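(* Let $q$ be a power of an odd prime and let $n\ge 1$. Let $g$ be a real element of $\mathrm{U}(n,\mathbb{F}_q)$. Then $g$ is strongly real in $\mathrm{U}(n,\mathbb{F}_q)$ if and only if every elementary divisor of $g$ of the form $(t-1)^{2m}$ or $(t+1)^{2m}$ (with $m\ge 1$) occurs with even multiplicity.
   Context: For a prime power $q$ write $\bar a=a^q$ for $a\in\mathbb{F}_{q^2}$, and apply the bar entrywise to matrices. The finite unitary group is $\mathrm{U}(n,\mathbb{F}_q)=\{g\in \mathrm{GL}(n,\mathbb{F}_{q^2}) : {}^{\top}\bar g\, g=I_n\}$; up to isomorphism it is the isometry group of any non-degenerate Hermitian form on an $n$-dimensional $\mathbb{F}_{q^2}$-vector space. An element $g$ of a group $G$ is real in $G$ if it is conjugate in $G$ to $g^{-1}$; it is strongly real in $G$ if there is $s\in G$ with $s^2=1$ and $sgs=g^{-1}$. The multiplicity of $(t\mp 1)^{k}$ as an elementary divisor of $g$ is the number of Jordan blocks of $g$ of size $k$ with eigenvalue $\pm1$ (multiplicity $0$, which is even, is allowed). *)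

theory Defs
  imports
    "Jordan_Normal_Form.Jordan_Normal_Form_Existence"
    "Jordan_Normal_Form.Jordan_Normal_Form_Uniqueness"
    "Jordan_Normal_Form.DL_Rank"
    "HOL-Algebra.Algebraic_Closure_Type"
    "HOL-Library.Cardinality"
    "HOL-Number_Theory.Residues"
begin

section \<open>Real and strongly real elements\<close>

definition real_in :: "('a, 'b) monoid_scheme \<Rightarrow> 'a \<Rightarrow> bool" where
  "real_in G g \<longleftrightarrow> g \<in> carrier G \<and>
     (\<exists>h \<in> carrier G. h \<otimes>\<^bsub>G\<^esub> g \<otimes>\<^bsub>G\<^esub> inv\<^bsub>G\<^esub> h = inv\<^bsub>G\<^esub> g)"

definition strongly_real_in :: "('a, 'b) monoid_scheme \<Rightarrow> 'a \<Rightarrow> bool" where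
  "strongly_real_in G g \<longleftrightarrow> g \<in> carrier G \<and>
     (\<exists>s \<in> carrier G. s [^]\<^bsub>G\<^esub> (2::nat) = \<one>\<^bsub>G\<^esub> \<and> s \<otimes>\<^bsub>G\<^esub> g \<otimes>\<^bsub>G\<^esub> s = inv\<^bsub>G\<^esub> g)"


section \<open>The finite unitary group\<close>

definition GL :: "nat \<Rightarrow> 'a :: field mat monoid" where
  "GL n = units_of (ring_mat TYPE('a) n ())"

definition bar_mat :: "nat \<Rightarrow> 'a :: field mat \<Rightarrow> 'a mat" where
  "bar_mat q A = map_mat (\<lambda>a. a ^ q) A"

text \<open>The group \<open>U(n, F\<^sub>q)\<close> when \<open>'a\<close> is a field with \<open>q\<^sup>2\<close> elements; for other \<open>q\<close> the
  definition has no meaning.\<close>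
definition unitary_group :: "nat \<Rightarrow> nat \<Rightarrow> 'a :: field mat monoid" where
  "unitary_group n q =
     (GL n)\<lparr>carrier := {g \<in> carrier (GL n). transpose_mat (bar_mat q g) * g = 1\<^sub>m n}\<rparr>"

lemma group_GL: "group (GL n :: 'a :: field mat monoid)"
proof -
  interpret R: ring "ring_mat TYPE('a) n ()" by (rule ring_mat)
  show ?thesis unfolding GL_def by (rule R.units_group)
qed

lemma GL_simps:
  "mult (GL n) = ((*) :: 'a :: field mat \<Rightarrow> _)"
  "one (GL n) = (1\<^sub>m n :: 'a :: field mat)"
  "carrier (GL n) = Units (ring_mat TYPE('a :: field) n ())"
  by (auto simp: GL_def units_of_def ring_mat_simps)

lemma carrier_GL_iff:
  "g \<in> carrier (GL n) \<longleftrightarrow> g \<in> carrier_mat n n \<and> det g \<noteq> (0 :: 'a :: field)"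
  using det_non_zero_imp_unit[of g n "()"] unit_imp_det_non_zero[of g n "()"]
  by (auto simp: GL_simps Units_def ring_mat_simps)

lemma bar_mat_mult:
  fixes A B :: "'a :: finite_field mat"
  assumes "Factorial_Ring.prime p" "q = p ^ k" "CARD('a) = q\<^sup>2"
    and A: "A \<in> carrier_mat n n" and B: "B \<in> carrier_mat n n"
  shows "bar_mat q (A * B) = bar_mat q A * bar_mat q B"
proof -
  have pr: "Factorial_Ring.prime CHAR('a)" by (rule prime_CHAR_semidom) (rule finite_imp_CHAR_pos, simp)
  have "CHAR('a) dvd q\<^sup>2" using CHAR_dvd_CARD[where 'a = 'a] assms by simp
  hence "CHAR('a) = p"
    using assms pr by (metis prime_dvd_power primes_dvd_imp_eq)
  hence q: "q = CHAR('a) ^ k" using assms by simp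
  have q0: "q > 0" using assms by (simp add: prime_gt_0_nat)
  interpret semiring_hom "\<lambda>a :: 'a. a ^ q"
    by standard (use q0 in \<open>auto simp: power_mult_distrib freshmans_dream'[OF pr q]\<close>)
  show ?thesis unfolding bar_mat_def by (rule mat_hom_mult[OF A B])
qed

lemma group_unitary_group:
  assumes "Factorial_Ring.prime p" "q = p ^ k" "CARD('a :: finite_field) = q\<^sup>2"
  shows "group (unitary_group n q :: 'a mat monoid)"
proof -
  let ?G = "GL n :: 'a mat monoid"
  let ?H = "{g \<in> carrier ?G. transpose_mat (bar_mat q g) * g = 1\<^sub>m n}"
  interpret G: group ?G by (rule group_GL)
  note bm = bar_mat_mult[OF assms]
  have q0: "q > 0" using assms by (simp add: prime_gt_0_nat)
  have one: "bar_mat q (1\<^sub>m n) = (1\<^sub>m n :: 'a mat)"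
    using q0 by (intro eq_matI) (auto simp: bar_mat_def)
  have c: "x \<in> carrier_mat n n" "bar_mat q x \<in> carrier_mat n n"
    "transpose_mat (bar_mat q x) \<in> carrier_mat n n" if "x \<in> carrier ?G" for x
    using that by (auto simp: carrier_GL_iff bar_mat_def)
  have mult: "transpose_mat (bar_mat q (x * y)) * (x * y) = 1\<^sub>m n"
    if x: "x \<in> ?H" and y: "y \<in> carrier ?G" "transpose_mat (bar_mat q y) * y = 1\<^sub>m n" for x y
  proof -
    have xc: "x \<in> carrier ?G" and xx: "transpose_mat (bar_mat q x) * x = 1\<^sub>m n" using x by auto
    note cx = c[OF xc] and cy = c[OF y(1)]
    have "transpose_mat (bar_mat q (x * y)) * (x * y)
        = (transpose_mat (bar_mat q y) * transpose_mat (bar_mat q x)) * (x * y)"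
      using cx cy by (simp add: bm[OF cx(1) cy(1)] transpose_mult)
    also have "\<dots> = transpose_mat (bar_mat q y) * (transpose_mat (bar_mat q x) * (x * y))"
      by (rule assoc_mult_mat[OF cy(3) cx(3)]) (use cx cy in auto)
    also have "transpose_mat (bar_mat q x) * (x * y) = y"
      by (subst assoc_mult_mat[symmetric, OF cx(3) cx(1) cy(1)]) (use xx cy in simp)
    finally show ?thesis using y by simp
  qed
  have "subgroup ?H ?G"
  proof (rule G.subgroupI)
    show "?H \<subseteq> carrier ?G" by blast
    show "?H \<noteq> {}" using one G.one_closed by (auto simp: GL_simps)
    fix x assume x: "x \<in> ?H"
    define y where "y = inv\<^bsub>?G\<^esub> x"
    have xc: "x \<in> carrier ?G" and xx: "transpose_mat (bar_mat q x) * x = 1\<^sub>m n" using x by auto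
    have yc: "y \<in> carrier ?G" using G.inv_closed[OF xc] by (simp add: y_def)
    have xy: "x * y = 1\<^sub>m n" using G.r_inv[OF xc] by (simp add: y_def GL_simps)
    note cx = c[OF xc] and cy = c[OF yc]
    have "y = transpose_mat (bar_mat q x) * x * y"
      using xx cy by simp
    also have "\<dots> = transpose_mat (bar_mat q x)"
      by (subst assoc_mult_mat[OF cx(3) cx(1) cy(1)]) (use xy cx in simp)
    finally have y: "y = transpose_mat (bar_mat q x)" .
    have "transpose_mat (bar_mat q y) * y = transpose_mat (bar_mat q y) * transpose_mat (bar_mat q x)"
      using y by simp
    also have "\<dots> = transpose_mat (bar_mat q (x * y))"
      using cx cy by (simp add: bm[OF cx(1) cy(1)] transpose_mult)
    finally show "inv\<^bsub>?G\<^esub> x \<in> ?H" using xy one yc by (auto simp: y_def)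
  next
    fix x y assume "x \<in> ?H" "y \<in> ?H"
    thus "x \<otimes>\<^bsub>?G\<^esub> y \<in> ?H" using mult[of x y] G.m_closed[of x y] by (auto simp: GL_simps)
  qed
  from G.subgroup_imp_group[OF this] show ?thesis unfolding unitary_group_def .
qed


section \<open>Multiplicities of elementary divisors\<close>

text \<open>The multiplicity of \<open>(t - \<epsilon>)\<^sup>k\<close> as an elementary divisor of \<open>g\<close>, i.e. the number of
  Jordan blocks of size \<open>k\<close> with eigenvalue \<open>\<epsilon>\<close>.  The other eigenvalues of \<open>g\<close> need not lie in
  the ground field, so the Jordan normal form is taken over the algebraic closure. It exists
  and the choice is immaterial, see \<open>jordan_nf_exists_alg_closed\<close> and
  \<open>elementary_divisor_mult_eq\<close> below.\<close>
definition elementary_divisor_mult :: "'a :: field mat \<Rightarrow> 'a \<Rightarrow> nat \<Rightarrow> nat" where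
  "elementary_divisor_mult g \<epsilon> k =
     count_list (SOME n_as. jordan_nf (map_mat to_ac g) n_as) (k, to_ac \<epsilon>)"

lemma ex_invertible_first_col:
  fixes v :: "'a :: field vec"
  assumes v: "v \<in> carrier_vec n" "v \<noteq> 0\<^sub>v n" and n: "n > 0"
  obtains V W where "V \<in> carrier_mat n n" "W \<in> carrier_mat n n"
    "V * W = 1\<^sub>m n" "W * V = 1\<^sub>m n" "col W 0 = v"
proof -
  interpret vec_space "TYPE('a)" n .
  note bc = basis_completion[OF v]
  define W where "W = mat_of_cols n (basis_completion v)"
  have W: "W \<in> carrier_mat n n"
    using mat_of_cols_carrier(1)[of n "basis_completion v"] unfolding W_def bc(6) .
  have cols: "cols W = basis_completion v" unfolding W_def using bc(2) by (rule cols_mat_of_cols)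
  have "rank W = n" by (rule lin_indpt_full_rank[OF W]; unfold cols; rule bc)
  hence "det W \<noteq> 0" unfolding det_rank_iff[OF W] .
  from det_non_zero_imp_unit[OF W this, of "()"] obtain V where V: "V \<in> carrier_mat n n"
    and VW: "V * W = 1\<^sub>m n" and WV: "W * V = 1\<^sub>m n"
    unfolding Units_def ring_mat_simps by blast
  have "basis_completion v ! 0 = col W 0"
    unfolding cols[symmetric] by (rule cols_nth) (unfold carrier_matD(2)[OF W], rule n)
  moreover have "basis_completion v ! 0 = v"
    by (simp add: basis_completion_def Let_def)
  ultimately show thesis using that[OF V W VW WV] by argo
qed

lemma upper_triangular_exists_alg_closed:
  fixes A :: "'a :: alg_closed_field mat"
  assumes "A \<in> carrier_mat n n"
  shows "\<exists>B \<in> carrier_mat n n. upper_triangular B \<and> similar_mat A B"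
  using assms
proof (induction n arbitrary: A)
  case 0
  hence "upper_triangular A" by auto
  with 0 similar_mat_refl[OF 0] show ?case by blast
next
  case (Suc n)
  let ?N = "Suc n"
  note A = Suc.prems
  have "Polynomial.degree (char_poly A) > 0" using degree_monic_char_poly[OF A] by simp
  from alg_closed_imp_poly_has_root[OF this] obtain e where "Polynomial.poly (char_poly A) e = 0" ..
  hence "eigenvalue A e" using eigenvalue_root_char_poly[OF A] by blast
  then obtain v where "eigenvector A v e" unfolding eigenvalue_def ..
  hence v: "v \<in> carrier_vec ?N" "v \<noteq> 0\<^sub>v ?N" and Av: "A *\<^sub>v v = e \<cdot>\<^sub>v v"
    unfolding eigenvector_def carrier_matD(1)[OF A] by blast+
  obtain V W where V: "V \<in> carrier_mat ?N ?N" and W: "W \<in> carrier_mat ?N ?N"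
    and VW: "V * W = 1\<^sub>m ?N" and WV: "W * V = 1\<^sub>m ?N" and colW: "col W 0 = v"
    using ex_invertible_first_col[OF v] by blast
  define A' where "A' = V * A * W"
  have A': "A' \<in> carrier_mat ?N ?N" using A V W by (simp add: A'_def)
  have simA': "similar_mat A' A"
    
  proof (rule similar_matI[of _ _ V W ?N])
    show "{A', A, V, W} \<subseteq> carrier_mat ?N ?N" using A A' V W by blast
  qed (fact VW WV A'_def)+
  have "col A' 0 = (V * A) *\<^sub>v v"
    unfolding A'_def using colW W V A by (subst col_mult2[of _ ?N ?N _ ?N]) auto
  also have "\<dots> = V *\<^sub>v (e \<cdot>\<^sub>v v)" using assoc_mult_mat_vec[OF V A v(1)] Av by simp
  also have "\<dots> = e \<cdot>\<^sub>v (V *\<^sub>v v)" using V v by (simp add: mult_mat_vec)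
  also have "V *\<^sub>v v = col (V * W) 0"
    using colW W V by (subst col_mult2[of _ ?N ?N _ ?N]) auto
  finally have col: "col A' 0 = e \<cdot>\<^sub>v unit_vec ?N 0" by (simp add: VW)
  obtain A1 A2 A0 A3 where split: "split_block A' 1 1 = (A1, A2, A0, A3)"
    by (cases "split_block A' 1 1") auto
  have dims: "dim_row A' = 1 + n" "dim_col A' = 1 + n" using A' by auto
  note sb = split_block[OF split dims]
  have "A' $$ (Suc i, 0) = 0" if "i < n" for i
    using arg_cong[OF col, of "\<lambda>u. vec_index u (Suc i)"] A' that by auto
  hence A0: "A0 = 0\<^sub>m n 1"
    using split A' by (auto simp: split_block_def Let_def)
  from Suc.IH[OF sb(4)] obtain B3 where B3: "B3 \<in> carrier_mat n n" "upper_triangular B3"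
    "similar_mat A3 B3" by blast
  from similar_mat_four_block_0_ex[OF similar_mat_refl[OF sb(1)] B3(3) sb(2) sb(1) sb(4)]
  obtain B2 where B2: "B2 \<in> carrier_mat 1 n"
    and sim: "similar_mat A' (four_block_mat A1 B2 (0\<^sub>m n 1) B3)"
    using sb(5) A0 by auto
  have "upper_triangular A1" using sb(1) by auto
  hence "upper_triangular (four_block_mat A1 B2 (0\<^sub>m n 1) B3)"
    by (rule upper_triangular_four_block[OF sb(1) B3(1) _ B3(2)])
  moreover have "four_block_mat A1 B2 (0\<^sub>m n 1) B3 \<in> carrier_mat ?N ?N"
    using four_block_carrier_mat[OF sb(1) B3(1)] by simp
  moreover have "similar_mat A (four_block_mat A1 B2 (0\<^sub>m n 1) B3)"
    using similar_mat_trans[OF similar_mat_sym[OF simA'] sim] .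
  ultimately show ?case by blast
qed

lemma jordan_nf_exists_alg_closed:
  fixes A :: "'a :: alg_closed_field mat"
  assumes A: "A \<in> carrier_mat n n"
  shows "\<exists>n_as. jordan_nf A n_as"
proof -
  obtain B where "B \<in> carrier_mat n n" "upper_triangular B" "similar_mat A B"
    using upper_triangular_exists_alg_closed[OF A] by blast
  with triangular_to_jnf_vector[of B n] show ?thesis
    by (auto simp: jordan_nf_def intro: similar_mat_trans)
qed

lemma elementary_divisor_mult_eq:
  fixes g :: "'a :: field mat"
  assumes jnf: "jordan_nf (map_mat to_ac g) n_as"
  shows "elementary_divisor_mult g \<epsilon> k = count_list n_as (k, to_ac \<epsilon>)"
proof (cases "k = 0")
  case False
  have "jordan_nf (map_mat to_ac g) (SOME n_as. jordan_nf (map_mat to_ac g) n_as)"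
    using jnf by (rule someI)
  from compute_nr_of_jordan_blocks[OF this False] compute_nr_of_jordan_blocks[OF jnf False]
  show ?thesis by (simp add: elementary_divisor_mult_def count_list_eq_length_filter)
next
  case True
  have "count_list l (0, a) = 0" if "jordan_nf (map_mat to_ac g) l" for l a
    using that by (force simp: jordan_nf_def count_list_0_iff)
  from this[OF jnf] this[OF someI[of "jordan_nf (map_mat to_ac g)", OF jnf]] True
  show ?thesis by (simp add: elementary_divisor_mult_def)
qed

end

theory Submission
  imports Defs "HOL-Library.Function_Algebras"
begin

text \<open>
  The heart of the matter is a statement about Hermitian forms over a finite field with an involution
  \<open>bar\<close> in odd characteristic. Let \<open>g\<close> be unitary without the eigenvalue \<open>1\<close>, and let \<open>bar \<iota> = - \<iota>\<close>. The
  Cayley transform \<open>T = \<iota> (g + 1) (g - 1)\<^sup>-\<^sup>1\<close> is self-adjoint, and passing from \<open>g\<close> to its inverse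
  amounts to passing from \<open>T\<close> to \<open>- T\<close>. So \<open>g\<close> is strongly real if and only if there is a flip of \<open>T\<close>, that
  is, a unitary involution that anticommutes with \<open>T\<close>. Jordan blocks of \<open>g\<close> with eigenvalue \<open>-1\<close> become
  nilpotent blocks of \<open>T\<close> of the same size. On the generalised eigenspace of \<open>1\<close> the same is done with
  \<open>- g\<close>; both parts are put together in \<open>involution_iff_even_jumps\<close>.

  A flip forces even multiplicities (\<open>flips_even_blocks\<close>): an odd power of \<open>T\<close> interchanges the two
  eigenspaces of the flip, and its two halves are adjoint to each other, so its rank is even. The ranks of
  all odd powers determine the parity of the number of nilpotent blocks of each even size.

  Conversely, suppose that \<open>T\<close> and \<open>- T\<close> have the same elementary divisors and that nilpotent
  blocks of even size occur with even multiplicity. A flip is built by induction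
  (\<open>ex_flips\<close>). For an irreducible \<open>f\<close> over the fixed field, a vector \<open>x\<close> of maximal exponent in the
  \<open>f\<close>-primary part with \<open>B (f\<^sup>e(T) x) x \<noteq> 0\<close> generates a nondegenerate cyclic subspace, which is determined
  up to isometry by the functional \<open>\<theta> p = B (p(T) x) x\<close>. Replacing \<open>x\<close> by \<open>b(T) x\<close> multiplies \<open>\<theta>\<close> by
  the norm of \<open>b\<close>, and over a finite field every real unit is a norm (\<open>norm_surj_mod_power\<close>), so \<open>\<theta>\<close> can be
  adjusted at will (\<open>rescale\<close>). If \<open>f\<close> is invariant under \<open>t \<mapsto> - t\<close>, then \<open>\<theta>\<close> can be made invariant as
  well, and \<open>p(T) x \<mapsto> p(-T) x\<close> is a flip (\<open>ex_cyclic_summand\<close>); for \<open>f = t\<close> this needs a block of odd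
  size. Otherwise there is a second vector \<open>y\<close>, orthogonal to the cyclic subspace of \<open>x\<close>, for
  \<open>f(-t)\<close> and the same exponent, and a flip interchanges \<open>p(T) x\<close> and \<open>p(-T) y\<close>
  (\<open>ex_pair_summand\<close>). For blocks of even size with \<open>f = t\<close> it is the even multiplicity that
  provides \<open>y\<close>.

  Then one continues in the orthogonal complement. The conditions on elementary divisors are conditions on
  the sizes of kernels of polynomials in \<open>T\<close>. These are multiplicative along orthogonal sums, and the
  summand satisfies the conditions because it has a flip, so its complement does too.
\<close>

hide_const (open) Module.smult UnivPoly.deg

abbreviation (input) deg :: "'a::zero poly \<Rightarrow> nat" where "deg \<equiv> Polynomial.degree"

section \<open>Polynomials over a field with an involution\<close>

text \<open>The example in mind is the field with \<open>q\<^sup>2\<close> elements and \<open>bar a = a\<^sup>q\<close>. The element \<open>\<iota>\<close> is an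
  imaginary unit: conjugation changes its sign, so every polynomial is \<open>p\<^sub>1 + \<iota> p\<^sub>2\<close> with
  \<open>p\<^sub>1\<close> and \<open>p\<^sub>2\<close> fixed by conjugation of the coefficients.\<close>
locale conj_field =
  fixes bar :: "'a::{field,finite} \<Rightarrow> 'a" and \<iota> :: 'a
  assumes bar_add: "bar (a + b) = bar a + bar b"
    and bar_mult: "bar (a * b) = bar a * bar b"
    and bar_bar [simp]: "bar (bar a) = a"
    and bar_iota: "bar \<iota> = - \<iota>"
    and iota_nz: "\<iota> \<noteq> 0"
    and two_nz: "(2::'a) \<noteq> 0"
begin

lemma bar_0 [simp]: "bar 0 = 0"
  using bar_add[of 0 0] by (metis add.right_neutral add_left_cancel)

lemma bar_eq_0_iff [simp]: "bar a = 0 \<longleftrightarrow> a = 0"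
  by (metis bar_0 bar_bar)

lemma bar_1 [simp]: "bar 1 = 1"
  using bar_mult[of 1 1] bar_eq_0_iff[of 1] by simp

lemma bar_minus: "bar (- a) = - bar a"
  using bar_add[of a "- a"] by (simp add: eq_neg_iff_add_eq_0 add.commute)

lemma bar_diff: "bar (a - b) = bar a - bar b"
  using bar_add[of a "- b"] by (simp add: bar_minus)

lemma bar_sum: "bar (sum f A) = (\<Sum>x\<in>A. bar (f x))"
  by (induction A rule: infinite_finite_induct) (auto simp: bar_add)

definition pbar :: "'a poly \<Rightarrow> 'a poly" where "pbar p = map_poly bar p"

lemma coeff_pbar [simp]: "poly.coeff (pbar p) i = bar (poly.coeff p i)"
  by (simp add: pbar_def coeff_map_poly)

lemma pbar_add: "pbar (p + q) = pbar p + pbar q"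
  by (rule poly_eqI) (simp add: bar_add)

lemma pbar_diff: "pbar (p - q) = pbar p - pbar q"
  by (rule poly_eqI) (simp add: bar_diff)

lemma pbar_mult: "pbar (p * q) = pbar p * pbar q"
  by (rule poly_eqI) (simp add: coeff_mult bar_sum bar_mult)

lemma pbar_smult: "pbar (smult c p) = smult (bar c) (pbar p)"
  by (rule poly_eqI) (simp add: bar_mult)

lemma pbar_pCons: "pbar (pCons c p) = pCons (bar c) (pbar p)"
  by (rule poly_eqI) (simp add: coeff_pCons split: nat.split)

lemma pbar_pbar [simp]: "pbar (pbar p) = p"
  by (rule poly_eqI) simp

lemma pbar_0 [simp]: "pbar 0 = 0" and pbar_1 [simp]: "pbar 1 = 1"
  by (simp_all add: pbar_def)

lemma pbar_power: "pbar (p ^ n) = pbar p ^ n"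
  by (induction n) (auto simp: pbar_mult)

text \<open>The polynomials over the fixed field of \<open>bar\<close>. They are kept inside the polynomials over the
  whole field, which avoids a second coefficient type.\<close>
abbreviation preal :: "'a poly \<Rightarrow> bool" where "preal p \<equiv> pbar p = p"

definition pneg :: "'a poly \<Rightarrow> 'a poly" where "pneg p = pcompose p [:0, -1:]"

lemma coeff_pneg: "poly.coeff (pneg p) i = (- 1) ^ i * poly.coeff p i"
  by (simp add: pneg_def coeff_pcompose_linear)

lemma pneg_add: "pneg (p + q) = pneg p + pneg q" by (simp add: pneg_def pcompose_add)
lemma pneg_diff: "pneg (p - q) = pneg p - pneg q" by (simp add: pneg_def pcompose_diff)
lemma pneg_mult: "pneg (p * q) = pneg p * pneg q" by (simp add: pneg_def pcompose_mult)
lemma pneg_smult: "pneg (smult c p) = smult c (pneg p)" by (simp add: pneg_def pcompose_smult)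
lemma pneg_0 [simp]: "pneg 0 = 0" by (simp add: pneg_def)
lemma pneg_1 [simp]: "pneg 1 = 1" by (simp add: pneg_def pcompose_1)
lemma pneg_power: "pneg (p ^ n) = pneg p ^ n" by (induction n) (auto simp: pneg_mult)

lemma pneg_pneg [simp]: "pneg (pneg p) = p"
  by (rule poly_eqI) (simp add: coeff_pneg flip: power_mult_distrib)

lemma pneg_pCons: "pneg (pCons a p) = pCons a (- pneg p)"
  by (rule poly_eqI) (auto simp: coeff_pneg coeff_pCons split: nat.split)

lemma pbar_pneg: "pbar (pneg p) = pneg (pbar p)"
proof -
  have "bar ((- 1) ^ i) = (- 1) ^ i" for i
    by (induction i) (auto simp: bar_minus bar_mult)
  thus ?thesis by (intro poly_eqI) (simp add: coeff_pneg bar_mult)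
qed

lemma deg_pneg [simp]: "deg (pneg p) = deg p"
  by (simp add: pneg_def degree_pcompose)

lemma pneg_dvd_iff [simp]: "pneg p dvd pneg q \<longleftrightarrow> p dvd q"
  by (metis dvd_def pneg_mult pneg_pneg)

lemma preal_mod:
  assumes "preal p" "preal f" shows "preal (p mod f)" "preal (p div f)"
proof -
  have "preal (p mod f) \<and> preal (p div f)"
  proof (cases "f = 0")
    case True
    thus ?thesis using assms by simp
  next
    case False
    define d r where "d = pbar (p div f)" and "r = pbar (p mod f)"
    have "pbar (p div f * f + p mod f) = d * f + r"
      by (simp only: d_def r_def pbar_add pbar_mult assms(2))
    hence e: "p = d * f + r" by (simp add: assms(1))
    have "r = 0 \<or> deg r < deg f"
      using degree_mod_less[OF False, of p]
      by (auto simp: r_def pbar_def degree_map_poly)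
    hence r: "r mod f = r" by (auto simp: mod_poly_less)
    have "p mod f = r mod f" by (subst e) simp
    hence pm: "p mod f = r" using r by simp
    have "p = p div f * f + r" unfolding pm[symmetric] by simp
    hence "p div f * f + r = d * f + r" using e by argo
    hence "p div f = d" using False by simp
    thus ?thesis using pm unfolding d_def r_def by simp
  qed
  thus "preal (p mod f)" "preal (p div f)" by blast+
qed

text \<open>Irreducibility over the fixed field only: over the whole field such a polynomial may split
  into two conjugate factors.\<close>
definition irred :: "'a poly \<Rightarrow> bool" where
  "irred f \<longleftrightarrow> preal f \<and> deg f > 0 \<and> (\<forall>g. preal g \<longrightarrow> g dvd f \<longrightarrow> deg g = 0 \<or> deg g = deg f)"

lemma irred_pneg: assumes "irred f" shows "irred (pneg f)"
  unfolding irred_def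
proof (intro conjI allI impI)
  show "preal (pneg f)" "deg (pneg f) > 0" using assms by (auto simp: irred_def pbar_pneg)
  fix g assume g: "preal g" "g dvd pneg f"
  have "preal (pneg g)" "pneg g dvd f" using g pneg_dvd_iff[of "pneg g" f] by (auto simp: pbar_pneg)
  moreover have "\<forall>g. preal g \<longrightarrow> g dvd f \<longrightarrow> deg g = 0 \<or> deg g = deg f" using assms by (simp add: irred_def)
  ultimately have "deg (pneg g) = 0 \<or> deg (pneg g) = deg f" by blast
  thus "deg g = 0 \<or> deg g = deg (pneg f)" by simp
qed

lemma irred_nz: "irred f \<Longrightarrow> f \<noteq> 0" by (auto simp: irred_def)

text \<open>Division with remainder does not leave the real polynomials. A nonzero real combination of
  \<open>p\<close> and \<open>f\<close> of least degree therefore divides both, and it is constant because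
  \<open>f\<close> is irreducible and does not divide \<open>p\<close>.\<close>
lemma irred_bezout:
  assumes f: "irred f" and p: "preal p" and nd: "\<not> f dvd p"
  shows "\<exists>r s. preal r \<and> preal s \<and> r * p + s * f = 1"
proof -
  define I where "I = {d. \<exists>r s. preal r \<and> preal s \<and> d = r * p + s * f}"
  have pf: "preal f" and fnz: "f \<noteq> 0" using f irred_nz by (auto simp: irred_def)
  have Ireal: "preal d" if "d \<in> I" for d
    using that p pf unfolding I_def by (clarsimp simp: pbar_add pbar_mult)
  have fI: "f \<in> I" and pI: "p \<in> I"
    unfolding I_def by (force intro: exI[of _ 0] exI[of _ 1])+
  have "\<exists>d. d \<in> I \<and> d \<noteq> 0" using fI fnz by blast
  from exists_least_iff[of "\<lambda>k. \<exists>d. d \<in> I \<and> d \<noteq> 0 \<and> deg d = k"] this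
  obtain d where d: "d \<in> I" "d \<noteq> 0" and least: "\<And>d'. d' \<in> I \<Longrightarrow> d' \<noteq> 0 \<Longrightarrow> \<not> deg d' < deg d"
    by blast
  have dvd: "d dvd a" if a: "a \<in> I" for a
  proof -
    obtain r s r' s' where rs: "preal r" "preal s" "a = r * p + s * f"
      and rs': "preal r'" "preal s'" "d = r' * p + s' * f" using a d(1) unfolding I_def by blast
    define c where "c = a div d"
    have c: "preal c" using preal_mod(2) Ireal a d by (simp add: c_def)
    have "a mod d = a - c * d" unfolding c_def by (rule minus_div_mult_eq_mod[symmetric])
    also have "\<dots> = (r * p + s * f) - c * (r' * p + s' * f)" by (simp only: rs(3)[symmetric] rs'(3)[symmetric])
    also have "\<dots> = (r - c * r') * p + (s - c * s') * f" by (simp add: algebra_simps)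
    finally have "a mod d = (r - c * r') * p + (s - c * s') * f" .
    moreover have "preal (r - c * r')" "preal (s - c * s')"
      by (simp_all only: pbar_diff pbar_mult c rs(1,2) rs'(1,2))
    ultimately have "a mod d \<in> I" unfolding I_def by blast
    hence "a mod d = 0" using least[of "a mod d"] degree_mod_less[OF d(2), of a] by auto
    thus ?thesis by (simp add: dvd_eq_mod_eq_0)
  qed
  have "deg d = 0"
  proof (rule ccontr)
    assume "deg d \<noteq> 0"
    have "\<forall>g. preal g \<longrightarrow> g dvd f \<longrightarrow> deg g = 0 \<or> deg g = deg f" using f by (simp add: irred_def)
    from this[rule_format, OF Ireal[OF d(1)] dvd[OF fI]] \<open>deg d \<noteq> 0\<close>
    have df: "deg d = deg f" by simp
    obtain c where c: "f = d * c" using dvd[OF fI] ..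
    with fnz have "c \<noteq> 0" by auto
    hence "deg f = deg d + deg c" using c d(2) by (simp add: degree_mult_eq)
    hence "deg c = 0" using df by simp
    then obtain c0 where c0: "c = [:c0:]" by (rule degree_eq_zeroE)
    with \<open>c \<noteq> 0\<close> have "c0 \<noteq> 0" by auto
    hence "f dvd d" unfolding c c0 by (simp add: smult_dvd_iff)
    with dvd[OF pI] nd show False using dvd_trans by blast
  qed
  then obtain d0 where d0': "d = [:d0:]" by (rule degree_eq_zeroE)
  hence d0: "d = [:d0:]" "d0 \<noteq> 0" using d(2) by auto
  have d0r: "preal [:inverse d0:]"
  proof -
    have "bar d0 = d0" using Ireal[OF d(1)] d0 by (simp add: pbar_pCons)
    hence "bar (inverse d0) * d0 = 1" using bar_mult[of "inverse d0" d0] d0(2) by simp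
    hence "bar (inverse d0) = inverse d0" using d0(2) by (simp add: field_simps)
    thus ?thesis by (simp add: pbar_pCons)
  qed
  from d(1) obtain r s where rs: "preal r" "preal s" "d = r * p + s * f" unfolding I_def by blast
  have "([:inverse d0:] * r) * p + ([:inverse d0:] * s) * f = [:inverse d0:] * d"
    by (simp add: rs(3) algebra_simps smult_add_right)
  also have "\<dots> = 1" using d0 by (simp add: one_pCons)
  finally have "([:inverse d0:] * r) * p + ([:inverse d0:] * s) * f = 1" .
  moreover have "preal ([:inverse d0:] * r)" "preal ([:inverse d0:] * s)"
    using rs(1,2) d0r by (simp_all only: pbar_mult)
  ultimately show ?thesis by blast
qed

lemma irred_bezout_power:
  assumes "irred f" "preal p" "\<not> f dvd p"
  shows "\<exists>r s. preal r \<and> preal s \<and> r * p + s * f ^ e = 1"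
proof (induction e)
  case 0
  show ?case by (intro exI[of _ 0] exI[of _ 1]) auto
next
  case (Suc e)
  then obtain r s where rs: "preal r" "preal s" "r * p + s * f ^ e = 1" by blast
  obtain r' s' where rs': "preal r'" "preal s'" "r' * p + s' * f = 1"
    using irred_bezout[OF assms] by blast
  have pf: "preal f" using assms by (auto simp: irred_def)
  have "1 = (r * p + s * f ^ e) * (r' * p + s' * f)" using rs(3) rs'(3) by simp
  also have "\<dots> = (r * (r' * p + s' * f) + s * f ^ e * r') * p + s * s' * f ^ Suc e"
    by (simp add: algebra_simps)
  finally have "(r * (r' * p + s' * f) + s * f ^ e * r') * p + s * s' * f ^ Suc e = 1" by (rule sym)
  moreover have "preal (r * (r' * p + s' * f) + s * f ^ e * r')" "preal (s * s')"
    using rs rs' pf assms(2) by (simp_all add: pbar_add pbar_mult pbar_power)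
  ultimately show ?case by blast
qed

text \<open>Only one of the two factors has to be real, because the Bezout identity for \<open>p\<close> and \<open>f\<close> may be
  multiplied by an arbitrary \<open>q\<close>.\<close>
lemma irred_dvd_mult:
  assumes "irred f" "preal p" "f dvd p * q" shows "f dvd p \<or> f dvd q"
proof (rule disjCI)
  assume "\<not> f dvd q"
  show "f dvd p"
  proof (rule ccontr)
    assume "\<not> f dvd p"
    then obtain r s where rs: "r * p + s * f = 1" using irred_bezout assms by blast
    have "f dvd r * (p * q) + s * q * f" using assms(3) by simp
    also have "r * (p * q) + s * q * f = (r * p + s * f) * q" by (simp add: algebra_simps)
    also have "\<dots> = q" by (simp add: rs)
    finally have "f dvd q" .
    with \<open>\<not> f dvd q\<close> show False ..
  qed
qed

section \<open>Norms modulo powers of irreducible real polynomials\<close>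

text \<open>Modulo \<open>f\<close> the real polynomials form a finite field, and more than half of its elements are
  squares. So the set of squares meets the equally large set of all \<open>w + \<iota>\<^sup>2 z\<^sup>2\<close>. The expression
  \<open>y\<^sup>2 - \<iota>\<^sup>2 z\<^sup>2\<close> is the norm of \<open>y + \<iota> z\<close>.\<close>
lemma norm_form_surj_mod_irred:
  assumes f: "irred f" and w: "preal w"
  shows "\<exists>y z. preal y \<and> preal z \<and> f dvd y ^ 2 - smult (\<iota> ^ 2) (z ^ 2) - w"
proof -
  define A where "A = {p. preal p \<and> p mod f = p}"
  have pf: "preal f" and fnz: "f \<noteq> 0" using f irred_nz by (auto simp: irred_def)
  have i2: "bar (\<iota> ^ 2) = \<iota> ^ 2" by (simp add: power2_eq_square bar_mult bar_iota)
  have i2nz: "\<iota> ^ 2 \<noteq> 0" using iota_nz by simp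
  have finA: "finite A"
  proof (rule finite_subset)
    show "A \<subseteq> Poly ` {xs. set xs \<subseteq> UNIV \<and> length xs \<le> deg f}"
    proof
      fix p assume "p \<in> A"
      hence "p mod f = p" by (simp add: A_def)
      hence "p = 0 \<or> deg p < deg f" using degree_mod_less[OF fnz, of p] by auto
      hence "length (coeffs p) \<le> deg f" 
        by (cases "p = 0") (simp_all add: length_coeffs_degree)
      moreover have "p = Poly (coeffs p)" by simp
      ultimately show "p \<in> Poly ` {xs. set xs \<subseteq> UNIV \<and> length xs \<le> deg f}" by blast
    qed
    show "finite (Poly ` {xs :: 'a list. set xs \<subseteq> UNIV \<and> length xs \<le> deg f})"
      by (intro finite_imageI finite_lists_length_le) simp
  qed
  have A0: "0 \<in> A" by (simp add: A_def)
  define S where "S = (\<lambda>y. y ^ 2 mod f) ` A"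
  have SA: "S \<subseteq> A" using preal_mod(1)[OF _ pf] by (auto simp: S_def A_def pbar_power)
  have dvdA: "p = 0" if "p \<in> A" "f dvd p" for p
    using that by (simp add: A_def dvd_eq_mod_eq_0)
  have cS: "card A < 2 * card S"
  proof -
    have "A - {0} \<subseteq> (\<Union>t\<in>S - {0}. {y \<in> A. y ^ 2 mod f = t})"
    proof
      fix y assume y: "y \<in> A - {0}"
      have "y ^ 2 mod f \<noteq> 0"
      proof
        assume "y ^ 2 mod f = 0"
        hence "f dvd y * y" by (simp add: dvd_eq_mod_eq_0 power2_eq_square)
        hence "f dvd y" using irred_dvd_mult[OF f] y unfolding A_def by blast
        thus False using dvdA y by blast
      qed
      thus "y \<in> (\<Union>t\<in>S - {0}. {y \<in> A. y ^ 2 mod f = t})" using y by (auto simp: S_def)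
    qed
    moreover have "card {y \<in> A. y ^ 2 mod f = t} \<le> 2" if tS: "t \<in> S" for t
    proof -
      obtain y where y: "y \<in> A" "y ^ 2 mod f = t" using tS unfolding S_def by blast
      have "{y \<in> A. y ^ 2 mod f = t} \<subseteq> {y, - y}"
      proof
        fix x assume "x \<in> {y \<in> A. y ^ 2 mod f = t}"
        hence x: "x \<in> A" "x ^ 2 mod f = t" by auto
        have "f dvd x ^ 2 - y ^ 2" using x(2) y(2) by (metis mod_eq_dvd_iff)
        hence d: "f dvd (x - y) * (x + y)" by (simp add: power2_eq_square algebra_simps)
        have m: "(x - y) mod f = x - y" "(x + y) mod f = x + y"
          using x(1) y(1) poly_mod_diff_left[of x y f] poly_mod_add_left[of x y f] by (auto simp: A_def)
        have r: "preal (x - y)" using x(1) y(1) by (simp add: A_def pbar_diff)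
        from irred_dvd_mult[OF f r d] m have "x - y = 0 \<or> x + y = 0" by (auto simp: dvd_eq_mod_eq_0)
        thus "x \<in> {y, - y}" by (auto simp: eq_neg_iff_add_eq_0)
      qed
      hence "card {y \<in> A. y ^ 2 mod f = t} \<le> card {y, - y}" by (intro card_mono) auto
      also have "\<dots> \<le> 2" by (simp add: card_insert_if)
      finally show ?thesis .
    qed
    moreover have finS: "finite S" using SA finA finite_subset by blast
    ultimately have "card (A - {0}) \<le> card (\<Union>t\<in>S - {0}. {y \<in> A. y ^ 2 mod f = t})"
      using finA by (intro card_mono) auto
    also have "\<dots> \<le> (\<Sum>t\<in>S - {0}. card {y \<in> A. y ^ 2 mod f = t})"
      using finS by (intro card_UN_le) simp
    also have "\<dots> \<le> (\<Sum>t\<in>S - {0}. 2)"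
      using \<open>\<And>t. t \<in> S \<Longrightarrow> card {y \<in> A. y ^ 2 mod f = t} \<le> 2\<close> by (intro sum_mono) auto
    also have "\<dots> = 2 * card (S - {0})" by simp
    finally have "card (A - {0}) \<le> 2 * card (S - {0})" .
    moreover have "0 \<in> S" unfolding S_def using A0 by (intro image_eqI[of _ _ 0]) auto
    ultimately have "card A - 1 \<le> 2 * (card S - 1)" "card A > 0" "card S > 0"
      using A0 finA finS by (auto simp: card_Diff_singleton card_gt_0_iff)
    thus ?thesis by linarith
  qed
  define T where "T = (\<lambda>t. (w + smult (\<iota> ^ 2) t) mod f) ` S"
  have TA: "T \<subseteq> A"
  proof
    fix t assume "t \<in> T"
    then obtain s where s: "s \<in> A" "t = (w + smult (\<iota> ^ 2) s) mod f" using SA by (auto simp: T_def)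
    have "preal (w + smult (\<iota> ^ 2) s)" using s(1) w by (simp add: A_def pbar_add pbar_smult i2)
    from preal_mod(1)[OF this pf] show "t \<in> A" by (simp add: s(2) A_def)
  qed
  have "inj_on (\<lambda>t. (w + smult (\<iota> ^ 2) t) mod f) S"
  proof (rule inj_onI)
    fix s t assume s: "s \<in> S" "t \<in> S" and e: "(w + smult (\<iota> ^ 2) s) mod f = (w + smult (\<iota> ^ 2) t) mod f"
    have "f dvd (w + smult (\<iota> ^ 2) s) - (w + smult (\<iota> ^ 2) t)" using e by (metis mod_eq_dvd_iff)
    hence "f dvd smult (\<iota> ^ 2) (s - t)" by (simp add: smult_diff_right)
    hence "f dvd s - t" using i2nz by (simp add: dvd_smult_iff)
    moreover have "s \<in> A" "t \<in> A" using s SA by blast+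
    hence "s - t \<in> A" using poly_mod_diff_left[of s t f] by (simp add: A_def pbar_diff)
    ultimately show "s = t" using dvdA by fastforce
  qed
  hence cT: "card T = card S" unfolding T_def by (rule card_image)
  have "S \<inter> T \<noteq> {}"
  proof
    assume "S \<inter> T = {}"
    hence "card (S \<union> T) = card S + card T" using SA TA finA by (meson card_Un_disjoint finite_subset)
    moreover have "card (S \<union> T) \<le> card A" using SA TA finA by (intro card_mono) auto
    ultimately show False using cS cT by simp
  qed
  then obtain y z where yz: "y \<in> A" "z \<in> A" "y ^ 2 mod f = (w + smult (\<iota> ^ 2) (z ^ 2 mod f)) mod f"
    by (auto simp: S_def T_def)
  have "y ^ 2 mod f = (w + smult (\<iota> ^ 2) (z ^ 2)) mod f"
    unfolding yz(3) by (simp add: poly_mod_add_left mod_smult_left)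
  hence "f dvd y ^ 2 - (w + smult (\<iota> ^ 2) (z ^ 2))" by (metis mod_eq_dvd_iff)
  moreover have "y ^ 2 - (w + smult (\<iota> ^ 2) (z ^ 2)) = y ^ 2 - smult (\<iota> ^ 2) (z ^ 2) - w" by simp
  ultimately show ?thesis using yz(1,2) unfolding A_def by auto
qed

lemma odd_CHAR_power: "odd (CHAR('a) ^ n)" and prime_CHAR: "Factorial_Ring.prime CHAR('a)"
proof -
  show p: "Factorial_Ring.prime CHAR('a)"
    by (rule prime_CHAR_semidom) (rule finite_imp_CHAR_pos, simp)
  have "CHAR('a) \<noteq> 2"
  proof
    assume "CHAR('a) = 2"
    hence "of_nat 2 = (0::'a)" by (metis of_nat_CHAR)
    thus False using two_nz by simp
  qed
  thus "odd (CHAR('a) ^ n)" using p by (metis even_power primes_dvd_imp_eq two_is_prime_nat)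
qed

text \<open>By the freshman's dream \<open>u\<^sup>P = 1\<close> modulo \<open>f\<^sup>e\<close> for a large power \<open>P\<close> of the characteristic.
  As \<open>P\<close> is odd, the power of \<open>u\<close> with exponent \<open>(P + 1) / 2\<close> is a square root of \<open>u\<close>. This
  takes the place of Hensel's lemma.\<close>
lemma principal_unit_square:
  assumes "preal u" "f dvd u - 1"
  shows "\<exists>\<eta>. preal \<eta> \<and> f ^ e dvd \<eta> ^ 2 - u"
proof -
  define P where "P = CHAR('a) ^ e"
  have oddP: "odd P" unfolding P_def by (rule odd_CHAR_power)
  have p: "Factorial_Ring.prime CHAR('a poly)" using prime_CHAR by simp
  have "e < P" unfolding P_def using prime_gt_1_nat[OF prime_CHAR] by (intro power_gt_expt) simp
  have "u ^ P = ((u - 1) + 1) ^ P" by simp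
  also have "\<dots> = (u - 1) ^ P + 1 ^ P" by (rule freshmans_dream'[OF p, of _ e]) (simp add: P_def)
  finally have "u ^ P - 1 = (u - 1) ^ P" by simp
  moreover have "f ^ e dvd (u - 1) ^ P"
    using assms(2) \<open>e < P\<close> by (meson dvd_power_same dvd_trans le_imp_power_dvd less_imp_le_nat)
  ultimately have "f ^ e dvd u * (u ^ P - 1)" by simp
  moreover have "(u ^ ((P + 1) div 2)) ^ 2 = u * u ^ P"
  proof -
    have "(P + 1) div 2 * 2 = Suc P" using oddP by presburger
    thus ?thesis by (simp only: power_mult[symmetric] power_Suc)
  qed
  ultimately have "f ^ e dvd (u ^ ((P + 1) div 2)) ^ 2 - u" by (simp add: algebra_simps)
  thus ?thesis using assms(1) pbar_power by metis
qed

text \<open>Modulo \<open>f\<close> the norm form represents \<open>w\<close>. Dividing \<open>w\<close> by the norm that was found leaves a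
  principal unit, which is the square of a real polynomial \<open>\<eta>\<close>, and \<open>\<eta>\<^sup>2\<close> is the norm of \<open>\<eta>\<close>.\<close>
lemma norm_surj_mod_power:
  assumes f: "irred f" and w: "preal w" and nd: "\<not> f dvd w"
  shows "\<exists>b. f ^ e dvd b * pbar b - w"
proof -
  obtain y z where yz: "preal y" "preal z" "f dvd y ^ 2 - smult (\<iota> ^ 2) (z ^ 2) - w"
    using norm_form_surj_mod_irred[OF f w] by blast
  define b where "b = y + smult \<iota> z"
  have pb: "pbar b = y - smult \<iota> z" by (simp add: b_def pbar_add pbar_smult yz(1,2) bar_iota)
  define N where "N = b * pbar b"
  have "N = y ^ 2 - smult (\<iota> ^ 2) (z ^ 2)"
    unfolding N_def pb unfolding b_def by (simp add: power2_eq_square algebra_simps)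
  hence fN: "f dvd N - w" using yz(3) by simp
  have rN: "preal N" by (simp add: N_def pbar_mult mult.commute)
  have "\<not> f dvd N" using dvd_diff[of f N "N - w"] fN nd by auto
  then obtain r s where rs: "preal r" "r * N + s * f ^ Suc e = 1"
    using irred_bezout_power[OF f rN] by blast
  define u where "u = w * r"
  have "u - 1 = - (r * (N - w)) - s * f ^ e * f"
    unfolding u_def rs(2)[symmetric] by (simp add: algebra_simps)
  hence "f dvd u - 1" using fN by simp
  moreover have ru: "preal u" by (simp add: u_def pbar_mult w rs)
  ultimately obtain \<eta> where \<eta>: "preal \<eta>" "f ^ e dvd \<eta> ^ 2 - u" using principal_unit_square by blast
  have "(b * \<eta>) * pbar (b * \<eta>) - w = N * (\<eta> ^ 2 - u) + w * (r * N - 1)"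
    by (simp add: N_def pbar_mult \<eta>(1) u_def power2_eq_square algebra_simps)
  also have "r * N - 1 = - (s * f * f ^ e)" using rs(2) by (simp add: algebra_simps)
  finally have "(b * \<eta>) * pbar (b * \<eta>) - w = N * (\<eta> ^ 2 - u) + w * - (s * f * f ^ e)" .
  moreover have "f ^ e dvd N * (\<eta> ^ 2 - u) + w * - (s * f * f ^ e)"
    using \<eta>(2) by (intro dvd_add dvd_mult) auto
  ultimately show ?thesis by metis
qed

section \<open>Linear functionals on the polynomial ring\<close>

definition functional :: "('a poly \<Rightarrow> 'a) \<Rightarrow> bool" where
  "functional \<theta> \<longleftrightarrow> (\<forall>p q. \<theta> (p + q) = \<theta> p + \<theta> q) \<and> (\<forall>c p. \<theta> (smult c p) = c * \<theta> p)"

lemma functional_0: "functional \<theta> \<Longrightarrow> \<theta> 0 = 0"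
  unfolding functional_def by (metis mult_zero_left smult_0_left)

lemma functional_add: "functional \<theta> \<Longrightarrow> \<theta> (p + q) = \<theta> p + \<theta> q"
  and functional_smult: "functional \<theta> \<Longrightarrow> \<theta> (smult c p) = c * \<theta> p"
  unfolding functional_def by blast+

lemma functional_diff: assumes "functional \<theta>" shows "\<theta> (p - q) = \<theta> p - \<theta> q"
  using functional_add[OF assms, of "p - q" q] by simp

lemma functional_sum: "functional \<theta> \<Longrightarrow> \<theta> (sum h I) = (\<Sum>i\<in>I. \<theta> (h i))"
  by (induction I rule: infinite_finite_induct) (auto simp: functional_0 functional_add)

lemma functional_zeroI:
  assumes th: "functional \<theta>" and F: "F \<noteq> 0" and vF: "\<And>p. \<theta> (F * p) = 0"
    and v: "\<And>i. i < deg F \<Longrightarrow> \<theta> (Polynomial.monom 1 i) = 0"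
  shows "\<theta> p = 0"
proof -
  have "\<theta> p = \<theta> (F * (p div F) + p mod F)" by simp
  also have "\<dots> = \<theta> (p mod F)" by (simp only: functional_add[OF th] vF) simp
  also have "p mod F = (\<Sum>i\<le>deg (p mod F). smult (poly.coeff (p mod F) i) (Polynomial.monom 1 i))"
    by (subst poly_as_sum_of_monoms[symmetric]) (simp add: smult_monom)
  also have "\<theta> \<dots> = (\<Sum>i\<le>deg (p mod F). poly.coeff (p mod F) i * \<theta> (Polynomial.monom 1 i))"
    by (simp add: functional_sum[OF th] functional_smult[OF th])
  also have "\<dots> = 0"
  proof (intro sum.neutral ballI)
    fix i assume "i \<in> {..deg (p mod F)}"
    hence "p mod F = 0 \<or> i < deg F" using degree_mod_less[OF F, of p] by auto
    thus "poly.coeff (p mod F) i * \<theta> (Polynomial.monom 1 i) = 0" using v by auto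
  qed
  finally show ?thesis .
qed

text \<open>The symmetric bilinear form \<open>(p, r) \<mapsto> \<theta> (p r)\<close> has the ideal generated by \<open>F\<close> as its radical,
  so that \<open>\<theta>\<close> identifies the residue ring modulo \<open>F\<close> with its dual.\<close>
definition radical_is :: "('a poly \<Rightarrow> 'a) \<Rightarrow> 'a poly \<Rightarrow> bool" where
  "radical_is \<theta> F \<longleftrightarrow> F \<noteq> 0 \<and> functional \<theta> \<and> (\<forall>p. \<theta> (F * p) = 0) \<and> (\<forall>p. (\<forall>r. \<theta> (p * r) = 0) \<longrightarrow> F dvd p)"

text \<open>Sending \<open>w\<close> to \<open>p \<mapsto> \<theta> (w p)\<close> is injective on the polynomials of degree below \<open>deg F\<close>, and a
  functional that vanishes on multiples of \<open>F\<close> is given by \<open>deg F\<close> field elements. Both sets have the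
  same finite size, so the map is onto.\<close>
lemma dual_repr:
  assumes ex: "radical_is \<theta> F" and ph: "functional \<phi>" and vph: "\<And>p. \<phi> (F * p) = 0"
  shows "\<exists>w. \<forall>p. \<phi> p = \<theta> (w * p)"
proof -
  have F: "F \<noteq> 0" and th: "functional \<theta>" and vth: "\<And>p. \<theta> (F * p) = 0"
    and ann: "\<And>p. (\<And>r. \<theta> (p * r) = 0) \<Longrightarrow> F dvd p" using ex by (auto simp: radical_is_def)
  define D where "D = deg F"
  define A where "A = {p :: 'a poly. \<forall>i\<ge>D. poly.coeff p i = 0}"
  define L where "L = {xs :: 'a list. length xs = D}"
  have finL: "finite L" using finite_lists_length_eq[of "UNIV :: 'a set" D] by (simp add: L_def)
  have plw: "functional (\<lambda>p. \<theta> (w * p))" for w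
    unfolding functional_def by (simp add: distrib_left functional_add[OF th] functional_smult[OF th])
  have bij: "bij_betw (\<lambda>p. map (poly.coeff p) [0..<D]) A L"
  proof (rule bij_betwI')
    fix p q assume pq: "p \<in> A" "q \<in> A"
    show "(map (poly.coeff p) [0..<D] = map (poly.coeff q) [0..<D]) \<longleftrightarrow> p = q"
    proof
      assume e: "map (poly.coeff p) [0..<D] = map (poly.coeff q) [0..<D]"
      show "p = q"
      proof (rule poly_eqI)
        fix i show "poly.coeff p i = poly.coeff q i"
          using e pq by (cases "i < D") (auto simp: A_def)
      qed
    qed simp
  next
    fix p show "p \<in> A \<Longrightarrow> map (poly.coeff p) [0..<D] \<in> L" by (simp add: L_def)
  next
    fix h assume h: "h \<in> L"
    have c: "poly.coeff (Poly h) i = (if i < D then h ! i else 0)" for i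
      using h by (simp add: L_def nth_default_def)
    have "Poly h \<in> A" using c by (simp add: A_def)
    moreover have "h = map (poly.coeff (Poly h)) [0..<D]"
      using h c by (intro nth_equalityI) (auto simp: L_def)
    ultimately show "\<exists>p\<in>A. h = map (poly.coeff p) [0..<D]" by blast
  qed
  define T where "T = (\<lambda>w. map (\<lambda>i. \<theta> (w * Polynomial.monom 1 i)) [0..<D])"
  have TA: "T ` A \<subseteq> L" by (auto simp: T_def L_def)
  have "inj_on T A"
  proof (rule inj_onI)
    fix p q assume pq: "p \<in> A" "q \<in> A" and e: "T p = T q"
    have "\<theta> ((p - q) * r) = 0" for r
    proof (rule functional_zeroI[OF plw F])
      show "\<theta> ((p - q) * (F * g)) = 0" for g using vth[of "(p - q) * g"] by (simp add: mult.left_commute)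
      fix i assume "i < deg F"
      thus "\<theta> ((p - q) * Polynomial.monom 1 i) = 0"
        using e by (simp add: T_def D_def left_diff_distrib functional_diff[OF th])
    qed
    hence d: "F dvd p - q" by (rule ann)
    have "\<forall>i\<ge>D. poly.coeff (p - q) i = 0" using pq by (simp add: A_def)
    hence "p - q = 0 \<or> deg (p - q) < D" by (metis leading_coeff_0_iff linorder_not_less)
    thus "p = q" using d F unfolding D_def by (metis dvd_imp_degree_le linorder_not_less right_minus_eq)
  qed
  hence "card (T ` A) = card L" using bij_betw_same_card[OF bij] by (simp add: card_image)
  hence TL: "T ` A = L" using TA finL card_subset_eq by blast
  have "map (\<lambda>i. \<phi> (Polynomial.monom 1 i)) [0..<D] \<in> L" by (simp add: L_def)
  then obtain w where w: "map (\<lambda>i. \<phi> (Polynomial.monom 1 i)) [0..<D] = T w" using TL by (metis imageE)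
  have pl: "functional (\<lambda>p. \<phi> p - \<theta> (w * p))"
    using ph plw[of w] unfolding functional_def by (simp add: algebra_simps)
  have "\<phi> p - \<theta> (w * p) = 0" for p
  proof (rule functional_zeroI[OF pl F])
    show "\<phi> (F * g) - \<theta> (w * (F * g)) = 0" for g
      using vth[of "w * g"] vph[of g] by (simp add: mult.left_commute)
    fix i assume "i < deg F"
    thus "\<phi> (Polynomial.monom 1 i) - \<theta> (w * Polynomial.monom 1 i) = 0"
      using w by (simp add: T_def D_def)
  qed
  thus ?thesis by auto
qed

definition equivar :: "('a poly \<Rightarrow> 'a) \<Rightarrow> bool" where
  "equivar \<theta> \<longleftrightarrow> (\<forall>p. \<theta> (pbar p) = bar (\<theta> p))"

text \<open>If \<open>w\<close> represents an equivariant functional, then so does its conjugate, and the average of the two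
  is real.\<close>
lemma dual_repr_real:
  assumes ex: "radical_is \<theta> F" and ph: "functional \<phi>" and vph: "\<And>p. \<phi> (F * p) = 0"
    and eq: "equivar \<theta>" "equivar \<phi>"
  shows "\<exists>w. preal w \<and> (\<forall>p. \<phi> p = \<theta> (w * p))"
proof -
  have th: "functional \<theta>" using ex by (simp add: radical_is_def)
  obtain w where w: "\<And>p. \<phi> p = \<theta> (w * p)" using dual_repr[OF ex ph vph] by blast
  have w': "\<phi> p = \<theta> (pbar w * p)" for p
    using w[of "pbar p"] eq by (metis bar_bar equivar_def pbar_mult pbar_pbar)
  define v where "v = smult (1 / 2) (w + pbar w)"
  have "bar (1 / 2) = 1 / 2"
  proof -
    have "bar (1 / 2) * bar 2 = bar (1 / 2 * 2)" by (simp only: bar_mult)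
    moreover have "bar 2 = 2" using bar_add[of 1 1] by simp
    ultimately have "bar (1 / 2) * 2 = 1" using two_nz by simp
    thus ?thesis using two_nz by (metis nonzero_eq_divide_eq)
  qed
  hence "preal v" by (simp only: v_def pbar_smult pbar_add pbar_pbar add.commute)
  moreover have "\<phi> p = \<theta> (v * p)" for p
    using two_nz by (simp add: v_def distrib_right functional_add[OF th] functional_smult[OF th] flip: w w')
  ultimately show ?thesis by blast
qed

text \<open>The radical is an ideal that is stable under conjugation, so it is enough to treat a real member
  \<open>p\<close>. If \<open>f\<close> divided \<open>p\<close> exactly \<open>j \<le> e\<close> times, then by Bezout \<open>f\<^sup>j\<close>, and with it \<open>f\<^sup>e\<close>, would belong to
  the radical as well.\<close>
lemma radical_isI:
  assumes f: "irred f" and th: "functional \<theta>" and eq: "equivar \<theta>"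
    and v: "\<And>p. \<theta> (f ^ Suc e * p) = 0" and nv: "\<theta> (f ^ e * g) \<noteq> 0"
  shows "radical_is \<theta> (f ^ Suc e)"
proof -
  have fnz: "f \<noteq> 0" and pf: "preal f" using f irred_nz by (auto simp: irred_def)
  have real: "f ^ j dvd p" if p: "preal p" "\<And>r. \<theta> (p * r) = 0" and "j \<le> Suc e" for p j
    using \<open>j \<le> Suc e\<close>
  proof (induction j)
    case (Suc j)
    then obtain p' where p': "p = f ^ j * p'" by (auto simp: dvd_def)
    have "f dvd p'"
    proof (rule ccontr)
      assume n: "\<not> f dvd p'"
      have "f ^ j * pbar p' = f ^ j * p'" using p(1) by (simp add: p' pbar_mult pbar_power pf)
      hence "preal p'" using fnz by simp
      then obtain r s where rs: "r * p' + s * f ^ Suc e = 1"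
        using irred_bezout_power[OF f _ n] by blast
      have "f ^ e = f ^ (e - j) * f ^ j" using Suc.prems by (simp flip: power_add)
      hence "f ^ e * g = f ^ (e - j) * f ^ j * g * (r * p' + s * f ^ Suc e)"
        by (simp only: rs mult_1_right)
      also have "\<dots> = p * (f ^ (e - j) * g * r) + f ^ Suc e * (f ^ (e - j) * f ^ j * g * s)"
        by (simp add: p' algebra_simps)
      finally have "\<theta> (f ^ e * g) = 0" by (simp only: functional_add[OF th] p(2) v) simp
      with nv show False ..
    qed
    thus ?case using p' by (simp add: mult.commute mult_dvd_mono)
  qed simp
  have "f ^ Suc e dvd p" if p: "\<And>r. \<theta> (p * r) = 0" for p
  proof -
    have pb: "\<theta> (pbar p * r) = 0" for r
      using eq p[of "pbar r"] by (metis bar_0 equivar_def pbar_mult pbar_pbar)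
    have 1: "f ^ Suc e dvd p + pbar p"
      by (rule real) (auto simp: pbar_add add.commute distrib_right functional_add[OF th] p pb)
    have 2: "f ^ Suc e dvd smult \<iota> (p - pbar p)"
      by (rule real) (auto simp: pbar_smult pbar_diff bar_iota left_diff_distrib smult_diff_right
          functional_diff[OF th] functional_smult[OF th] p pb)
    have "f ^ Suc e dvd p - pbar p" using 2 iota_nz by (simp add: dvd_smult_iff)
    from dvd_add[OF 1 this] have "f ^ Suc e dvd smult 2 p" by (simp add: smult_add_left[of 1 1 p, simplified])
    thus ?thesis using two_nz by (simp add: dvd_smult_iff)
  qed
  thus ?thesis using fnz th v by (simp add: radical_is_def)
qed

end

section \<open>Hermitian forms\<close>

locale herm = conj_field bar \<iota> + vector_space scale
  for bar :: "'a::{field,finite} \<Rightarrow> 'a" and \<iota> :: 'a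
    and scale :: "'a \<Rightarrow> 'v::ab_group_add \<Rightarrow> 'v" (infixr "*s" 75) +
  fixes B :: "'v \<Rightarrow> 'v \<Rightarrow> 'a"
  assumes B_add_left: "B (u + v) w = B u w + B v w"
    and B_scale_left: "B (c *s u) w = c * B u w"
    and B_swap: "B v u = bar (B u v)"
begin

lemma B_add_right: "B w (u + v) = B w u + B w v"
  by (metis B_add_left B_swap bar_add)

lemma B_scale_right: "B w (c *s u) = bar c * B w u"
  by (metis B_scale_left B_swap bar_mult)

lemma B_0_left [simp]: "B 0 w = 0" using B_scale_left[of 0 0 w] by simp
lemma B_0_right [simp]: "B w 0 = 0" using B_scale_right[of w 0 0] by simp

lemma B_minus_left: "B (- u) w = - B u w"
  using B_add_left[of "- u" u w] by (simp add: eq_neg_iff_add_eq_0)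

lemma B_minus_right: "B w (- u) = - B w u"
  using B_add_right[of w "- u" u] by (simp add: eq_neg_iff_add_eq_0)

lemma B_diff_left: "B (u - v) w = B u w - B v w"
  using B_add_left[of u "- v" w] by (simp add: B_minus_left)

lemma B_diff_right: "B w (u - v) = B w u - B w v"
  using B_add_right[of w u "- v"] by (simp add: B_minus_right)

definition lin :: "('v \<Rightarrow> 'v) \<Rightarrow> bool" where
  "lin D \<longleftrightarrow> (\<forall>u v. D (u + v) = D u + D v) \<and> (\<forall>c u. D (c *s u) = c *s D u)"

lemma lin_add: "lin D \<Longrightarrow> D (u + v) = D u + D v" and lin_scale: "lin D \<Longrightarrow> D (c *s u) = c *s D u"
  by (auto simp: lin_def)

lemma lin_0: assumes "lin D" shows "D 0 = 0" using lin_scale[OF assms, of 0 0] by simp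

lemma lin_minus: assumes "lin D" shows "D (- u) = - D u"
  using lin_add[OF assms, of "- u" u] lin_0[OF assms] by (simp add: eq_neg_iff_add_eq_0)

lemma lin_diff: assumes "lin D" shows "D (u - v) = D u - D v"
  using lin_add[OF assms, of u "- v"] lin_minus[OF assms] by simp

lemma lin_sum: "lin D \<Longrightarrow> D (sum h I) = (\<Sum>i\<in>I. D (h i))"
  by (induction I rule: infinite_finite_induct) (auto simp: lin_0 lin_add)

lemma lin_funpow: "lin D \<Longrightarrow> lin (D ^^ j)"
  by (induction j) (auto simp: lin_def)

section \<open>Sizes of subspaces\<close>

lemma card_span: "finite S \<Longrightarrow> finite (span S) \<and> (\<exists>d. card (span S) = CARD('a) ^ d)"
proof (induction S rule: finite_induct)
  case empty
  show ?case by (auto intro: exI[of _ 0])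
next
  case (insert a S)
  show ?case
  proof (cases "a \<in> span S")
    case True
    thus ?thesis using insert.IH span_redundant by simp
  next
    case False
    have "bij_betw (\<lambda>(k, y). k *s a + y) (UNIV \<times> span S) (span (insert a S))"
    proof (rule bij_betwI')
      fix p q assume pq: "p \<in> (UNIV :: 'a set) \<times> span S" "q \<in> (UNIV :: 'a set) \<times> span S"
      obtain k y l z where kl: "p = (k, y)" "q = (l, z)" by (cases p, cases q)
      have yz: "y \<in> span S" "z \<in> span S" using pq kl by auto
      show "((case p of (k, y) \<Rightarrow> k *s a + y) = (case q of (k, y) \<Rightarrow> k *s a + y)) = (p = q)"
      proof
        assume "(case p of (k, y) \<Rightarrow> k *s a + y) = (case q of (k, y) \<Rightarrow> k *s a + y)"
        hence e: "(k - l) *s a = z - y" by (simp add: kl scale_left_diff_distrib algebra_simps)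
        have "k = l"
        proof (rule ccontr)
          assume "k \<noteq> l"
          have "(k - l) *s a \<in> span S" unfolding e using yz span_diff by blast
          hence "inverse (k - l) *s (k - l) *s a \<in> span S" by (rule span_scale)
          with \<open>k \<noteq> l\<close> False show False by simp
        qed
        with e show "p = q" by (simp add: kl)
      qed simp
    next
      fix p assume "p \<in> (UNIV :: 'a set) \<times> span S"
      thus "(case p of (k, y) \<Rightarrow> k *s a + y) \<in> span (insert a S)"
        by (auto simp: span_insert intro!: exI[of _ "fst p"])
    next
      fix x assume "x \<in> span (insert a S)"
      then obtain k where "x - k *s a \<in> span S" by (auto simp: span_insert)
      thus "\<exists>p\<in>UNIV \<times> span S. x = (case p of (k, y) \<Rightarrow> k *s a + y)"
        by (intro bexI[of _ "(k, x - k *s a)"]) auto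
    qed
    note b = this
    obtain d where d: "card (span S) = CARD('a) ^ d" "finite (span S)" using insert.IH by blast
    have "finite (span (insert a S))" using bij_betw_finite[OF b] d(2) by simp
    moreover have "card (span (insert a S)) = CARD('a) ^ Suc d"
      using bij_betw_same_card[OF b] d(1) by (simp add: card_cartesian_product)
    ultimately show ?thesis by blast
  qed
qed

lemma card_subspace: assumes "subspace A" "finite A" shows "\<exists>d. card A = CARD('a) ^ d"
proof -
  have "span A = A" using assms(1) by (simp only: span_eq_iff)
  show ?thesis using card_span[OF assms(2)] unfolding \<open>span A = A\<close> by blast
qed

text \<open>The dimension of a finite subspace is read off from its size, so that every dimension formula
  becomes the count of a finite set.\<close>
definition fdim :: "'v set \<Rightarrow> nat" where "fdim A = (SOME d. card A = CARD('a) ^ d)"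

lemma card_fdim: "subspace A \<Longrightarrow> finite A \<Longrightarrow> card A = CARD('a) ^ fdim A"
  unfolding fdim_def using card_subspace someI_ex by (metis (mono_tags, lifting))

lemma CARD_gt_1: "1 < CARD('a)"
proof -
  have "card {0, 1 :: 'a} \<le> CARD('a)" by (intro card_mono) auto
  thus ?thesis by simp
qed

lemma fdim_eqI: "card A = CARD('a) ^ d \<Longrightarrow> fdim A = d"
  unfolding fdim_def using CARD_gt_1 by (intro some_equality) auto

definition direct :: "'v set \<Rightarrow> 'v set \<Rightarrow> 'v set \<Rightarrow> bool" where
  "direct U W Y \<longleftrightarrow> subspace W \<and> subspace Y \<and> W \<inter> Y \<subseteq> {0} \<and> U = {x + y | x y. x \<in> W \<and> y \<in> Y}"

lemma direct_card: assumes "direct U W Y" shows "card U = card W * card Y"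
proof -
  have s: "subspace W" "subspace Y" and i: "W \<inter> Y \<subseteq> {0}" using assms by (auto simp: direct_def)
  have "inj_on (\<lambda>(x, y). x + y) (W \<times> Y)"
  proof (rule inj_onI, clarify)
    fix x y x' y' assume a: "x \<in> W" "y \<in> Y" "x' \<in> W" "y' \<in> Y" "x + y = x' + y'"
    have "x - x' = y' - y" using a(5) by (simp add: algebra_simps)
    moreover have "x - x' \<in> W" "y' - y \<in> Y" using a s subspace_diff by blast+
    ultimately have "x - x' = 0" "y' - y = 0" using i by auto
    thus "x = x' \<and> y = y'" by simp
  qed
  moreover have "(\<lambda>(x, y). x + y) ` (W \<times> Y) = U" using assms by (auto simp: direct_def)
  ultimately show ?thesis using card_image card_cartesian_product by metis
qed

lemma direct_fdim:
  assumes "direct U W Y" "finite W" "finite Y" shows "fdim U = fdim W + fdim Y"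
  using direct_card[OF assms(1)] assms card_fdim[of W] card_fdim[of Y]
  by (intro fdim_eqI) (simp add: direct_def power_add)

lemma glue:
  assumes d: "direct U W Y"
  shows "\<exists>s. \<forall>w\<in>W. \<forall>y\<in>Y. s (w + y) = s1 w + s2 y"
proof -
  have W: "subspace W" "subspace Y" and i: "W \<inter> Y \<subseteq> {0}" using d by (auto simp: direct_def)
  define \<pi> where "\<pi> u = (SOME w. w \<in> W \<and> u - w \<in> Y)" for u
  have "\<pi> (w + y) = w" if wy: "w \<in> W" "y \<in> Y" for w y
  proof -
    have "w \<in> W \<and> (w + y) - w \<in> Y" using wy by simp
    hence p: "\<pi> (w + y) \<in> W \<and> (w + y) - \<pi> (w + y) \<in> Y" unfolding \<pi>_def by (rule someI)
    have "w - \<pi> (w + y) \<in> W" using p wy W subspace_diff by blast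
    moreover have "((w + y) - \<pi> (w + y)) - y \<in> Y" using p wy W subspace_diff by blast
    moreover have "((w + y) - \<pi> (w + y)) - y = w - \<pi> (w + y)" by (simp add: algebra_simps)
    ultimately have "w - \<pi> (w + y) = 0" using i by auto
    thus ?thesis by simp
  qed
  thus ?thesis by (intro exI[of _ "\<lambda>u. s1 (\<pi> u) + s2 (u - \<pi> u)"]) simp
qed

definition isometric :: "'v set \<Rightarrow> ('v \<Rightarrow> 'v) \<Rightarrow> bool" where
  "isometric W s \<longleftrightarrow> (\<forall>u\<in>W. \<forall>v\<in>W. s (u + v) = s u + s v) \<and>
     (\<forall>c. \<forall>u\<in>W. s (c *s u) = c *s s u) \<and> (\<forall>u\<in>W. \<forall>v\<in>W. B (s u) (s v) = B u v)"

lemma glue_isometric: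
  assumes d: "direct U W Y" and orth: "\<And>w y. w \<in> W \<Longrightarrow> y \<in> Y \<Longrightarrow> B w y = 0"
    and s1: "isometric W s1" and s2: "isometric Y s2"
    and im: "\<And>w y. w \<in> W \<Longrightarrow> y \<in> Y \<Longrightarrow> B (s1 w) (s2 y) = 0"
  shows "\<exists>s. isometric U s \<and> (\<forall>w\<in>W. \<forall>y\<in>Y. s (w + y) = s1 w + s2 y)"
proof -
  have orth': "B y w = 0" if "w \<in> W" "y \<in> Y" for w y using orth[OF that] B_swap[of y w] by simp
  have im': "B (s2 y) (s1 w) = 0" if "w \<in> W" "y \<in> Y" for w y using im[OF that] B_swap[of "s2 y" "s1 w"] by simp
  have sub: "subspace W" "subspace Y" using d by (auto simp: direct_def)
  obtain s where s: "\<And>w y. w \<in> W \<Longrightarrow> y \<in> Y \<Longrightarrow> s (w + y) = s1 w + s2 y" using glue[OF d, of s1 s2] by blast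
  have ob: "\<exists>w\<in>W. \<exists>y\<in>Y. u = w + y" if "u \<in> U" for u using d that unfolding direct_def by blast
  have h1: "s1 (w + w') = s1 w + s1 w'" "B (s1 w) (s1 w') = B w w'" "s1 (c *s w) = c *s s1 w"
    if "w \<in> W" "w' \<in> W" for w w' c using s1 that unfolding isometric_def by blast+
  have h2: "s2 w + s2 w' = s2 (w + w')" "B (s2 w) (s2 w') = B w w'" "s2 (c *s w) = c *s s2 w"
    if "w \<in> Y" "w' \<in> Y" for w w' c using s2 that unfolding isometric_def by simp_all
  have "isometric U s" unfolding isometric_def
  proof (intro conjI ballI allI)
    fix u assume "u \<in> U"
    then obtain w y where u: "u = w + y" "w \<in> W" "y \<in> Y" using ob by blast
    {
      fix c
      have cs: "c *s w \<in> W" "c *s y \<in> Y" using sub u subspace_scale by blast+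
      show "s (c *s u) = c *s s u"
        unfolding u(1) scale_right_distrib s[OF cs] s[OF u(2,3)]
        using h1(3)[OF u(2,2)] h2(3)[OF u(3,3)] by simp
    }
    fix v assume "v \<in> U"
    then obtain w' y' where v: "v = w' + y'" "w' \<in> W" "y' \<in> Y" using ob by blast
    have a: "w + w' \<in> W" "y + y' \<in> Y" using sub u v subspace_add by blast+
    have "u + v = (w + w') + (y + y')" by (simp add: u v)
    hence "s (u + v) = s1 (w + w') + s2 (y + y')" using s[OF a] by simp
    also have "\<dots> = (s1 w + s1 w') + (s2 y + s2 y')" using h1(1)[OF u(2) v(2)] h2(1)[OF u(3) v(3)] by simp
    also have "\<dots> = s u + s v" unfolding u(1) v(1) s[OF u(2,3)] s[OF v(2,3)] by (simp add: add_ac)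
    finally show "s (u + v) = s u + s v" .
    have "B (s u) (s v) = B (s1 w) (s1 w') + B (s2 y) (s2 y')"
      unfolding u(1) v(1) s[OF u(2,3)] s[OF v(2,3)]
      using im[OF u(2) v(3)] im'[OF v(2) u(3)] by (simp add: B_add_left B_add_right)
    also have "\<dots> = B w w' + B y y'" using h1(2)[OF u(2) v(2)] h2(2)[OF u(3) v(3)] by simp
    also have "\<dots> = B u v" unfolding u(1) v(1) using orth[OF u(2) v(3)] orth'[OF v(2) u(3)]
      by (simp add: B_add_left B_add_right)
    finally show "B (s u) (s v) = B u v" .
  qed
  thus ?thesis using s by blast
qed

lemma hyperplane_card:
  assumes Y: "subspace Y" "finite Y" and y0: "y0 \<in> Y" "B z y0 \<noteq> 0"
  shows "CARD('a) * card {y \<in> Y. B z y = 0} = card Y"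
proof -
  let ?K = "{y \<in> Y. B z y = 0}"
  have "bij_betw (\<lambda>(c, y). c *s y0 + y) (UNIV \<times> ?K) Y"
  proof (rule bij_betwI')
    fix p q assume pq: "p \<in> (UNIV :: 'a set) \<times> ?K" "q \<in> (UNIV :: 'a set) \<times> ?K"
    obtain k y l w where kl: "p = (k, y)" "q = (l, w)" by (cases p, cases q)
    show "((case p of (c, y) \<Rightarrow> c *s y0 + y) = (case q of (c, y) \<Rightarrow> c *s y0 + y)) = (p = q)"
    proof
      assume "(case p of (c, y) \<Rightarrow> c *s y0 + y) = (case q of (c, y) \<Rightarrow> c *s y0 + y)"
      hence e: "k *s y0 + y = l *s y0 + w" by (simp add: kl)
      hence "B z (k *s y0 + y) = B z (l *s y0 + w)" by simp
      hence "bar k = bar l" using pq y0 by (simp add: kl B_add_right B_scale_right)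
      hence "k = l" by (metis bar_bar)
      with e show "p = q" by (simp add: kl)
    qed simp
  next
    fix p assume "p \<in> (UNIV :: 'a set) \<times> ?K"
    thus "(case p of (c, y) \<Rightarrow> c *s y0 + y) \<in> Y"
      using Y y0 by (auto intro: subspace_add subspace_scale)
  next
    fix x assume x: "x \<in> Y"
    define c where "c = bar (B z x / B z y0)"
    have "B z (x - c *s y0) = 0" using y0 by (simp add: B_diff_right B_scale_right c_def)
    moreover have "x - c *s y0 \<in> Y" using x Y y0 by (auto intro: subspace_diff subspace_scale)
    ultimately show "\<exists>p\<in>UNIV \<times> ?K. x = (case p of (c, y) \<Rightarrow> c *s y0 + y)"
      by (intro bexI[of _ "(c, x - c *s y0)"]) auto
  qed
  from bij_betw_same_card[OF this] show ?thesis by (simp add: card_cartesian_product)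
qed

lemma count_pairs:
  assumes W: "subspace W" "finite W" and Y: "subspace Y" "finite Y"
    and D: "\<And>x. x \<in> W \<Longrightarrow> D x \<in> Y" and nd: "\<And>u. u \<in> Y \<Longrightarrow> \<forall>v\<in>Y. B u v = 0 \<Longrightarrow> u = 0"
  shows "CARD('a) * card {(x, y). x \<in> W \<and> y \<in> Y \<and> B (D x) y = 0}
    = card W * card Y + (CARD('a) - 1) * card {x \<in> W. D x = 0} * card Y"
proof -
  let ?Q = "CARD('a)" and ?K = "{x \<in> W. D x = 0}"
  have e: "{(x, y). x \<in> W \<and> y \<in> Y \<and> B (D x) y = 0} = (SIGMA x:W. {y \<in> Y. B (D x) y = 0})" by auto
  have c: "?Q * card {y \<in> Y. B (D x) y = 0} = card Y + (if D x = 0 then (?Q - 1) * card Y else 0)"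
    if x: "x \<in> W" for x
  proof (cases "D x = 0")
    case True
    have "?Q * card Y = (1 + (?Q - 1)) * card Y" using CARD_gt_1 by simp
    thus ?thesis using True by (simp add: algebra_simps)
  next
    case False
    then obtain y where "y \<in> Y" "B (D x) y \<noteq> 0" using nd D x by blast
    thus ?thesis using hyperplane_card[OF Y] False by simp
  qed
  have "?Q * card {(x, y). x \<in> W \<and> y \<in> Y \<and> B (D x) y = 0}
      = (\<Sum>x\<in>W. ?Q * card {y \<in> Y. B (D x) y = 0})"
    unfolding e using W Y by (subst card_SigmaI) (auto simp: sum_distrib_left)
  also have "\<dots> = (\<Sum>x\<in>W. card Y + (if D x = 0 then (?Q - 1) * card Y else 0))"
    by (rule sum.cong) (auto simp: c)
  also have "\<dots> = card W * card Y + card ?K * ((?Q - 1) * card Y)"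
    using W by (simp add: sum.distrib sum.If_cases Int_def conj_commute)
  finally show ?thesis by (simp add: algebra_simps)
qed

text \<open>An operator and its adjoint have the same rank. The pairs \<open>(x, y)\<close> with \<open>B (D x) y = 0\<close> are
  counted once by \<open>x\<close> and once by \<open>y\<close>; a nonzero functional vanishes on a fraction of exactly
  \<open>1 / CARD('a)\<close> of its domain.\<close>
lemma adjoint_kernels:
  assumes W: "subspace W" "finite W" and Y: "subspace Y" "finite Y"
    and D: "\<And>x. x \<in> W \<Longrightarrow> D x \<in> Y" "\<And>y. y \<in> Y \<Longrightarrow> D y \<in> W"
    and adj: "\<And>x y. x \<in> W \<Longrightarrow> y \<in> Y \<Longrightarrow> B (D x) y = B x (D y)"
    and ndW: "\<And>u. u \<in> W \<Longrightarrow> \<forall>v\<in>W. B u v = 0 \<Longrightarrow> u = 0"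
    and ndY: "\<And>u. u \<in> Y \<Longrightarrow> \<forall>v\<in>Y. B u v = 0 \<Longrightarrow> u = 0"
  shows "card {x \<in> W. D x = 0} * card Y = card {y \<in> Y. D y = 0} * card W"
proof -
  let ?P = "{(x, y). x \<in> W \<and> y \<in> Y \<and> B (D x) y = 0}" and ?P' = "{(y, x). y \<in> Y \<and> x \<in> W \<and> B (D y) x = 0}"
  have iff: "B (D y) x = 0 \<longleftrightarrow> B (D x) y = 0" if "x \<in> W" "y \<in> Y" for x y
    using adj[OF that] B_swap[of "D y" x] by simp
  have "?P' = {p. prod.swap p \<in> ?P}" using iff by auto
  also have "\<dots> = prod.swap ` ?P" by (auto simp: image_iff)
  finally have "?P' = prod.swap ` ?P" .
  moreover have "inj_on prod.swap ?P" by (auto intro: inj_onI)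
  ultimately have "card ?P' = card ?P" by (simp add: card_image)
  moreover have "n * N = w * y + a \<Longrightarrow> n * N' = y * w + b \<Longrightarrow> N' = N \<Longrightarrow> a = b"
    for n N N' w y a b :: nat by (simp add: mult.commute)
  ultimately have "(CARD('a) - 1) * card {x \<in> W. D x = 0} * card Y = (CARD('a) - 1) * card {y \<in> Y. D y = 0} * card W"
    using count_pairs[where D = D, OF W Y D(1) ndY] count_pairs[where D = D, OF Y W D(2) ndW]
    by blast
  thus ?thesis using CARD_gt_1 by (simp only: mult.assoc mult_cancel1) simp
qed

end

section \<open>Self-adjoint operators\<close>

locale herm_op = herm bar \<iota> scale B
  for bar :: "'a::{field,finite} \<Rightarrow> 'a" and \<iota> :: 'a
    and scale :: "'a \<Rightarrow> 'v::ab_group_add \<Rightarrow> 'v" (infixr "*s" 75) and B +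
  fixes T :: "'v \<Rightarrow> 'v"
  assumes T: "lin T"
begin

text \<open>The module structure over the polynomial ring in which \<open>t\<close> acts as \<open>T\<close>.\<close>
definition act :: "'a poly \<Rightarrow> 'v \<Rightarrow> 'v" where
  "act p v = (\<Sum>i\<le>deg p. poly.coeff p i *s (T ^^ i) v)"

lemma act_eq: "deg p \<le> n \<Longrightarrow> act p v = (\<Sum>i\<le>n. poly.coeff p i *s (T ^^ i) v)"
  unfolding act_def by (intro sum.mono_neutral_left) (auto simp: coeff_eq_0)

lemma act_add: "act (p + q) v = act p v + act q v"
proof -
  let ?n = "max (deg p) (deg q)"
  have "deg (p + q) \<le> ?n" by (rule degree_add_le_max)
  thus ?thesis using act_eq[of p ?n] act_eq[of q ?n] act_eq[of "p + q" ?n]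
    by (simp add: scale_left_distrib sum.distrib)
qed

lemma act_smult: "act (smult c p) v = c *s act p v"
  using act_eq[of "smult c p" "deg p" v] degree_smult_le[of c p]
  by (simp add: act_def scale_sum_right)

lemma act_0 [simp]: "act 0 v = 0" by (simp add: act_def)

lemma act_pCons: "act (pCons a p) v = a *s v + T (act p v)"
proof -
  have "deg (pCons a p) \<le> Suc (deg p)" by (rule degree_pCons_le)
  hence "act (pCons a p) v = (\<Sum>i\<le>Suc (deg p). poly.coeff (pCons a p) i *s (T ^^ i) v)" by (rule act_eq)
  also have "\<dots> = a *s v + (\<Sum>i\<le>deg p. poly.coeff p i *s T ((T ^^ i) v))"
    by (subst sum.atMost_Suc_shift) simp
  also have "(\<Sum>i\<le>deg p. poly.coeff p i *s T ((T ^^ i) v)) = T (act p v)"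
    by (simp add: act_def lin_sum[OF T] lin_scale[OF T])
  finally show ?thesis .
qed

lemma act_1 [simp]: "act 1 v = v"
  by (simp add: one_pCons act_pCons lin_0[OF T])

lemma act_mult: "act (p * q) v = act p (act q v)"
  by (induction p) (auto simp: act_pCons act_add act_smult)

lemma act_commute: "act p (act q v) = act q (act p v)"
  by (metis act_mult mult.commute)

lemma lin_act: "lin (act p)"
proof (induction p)
  case 0
  show ?case by (simp add: lin_def)
next
  case (pCons a p)
  thus ?case using T by (simp add: lin_def act_pCons algebra_simps scale_right_distrib)
qed

lemma act_minus: "act (- p) v = - act p v"
  using act_smult[of "-1" p v] by simp

lemma act_diff: "act (p - q) v = act p v - act q v"
  using act_add[of p "- q" v] by (simp add: act_minus)

lemma act_zero [simp]: "act p 0 = 0" by (rule lin_0[OF lin_act])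

lemma act_dvd: assumes "act p v = 0" "p dvd q" shows "act q v = 0"
  using assms by (auto simp: dvd_def mult.commute[of p] act_mult)

text \<open>These are the objects of the main induction: self-adjoint operators on finite Hermitian spaces.\<close>
definition sa_space :: "'v set \<Rightarrow> bool" where
  "sa_space U \<longleftrightarrow> subspace U \<and> finite U \<and> (\<forall>u\<in>U. T u \<in> U) \<and> (\<forall>u\<in>U. \<forall>v\<in>U. B (T u) v = B u (T v))
     \<and> (\<forall>u\<in>U. (\<forall>v\<in>U. B u v = 0) \<longrightarrow> u = 0)"

definition Ker :: "'v set \<Rightarrow> 'a poly \<Rightarrow> 'v set" where "Ker U p = {u \<in> U. act p u = 0}"

text \<open>If \<open>T\<close> is the Cayley transform of a unitary \<open>g\<close>, then the flips are exactly the unitary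
  involutions that invert \<open>g\<close>.\<close>
definition flips :: "'v set \<Rightarrow> ('v \<Rightarrow> 'v) \<Rightarrow> bool" where
  "flips U s \<longleftrightarrow> (\<forall>u\<in>U. s u \<in> U) \<and> (\<forall>u\<in>U. \<forall>v\<in>U. s (u + v) = s u + s v) \<and>
     (\<forall>c. \<forall>u\<in>U. s (c *s u) = c *s s u) \<and> (\<forall>u\<in>U. s (s u) = u) \<and>
     (\<forall>u\<in>U. \<forall>v\<in>U. B (s u) (s v) = B u v) \<and> (\<forall>u\<in>U. s (T u) = - T (s u))"

text \<open>What remains of reality when one counts. Orthogonal complements inherit this condition, whereas
  a map that conjugates \<open>T\<close> to \<open>- T\<close> need not respect a given splitting.\<close>
definition balanced :: "'v set \<Rightarrow> bool" where
  "balanced U \<longleftrightarrow> (\<forall>p. card (Ker U p) = card (Ker U (pneg p)))"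

abbreviation "tt \<equiv> [:0, 1:] :: 'a poly"

text \<open>With \<open>d\<^sub>j\<close> for the dimension of the kernel of \<open>T\<^sup>j\<close>, the number of nilpotent Jordan blocks of size
  \<open>2 m\<close> is \<open>2 d\<^sub>j - d\<^bsub>j-1\<^esub> - d\<^bsub>j+1\<^esub>\<close> for \<open>j = 2 m\<close>. Its parity does not involve \<open>d\<^sub>j\<close>.\<close>
definition even_blocks :: "'v set \<Rightarrow> bool" where
  "even_blocks U \<longleftrightarrow> (\<forall>m\<ge>1. even (fdim (Ker U (tt ^ (2 * m - 1))) + fdim (Ker U (tt ^ (2 * m + 1)))))"

lemma act_tt: "act tt v = T v" by (simp add: act_pCons lin_0[OF T])
lemma act_tt_power: "act (tt ^ j) v = (T ^^ j) v"
proof (induction j)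
  case (Suc j)
  thus ?case by (simp only: power_Suc act_mult act_tt funpow.simps o_apply)
qed simp

lemma sa_spaceD:
  assumes "sa_space U"
  shows "subspace U" "finite U" "u \<in> U \<Longrightarrow> T u \<in> U" "u \<in> U \<Longrightarrow> v \<in> U \<Longrightarrow> B (T u) v = B u (T v)"
    "u \<in> U \<Longrightarrow> (\<And>v. v \<in> U \<Longrightarrow> B u v = 0) \<Longrightarrow> u = 0"
  using assms unfolding sa_space_def by blast+

lemma sa_space_act: assumes "sa_space U" "u \<in> U" shows "act p u \<in> U"
  using assms(2)
proof (induction p)
  case (pCons a p)
  thus ?case using assms(1) by (auto simp: act_pCons sa_space_def intro: subspace_add subspace_scale)
qed (use assms in \<open>auto simp: sa_space_def subspace_0\<close>)

lemma B_act:
  assumes U: "sa_space U" and uv: "u \<in> U" "v \<in> U" shows "B (act p u) v = B u (act (pbar p) v)"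
  using uv(2)
proof (induction p arbitrary: v)
  case (pCons a p)
  have Tv: "T v \<in> U" using pCons.prems U by (auto simp: sa_space_def)
  have "B (T (act p u)) v = B (act p u) (T v)"
    using U pCons.prems sa_space_act[OF U uv(1), of p] by (auto simp: sa_space_def)
  also have "\<dots> = B u (act (pbar p) (T v))" by (rule pCons.IH[OF Tv])
  also have "act (pbar p) (T v) = T (act (pbar p) v)" using act_commute[of "pbar p" tt v] by (simp add: act_tt)
  finally show ?case
    by (simp add: act_pCons pbar_pCons B_add_left B_scale_left B_add_right B_scale_right)
qed simp

lemma subspace_Ker: "sa_space U \<Longrightarrow> subspace (Ker U p)"
  unfolding Ker_def sa_space_def
  by (intro subspaceI) (auto simp: lin_add[OF lin_act] lin_scale[OF lin_act] intro: subspace_0 subspace_add subspace_scale)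

lemma finite_Ker: "sa_space U \<Longrightarrow> finite (Ker U p)"
  unfolding Ker_def sa_space_def by auto

section \<open>Flips and their invariants\<close>

lemma anti_act:
  assumes U: "sa_space U" and sU: "\<And>u. u \<in> U \<Longrightarrow> s u \<in> U"
    and add: "\<And>u v. u \<in> U \<Longrightarrow> v \<in> U \<Longrightarrow> s (u + v) = s u + s v"
    and sc: "\<And>c u. u \<in> U \<Longrightarrow> s (c *s u) = c *s s u"
    and anti: "\<And>u. u \<in> U \<Longrightarrow> s (T u) = - T (s u)" and u: "u \<in> U"
  shows "s (act p u) = act (pneg p) (s u)"
proof (induction p)
  case 0
  show ?case using sc[OF u, of 0] by simp
next
  case (pCons a p)
  have a: "act p u \<in> U" using sa_space_act[OF U u] .
  have "a *s u \<in> U" using U u by (auto simp: sa_space_def subspace_scale)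
  hence "s (act (pCons a p) u) = a *s s u + s (T (act p u))"
    unfolding act_pCons using sa_spaceD(3)[OF U a] by (simp add: add sc u)
  also have "s (T (act p u)) = - T (s (act p u))" by (rule anti[OF a])
  also have "a *s s u + - T (s (act p u)) = act (pneg (pCons a p)) (s u)"
    by (simp add: pCons.IH pneg_pCons act_pCons act_minus lin_minus[OF T])
  finally show ?case .
qed

lemma anti_balanced:
  assumes U: "sa_space U" and sU: "\<And>u. u \<in> U \<Longrightarrow> s u \<in> U"
    and add: "\<And>u v. u \<in> U \<Longrightarrow> v \<in> U \<Longrightarrow> s (u + v) = s u + s v"
    and sc: "\<And>c u. u \<in> U \<Longrightarrow> s (c *s u) = c *s s u"
    and anti: "\<And>u. u \<in> U \<Longrightarrow> s (T u) = - T (s u)" and inj: "inj_on s U"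
  shows "balanced U"
proof -
  have s0: "s 0 = 0" using sc[of 0 0] subspace_0[OF sa_spaceD(1)[OF U]] by simp
  have le: "card (Ker U p) \<le> card (Ker U (pneg p))" for p
  proof (rule card_inj_on_le)
    show "inj_on s (Ker U p)" by (rule inj_on_subset[OF inj]) (auto simp: Ker_def)
    show "s ` Ker U p \<subseteq> Ker U (pneg p)"
    proof
      fix v assume "v \<in> s ` Ker U p"
      then obtain u where u: "v = s u" "u \<in> U" "act p u = 0" by (auto simp: Ker_def)
      thus "v \<in> Ker U (pneg p)"
        using anti_act[of U s, OF U sU add sc anti u(2), of p] s0 sU by (auto simp: Ker_def)
    qed
    show "finite (Ker U (pneg p))" by (rule finite_Ker[OF U])
  qed
  show ?thesis unfolding balanced_def
  proof
    fix p
    show "card (Ker U p) = card (Ker U (pneg p))" using le[of p] le[of "pneg p"] by simp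
  qed
qed

lemma flips_act:
  assumes "sa_space U" "flips U s" "u \<in> U" shows "s (act p u) = act (pneg p) (s u)"
  by (rule anti_act[OF assms(1) _ _ _ _ assms(3)]) (use assms(2) in \<open>unfold flips_def, blast+\<close>)

lemma flips_balanced:
  assumes "sa_space U" and s: "flips U s" shows "balanced U"
proof (rule anti_balanced[OF assms(1)])
  have "s (s u) = u" if "u \<in> U" for u using s that unfolding flips_def by blast
  thus "inj_on s U" by (rule inj_on_inverseI)
qed (use s in \<open>unfold flips_def, blast+\<close>)

lemma halve: "(1 / 2 :: 'a) *s (v + v) = v"
proof -
  have "v + v = 2 *s v" by (metis one_add_one scale_left_distrib scale_one)
  thus ?thesis using two_nz by simp
qed

text \<open>Being odd, \<open>T\<^sup>j\<close> interchanges the two eigenspaces of the flip. They are orthogonal to each other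
  and \<open>T\<^sup>j\<close> is self-adjoint, so the two halves of \<open>T\<^sup>j\<close> are adjoint to each other and have the same
  rank. The rank of \<open>T\<^sup>j\<close> is therefore even.\<close>
lemma flips_even_rank:
  assumes U: "sa_space U" and s: "flips U s" and j: "odd j"
  shows "even (fdim U + fdim (Ker U (tt ^ j)))"
proof -
  have subU: "subspace U" and finU: "finite U" using U by (auto simp: sa_space_def)
  have s1: "\<And>u. u \<in> U \<Longrightarrow> s u \<in> U" and s2: "\<And>u. u \<in> U \<Longrightarrow> s (s u) = u"
    and sadd: "\<And>u v. u \<in> U \<Longrightarrow> v \<in> U \<Longrightarrow> s (u + v) = s u + s v"
    and ssc: "\<And>c u. u \<in> U \<Longrightarrow> s (c *s u) = c *s s u"
    and sB: "\<And>u v. u \<in> U \<Longrightarrow> v \<in> U \<Longrightarrow> B (s u) (s v) = B u v"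
    using s by (auto simp: flips_def)
  have sm: "s (- u) = - s u" if "u \<in> U" for u using ssc[OF that, of "-1"] by simp
  define P where "P = {u \<in> U. s u = u}"
  define M where "M = {u \<in> U. s u = - u}"
  have s0: "s 0 = 0" using ssc[of 0 0] subU subspace_0 by simp
  have sP: "subspace P" unfolding P_def
    using subU by (intro subspaceI) (simp_all add: sadd ssc s0 subspace_0 subspace_add subspace_scale)
  have sM: "subspace M" unfolding M_def
    using subU by (intro subspaceI) (simp_all add: sadd ssc s0 subspace_0 subspace_add subspace_scale)
  have fin: "finite P" "finite M" using finU by (auto simp: P_def M_def)
  have orth: "B a b = 0" "B b a = 0" if "a \<in> P" "b \<in> M" for a b
  proof -
    have "B a b = - B a b" using sB[of a b] that by (auto simp: P_def M_def B_minus_right)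
    hence "2 * B a b = 0" by (simp add: eq_neg_iff_add_eq_0)
    thus "B a b = 0" using two_nz by simp
    thus "B b a = 0" using B_swap[of b a] by simp
  qed
  have int: "P \<inter> M \<subseteq> {0}"
  proof
    fix u assume "u \<in> P \<inter> M"
    hence "u + u = 0" by (auto simp: P_def M_def eq_neg_iff_add_eq_0)
    thus "u \<in> {0}" using halve[of u] by simp
  qed
  define h :: 'a where "h = 1 / 2"
  have decomp: "h *s (u + s u) \<in> P" "h *s (u - s u) \<in> M" "u = h *s (u + s u) + h *s (u - s u)"
    if u: "u \<in> U" for u
  proof -
    have U': "u + s u \<in> U" "u - s u \<in> U" using u s1 subU by (auto intro: subspace_add subspace_diff)
    have "s (u + s u) = u + s u" using u s1 s2 sadd by (simp add: add.commute)
    thus "h *s (u + s u) \<in> P" using U' subU by (simp add: P_def ssc subspace_scale)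
    have "s (u - s u) = - (u - s u)"
      using sadd[of u "- s u"] u s1[OF u] s2[OF u] sm[of "s u"] subspace_neg[OF subU, of "s u"] by simp
    hence "s (h *s (u - s u)) = - (h *s (u - s u))" using ssc[OF U'(2), of h] by (simp only: scale_minus_right)
    thus "h *s (u - s u) \<in> M" using U' subU by (simp add: M_def subspace_scale)
    have "h *s (u + s u) + h *s (u - s u) = h *s (u + u)" by (simp flip: scale_right_distrib)
    thus "u = h *s (u + s u) + h *s (u - s u)" using halve[of u] by (simp add: h_def)
  qed
  have "U = {x + y | x y. x \<in> P \<and> y \<in> M}"
  proof (intro equalityI subsetI)
    fix u assume "u \<in> U"
    from decomp[OF this] show "u \<in> {x + y | x y. x \<in> P \<and> y \<in> M}" by blast
  next
    fix u assume "u \<in> {x + y | x y. x \<in> P \<and> y \<in> M}"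
    thus "u \<in> U" using subU by (auto simp: P_def M_def intro: subspace_add)
  qed
  hence dU: "direct U P M" unfolding direct_def using sP sM int by blast
  have ndP: "u = 0" if u: "u \<in> P" "\<forall>v\<in>P. B u v = 0" for u
  proof -
    have "B u v = 0" if v: "v \<in> U" for v
    proof -
      have "B u (h *s (v + s v) + h *s (v - s v)) = 0"
        unfolding B_add_right using decomp(1,2)[OF v] orth(1) u by simp
      thus ?thesis unfolding decomp(3)[OF v, symmetric] .
    qed
    thus ?thesis using U u(1) unfolding sa_space_def P_def by blast
  qed
  have ndM: "u = 0" if u: "u \<in> M" "\<forall>v\<in>M. B u v = 0" for u
  proof -
    have "B u v = 0" if v: "v \<in> U" for v
    proof -
      have "B u (h *s (v + s v) + h *s (v - s v)) = 0"
        unfolding B_add_right using decomp(1,2)[OF v] orth(2) u by simp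
      thus ?thesis unfolding decomp(3)[OF v, symmetric] .
    qed
    thus ?thesis using U u(1) unfolding sa_space_def M_def by blast
  qed
  define D where "D = act (tt ^ j)"
  have DU: "u \<in> U \<Longrightarrow> D u \<in> U" for u unfolding D_def using sa_space_act[OF U] .
  have pt: "pneg tt = - tt" by (simp add: pneg_pCons)
  have pj: "pneg (tt ^ j) = - (tt ^ j)" by (simp only: pneg_power pt power_minus_odd[OF j])
  have sD: "s (D u) = - D (s u)" if "u \<in> U" for u
    using flips_act[OF U s that, of "tt ^ j"] unfolding D_def pj act_minus .
  have linD: "lin D" unfolding D_def by (rule lin_act)
  have DP: "u \<in> P \<Longrightarrow> D u \<in> M" and DM: "u \<in> M \<Longrightarrow> D u \<in> P" for u
    using sD[of u] DU by (auto simp: P_def M_def lin_minus[OF linD])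
  have pb: "pbar (tt ^ j) = tt ^ j" by (simp add: pbar_power pbar_pCons)
  have adj: "B (D x) y = B x (D y)" if "x \<in> P" "y \<in> M" for x y
    using that B_act[OF U, of x y "tt ^ j"] by (simp add: pb D_def P_def M_def)
  have sKP: "subspace (Ker P (tt ^ j))" and sKM: "subspace (Ker M (tt ^ j))"
    unfolding Ker_def using sP sM
    by (auto intro!: subspaceI simp: lin_add[OF lin_act] lin_scale[OF lin_act] subspace_0 subspace_add subspace_scale)
  have finK: "finite (Ker P (tt ^ j))" "finite (Ker M (tt ^ j))" using fin by (auto simp: Ker_def)
  have "Ker U (tt ^ j) = {x + y | x y. x \<in> Ker P (tt ^ j) \<and> y \<in> Ker M (tt ^ j)}"
  proof (intro equalityI subsetI)
    fix u assume "u \<in> Ker U (tt ^ j)"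
    hence u: "u \<in> U" "D u = 0" by (auto simp: Ker_def D_def)
    have "D (s u) = 0" using sD[OF u(1)] u(2) s0 by simp
    hence "D (h *s (u + s u)) = 0" "D (h *s (u - s u)) = 0"
      using u(2) by (simp_all add: lin_scale[OF linD] lin_add[OF linD] lin_diff[OF linD])
    hence "h *s (u + s u) \<in> Ker P (tt ^ j)" "h *s (u - s u) \<in> Ker M (tt ^ j)"
      using decomp[OF u(1)] by (auto simp: Ker_def D_def)
    thus "u \<in> {x + y | x y. x \<in> Ker P (tt ^ j) \<and> y \<in> Ker M (tt ^ j)}" using decomp(3)[OF u(1)] by blast
  next
    fix u assume "u \<in> {x + y | x y. x \<in> Ker P (tt ^ j) \<and> y \<in> Ker M (tt ^ j)}"
    thus "u \<in> Ker U (tt ^ j)" using subU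
      by (auto simp: Ker_def P_def M_def lin_add[OF lin_act] subspace_add)
  qed
  hence dK: "direct (Ker U (tt ^ j)) (Ker P (tt ^ j)) (Ker M (tt ^ j))"
    unfolding direct_def using sKP sKM int by (auto simp: Ker_def)
  have "card (Ker P (tt ^ j)) * card M = card (Ker M (tt ^ j)) * card P"
    using adjoint_kernels[where D = D, OF sP fin(1) sM fin(2) DP DM adj ndP ndM]
    unfolding Ker_def D_def .
  hence "CARD('a) ^ (fdim (Ker P (tt ^ j)) + fdim M) = CARD('a) ^ (fdim (Ker M (tt ^ j)) + fdim P)"
    using card_fdim[OF sP fin(1)] card_fdim[OF sM fin(2)] card_fdim[OF sKP finK(1)] card_fdim[OF sKM finK(2)]
    by (simp add: power_add)
  hence "fdim (Ker P (tt ^ j)) + fdim M = fdim (Ker M (tt ^ j)) + fdim P"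
    using CARD_gt_1 by (simp add: power_inject_exp)
  moreover have "fdim U = fdim P + fdim M" by (rule direct_fdim[OF dU fin])
  moreover have "fdim (Ker U (tt ^ j)) = fdim (Ker P (tt ^ j)) + fdim (Ker M (tt ^ j))"
    by (rule direct_fdim[OF dK finK])
  ultimately have "fdim U + fdim (Ker U (tt ^ j)) = 2 * (fdim (Ker P (tt ^ j)) + fdim M)" by simp
  thus ?thesis by simp
qed

lemma flips_even_blocks:
  assumes U: "sa_space U" and s: "flips U s" shows "even_blocks U"
  unfolding even_blocks_def
proof (intro allI impI)
  fix m :: nat assume "m \<ge> 1"
  hence "odd (2 * m - 1)" by presburger
  hence "even (fdim U + fdim (Ker U (tt ^ (2 * m - 1))))" by (rule flips_even_rank[OF U s])
  moreover have "even (fdim U + fdim (Ker U (tt ^ (2 * m + 1))))" by (rule flips_even_rank[OF U s]) simp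
  ultimately show "even (fdim (Ker U (tt ^ (2 * m - 1))) + fdim (Ker U (tt ^ (2 * m + 1))))" by presburger
qed

section \<open>Cyclic subspaces and orthogonal splittings\<close>

text \<open>The Gram functional of \<open>x\<close>. Since \<open>T\<close> is self-adjoint, it determines the form on the whole
  cyclic subspace of \<open>x\<close>.\<close>
definition theta :: "'v \<Rightarrow> 'a poly \<Rightarrow> 'a" where "theta x p = B (act p x) x"
definition cyclic :: "'v \<Rightarrow> 'v set" where "cyclic x = range (\<lambda>p. act p x)"
definition perp :: "'v set \<Rightarrow> 'v \<Rightarrow> 'v set" where "perp U x = {u \<in> U. \<forall>p. B (act p x) u = 0}"

lemma functional_theta: "functional (theta x)"
  by (simp add: functional_def theta_def act_add act_smult B_add_left B_scale_left)

lemma equivar_theta: assumes "sa_space U" "x \<in> U" shows "equivar (theta x)"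
  unfolding equivar_def theta_def using B_act[OF assms assms(2)] B_swap by (metis pbar_pbar)

lemma B_cyclic: assumes "sa_space U" "x \<in> U" shows "B (act p x) (act r x) = theta x (p * pbar r)"
  unfolding theta_def mult.commute[of p] act_mult
  by (subst B_act[OF assms(1) sa_space_act[OF assms] assms(2)]) simp

lemma cyclic_self: "x \<in> cyclic x" unfolding cyclic_def by (rule range_eqI[of _ _ 1]) simp

lemma cyclic_subset: "sa_space U \<Longrightarrow> x \<in> U \<Longrightarrow> cyclic x \<subseteq> U"
  unfolding cyclic_def using sa_space_act by blast

lemma subspace_cyclic: "subspace (cyclic x)"
  unfolding cyclic_def
proof (rule subspaceI)
  show "0 \<in> range (\<lambda>p. act p x)" by (rule range_eqI[of _ _ 0]) simp
  fix u v c assume "u \<in> range (\<lambda>p. act p x)" "v \<in> range (\<lambda>p. act p x)"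
  then obtain p q where "u = act p x" "v = act q x" by blast
  thus "u + v \<in> range (\<lambda>p. act p x)" using act_add[of p q x] by (metis rangeI)
next
  fix u c assume "u \<in> range (\<lambda>p. act p x)"
  then obtain p where "u = act p x" by blast
  thus "c *s u \<in> range (\<lambda>p. act p x)" using act_smult[of c p x] by (metis rangeI)
qed

definition orth_split :: "'v set \<Rightarrow> 'v set \<Rightarrow> 'v set \<Rightarrow> bool" where
  "orth_split U W Y \<longleftrightarrow> sa_space U \<and> sa_space W \<and> sa_space Y \<and> direct U W Y \<and> (\<forall>w\<in>W. \<forall>y\<in>Y. B w y = 0)"

lemma orth_split_subset: assumes "orth_split U W Y" shows "W \<subseteq> U" "Y \<subseteq> U"
proof -
  have d: "subspace W" "subspace Y" "U = {x + y | x y. x \<in> W \<and> y \<in> Y}"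
    using assms by (auto simp: orth_split_def direct_def)
  show "W \<subseteq> U" unfolding d(3) using subspace_0[OF d(2)] by force
  show "Y \<subseteq> U" unfolding d(3) using subspace_0[OF d(1)] by force
qed

text \<open>If the Gram functional has no radical beyond the annihilator of \<open>x\<close>, then the cyclic subspace is
  nondegenerate. The orthogonal projection of \<open>u\<close> is found by representing \<open>p \<mapsto> B (p(T) x) u\<close> through
  the Gram functional.\<close>
lemma cyclic_orth_split:
  assumes U: "sa_space U" and x: "x \<in> U" and ex: "radical_is (theta x) F" and F: "act F x = 0"
  shows "orth_split U (cyclic x) (perp U x)"
proof -
  note g = sa_spaceD[OF U]
  have cU: "cyclic x \<subseteq> U" using cyclic_subset[OF U x] .
  have Tc: "T u \<in> cyclic x" if "u \<in> cyclic x" for u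
  proof -
    obtain p where "u = act p x" using \<open>u \<in> cyclic x\<close> by (auto simp: cyclic_def)
    hence "T u = act (tt * p) x" by (simp only: act_mult act_tt)
    thus ?thesis by (auto simp: cyclic_def)
  qed
  have ann: "F dvd p" if "\<And>r. theta x (p * r) = 0" for p using ex that unfolding radical_is_def by blast
  have nd: "u = 0" if "u \<in> cyclic x" "\<And>v. v \<in> cyclic x \<Longrightarrow> B u v = 0" for u
  proof -
    obtain p where p: "u = act p x" using \<open>u \<in> cyclic x\<close> by (auto simp: cyclic_def)
    have "theta x (p * r) = 0" for r
      using that(2)[of "act (pbar r) x"] B_cyclic[OF U x, of p "pbar r"] p by (auto simp: cyclic_def)
    hence "F dvd p" by (rule ann)
    thus ?thesis using act_dvd[OF F] p by simp
  qed
  have gc: "sa_space (cyclic x)" unfolding sa_space_def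
    using subspace_cyclic finite_subset[OF cU g(2)] Tc g(4) cU nd by blast
  have sp: "subspace (perp U x)" unfolding perp_def using g(1)
    by (intro subspaceI) (simp_all add: subspace_0 subspace_add subspace_scale B_add_right B_scale_right)
  have dec: "\<exists>w\<in>cyclic x. u - w \<in> perp U x" if u: "u \<in> U" for u
  proof -
    have "functional (\<lambda>p. B (act p x) u)"
      by (simp add: functional_def act_add act_smult B_add_left B_scale_left)
    moreover have "B (act (F * p) x) u = 0" for p
      using act_dvd[OF F, of "F * p"] by simp
    ultimately obtain w where w: "\<And>p. B (act p x) u = theta x (w * p)"
      using dual_repr[OF ex] by blast
    let ?w = "act (pbar w) x"
    have "B (act p x) (u - ?w) = 0" for p
      using B_cyclic[OF U x, of p "pbar w"] by (simp add: B_diff_right w mult.commute)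
    moreover have "u - ?w \<in> U" using u sa_space_act[OF U x] g(1) subspace_diff by blast
    ultimately show ?thesis unfolding perp_def cyclic_def by blast
  qed
  have orth: "B w y = 0" if "w \<in> cyclic x" "y \<in> perp U x" for w y
    using that by (auto simp: cyclic_def perp_def)
  have int: "cyclic x \<inter> perp U x \<subseteq> {0}"
  proof
    fix u assume u: "u \<in> cyclic x \<inter> perp U x"
    have "B u v = 0" if "v \<in> cyclic x" for v using orth[OF that, of u] u B_swap[of u v] by simp
    thus "u \<in> {0}" using nd u by blast
  qed
  have "U = {a + b | a b. a \<in> cyclic x \<and> b \<in> perp U x}"
  proof (intro equalityI subsetI)
    fix u assume "u \<in> U"
    then obtain w where "w \<in> cyclic x" "u - w \<in> perp U x" using dec by blast
    moreover have "u = w + (u - w)" by simp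
    ultimately show "u \<in> {a + b | a b. a \<in> cyclic x \<and> b \<in> perp U x}" by blast
  next
    fix u assume "u \<in> {a + b | a b. a \<in> cyclic x \<and> b \<in> perp U x}"
    thus "u \<in> U" using cU g(1) by (auto simp: perp_def intro: subspace_add)
  qed
  hence d: "direct U (cyclic x) (perp U x)" unfolding direct_def using subspace_cyclic sp int by blast
  have Tp: "T u \<in> perp U x" if u: "u \<in> perp U x" for u
  proof -
    have uU: "u \<in> U" using u by (simp add: perp_def)
    have "B (act p x) (T u) = 0" for p
    proof -
      have "B (act p x) (T u) = B (T (act p x)) u" using g(4)[OF sa_space_act[OF U x] uU] by simp
      also have "\<dots> = 0" using orth[OF Tc u, of "act p x"] by (auto simp: cyclic_def)
      finally show ?thesis .
    qed
    thus ?thesis using g(3)[OF uU] by (simp add: perp_def)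
  qed
  have ndp: "u = 0" if u: "u \<in> perp U x" "\<And>v. v \<in> perp U x \<Longrightarrow> B u v = 0" for u
  proof (rule g(5))
    show uU: "u \<in> U" using u by (simp add: perp_def)
    fix v assume "v \<in> U"
    then obtain w where w: "w \<in> cyclic x" "v - w \<in> perp U x" using dec by blast
    have "B u w = 0" using orth[OF w(1) u(1)] B_swap[of u w] by simp
    moreover have "B u (v - w) = 0" using u(2) w(2) by blast
    ultimately show "B u v = 0" by (simp add: B_diff_right)
  qed
  have pU: "perp U x \<subseteq> U" by (auto simp: perp_def)
  have "sa_space (perp U x)" unfolding sa_space_def
    using sp finite_subset[OF pU g(2)] Tp g(4) pU ndp by blast
  thus ?thesis unfolding orth_split_def using U gc d orth by blast
qed

lemma orth_split_Ker:
  assumes "orth_split U W Y" shows "direct (Ker U p) (Ker W p) (Ker Y p)"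
proof -
  have gd: "sa_space U" "sa_space W" "sa_space Y" "direct U W Y" using assms by (auto simp: orth_split_def)
  hence d: "subspace W" "subspace Y" "W \<inter> Y \<subseteq> {0}" "U = {x + y | x y. x \<in> W \<and> y \<in> Y}"
    by (auto simp: direct_def)
  have "Ker U p = {x + y | x y. x \<in> Ker W p \<and> y \<in> Ker Y p}"
  proof (intro equalityI subsetI)
    fix u assume u: "u \<in> Ker U p"
    then obtain w y where wy: "u = w + y" "w \<in> W" "y \<in> Y" using d(4) by (auto simp: Ker_def)
    have "act p w + act p y = 0" using u wy(1) by (simp add: Ker_def lin_add[OF lin_act])
    hence e: "act p w = - act p y" by (simp add: eq_neg_iff_add_eq_0)
    have "act p w \<in> W" "act p y \<in> Y" using sa_space_act gd wy by blast+
    hence "act p w \<in> W \<inter> Y" using e subspace_neg[OF d(2)] by simp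
    hence "act p w = 0" using d(3) by blast
    with e have "act p y = 0" by simp
    with \<open>act p w = 0\<close> wy show "u \<in> {x + y | x y. x \<in> Ker W p \<and> y \<in> Ker Y p}"
      unfolding Ker_def by blast
  next
    fix u assume "u \<in> {x + y | x y. x \<in> Ker W p \<and> y \<in> Ker Y p}"
    thus "u \<in> Ker U p" using d(4) by (auto simp: Ker_def lin_add[OF lin_act])
  qed
  moreover have "Ker W p \<inter> Ker Y p \<subseteq> {0}" using d(3) by (auto simp: Ker_def)
  ultimately show ?thesis unfolding direct_def using subspace_Ker gd by blast
qed

text \<open>Sizes of kernels multiply along an orthogonal splitting and can be cancelled.\<close>
lemma orth_split_balanced:
  assumes s: "orth_split U W Y" and U: "balanced U" and W: "balanced W" shows "balanced Y"
  unfolding balanced_def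
proof
  fix p
  have gW: "sa_space W" using s by (simp add: orth_split_def)
  have "card (Ker W p) > 0"
    using finite_Ker[OF gW] subspace_0[OF subspace_Ker[OF gW]] by (auto simp: card_gt_0_iff)
  moreover have "card (Ker W p) * card (Ker Y p) = card (Ker W (pneg p)) * card (Ker Y (pneg p))"
    using direct_card[OF orth_split_Ker[OF s, of p]] direct_card[OF orth_split_Ker[OF s, of "pneg p"]] U
    by (simp add: balanced_def)
  moreover have "card (Ker W p) = card (Ker W (pneg p))" using W by (simp add: balanced_def)
  ultimately show "card (Ker Y p) = card (Ker Y (pneg p))" by simp
qed

lemma orth_split_fdim_Ker:
  assumes "orth_split U W Y" shows "fdim (Ker U p) = fdim (Ker W p) + fdim (Ker Y p)"
  using direct_fdim[OF orth_split_Ker[OF assms]] assms finite_Ker by (auto simp: orth_split_def)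

lemma orth_split_even_blocks:
  assumes s: "orth_split U W Y" and U: "even_blocks U" and W: "even_blocks W" shows "even_blocks Y"
  unfolding even_blocks_def
proof (intro allI impI)
  fix m :: nat assume m: "1 \<le> m"
  have "even (fdim (Ker U (tt ^ (2 * m - 1))) + fdim (Ker U (tt ^ (2 * m + 1))))"
    "even (fdim (Ker W (tt ^ (2 * m - 1))) + fdim (Ker W (tt ^ (2 * m + 1))))"
    using U W m unfolding even_blocks_def by blast+
  thus "even (fdim (Ker Y (tt ^ (2 * m - 1))) + fdim (Ker Y (tt ^ (2 * m + 1))))"
    unfolding orth_split_fdim_Ker[OF s] by presburger
qed

lemma flips_join:
  assumes sp: "orth_split U W Y" and s1: "flips W s1" and s2: "flips Y s2"
  shows "\<exists>s. flips U s"
proof -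
  have d: "direct U W Y" and gW: "sa_space W" and gY: "sa_space Y" and orth: "\<And>w y. w \<in> W \<Longrightarrow> y \<in> Y \<Longrightarrow> B w y = 0"
    using sp unfolding orth_split_def by blast+
  have h1: "s1 w \<in> W" "s1 (s1 w) = w" "s1 (T w) = - T (s1 w)" if "w \<in> W" for w
    using s1 that unfolding flips_def by blast+
  have h2: "s2 y \<in> Y" "s2 (s2 y) = y" "s2 (T y) = - T (s2 y)" if "y \<in> Y" for y
    using s2 that unfolding flips_def by blast+
  have iso: "isometric W s1" "isometric Y s2" using s1 s2 unfolding flips_def isometric_def by blast+
  obtain s where si: "isometric U s" and s: "\<And>w y. w \<in> W \<Longrightarrow> y \<in> Y \<Longrightarrow> s (w + y) = s1 w + s2 y"
    using glue_isometric[OF d orth iso orth[OF h1(1) h2(1)]] by blast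
  have "s u \<in> U \<and> s (s u) = u \<and> s (T u) = - T (s u)" if "u \<in> U" for u
  proof -
    obtain w y where u: "u = w + y" "w \<in> W" "y \<in> Y" using d \<open>u \<in> U\<close> unfolding direct_def by blast
    have su: "s u = s1 w + s2 y" unfolding u(1) by (rule s[OF u(2,3)])
    have "s u \<in> U" unfolding su using d h1(1)[OF u(2)] h2(1)[OF u(3)] unfolding direct_def by blast
    moreover have "s (s u) = u" unfolding su s[OF h1(1)[OF u(2)] h2(1)[OF u(3)]] by (simp add: h1 h2 u)
    moreover have "s (T u) = s1 (T w) + s2 (T y)"
      unfolding u(1) lin_add[OF T] by (rule s[OF sa_spaceD(3)[OF gW u(2)] sa_spaceD(3)[OF gY u(3)]])
    hence "s (T u) = - T (s u)" unfolding su by (simp add: h1 h2 u lin_add[OF T])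
    ultimately show ?thesis by blast
  qed
  hence "flips U s" using si unfolding flips_def isometric_def by blast
  thus ?thesis by (rule exI[of "flips U" s])
qed

section \<open>Vectors of maximal exponent\<close>

text \<open>A real polynomial of least degree that has a nonzero kernel is irreducible. Such polynomials exist
  because the powers of \<open>T\<close> applied to a vector repeat. Choosing \<open>t\<close> itself whenever \<open>T\<close> is
  singular avoids constant multiples of \<open>t\<close> later on.\<close>
lemma ex_irred_Ker:
  assumes U: "sa_space U" and ne: "U \<noteq> {0}"
  shows "\<exists>f. irred f \<and> Ker U f \<noteq> {0} \<and> (Ker U tt \<noteq> {0} \<longrightarrow> f = tt)"
proof (cases "Ker U tt = {0}")
  case False
  have "irred tt" unfolding irred_def
  proof (intro conjI allI impI)
    fix g assume "preal g" "g dvd tt"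
    hence "deg g \<le> deg tt" by (intro dvd_imp_degree_le) auto
    thus "deg g = 0 \<or> deg g = deg tt" by auto
  qed (auto simp: pbar_pCons)
  thus ?thesis using False by blast
next
  case True
  define S where "S = {p. preal p \<and> p \<noteq> 0 \<and> (\<exists>u\<in>U. u \<noteq> 0 \<and> act p u = 0)}"
  obtain x where x: "x \<in> U" "x \<noteq> 0" using ne subspace_0[OF sa_spaceD(1)[OF U]] by blast
  have "range (\<lambda>i. act (tt ^ i) x) \<subseteq> U" using sa_space_act[OF U x(1)] by blast
  hence "finite (range (\<lambda>i. act (tt ^ i) x))" using sa_spaceD(2)[OF U] finite_subset by blast
  hence "\<not> inj (\<lambda>i :: nat. act (tt ^ i) x)" using finite_imageD infinite_UNIV_nat by blast
  then obtain i j :: nat where ij: "i \<noteq> j" "act (tt ^ i) x = act (tt ^ j) x" unfolding inj_def by blast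
  have "tt ^ i \<noteq> tt ^ j"
  proof
    assume "tt ^ i = tt ^ j"
    hence "deg (tt ^ i) = deg (tt ^ j)" by simp
    thus False using ij(1) by (simp add: degree_power_eq)
  qed
  hence "tt ^ i - tt ^ j \<in> S" unfolding S_def using x ij(2)
    by (auto simp: pbar_diff pbar_power pbar_pCons act_diff)
  from exists_least_iff[of "\<lambda>k. \<exists>p. p \<in> S \<and> deg p = k"] this
  obtain f where f: "f \<in> S" and least: "\<And>p. p \<in> S \<Longrightarrow> \<not> deg p < deg f" by blast
  obtain u where u: "u \<in> U" "u \<noteq> 0" "act f u = 0" and pf: "preal f" and fnz: "f \<noteq> 0"
    using f by (auto simp: S_def)
  have "irred f" unfolding irred_def
  proof (intro conjI allI impI)
    show "preal f" by (rule pf)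
    show "deg f > 0"
    proof (rule ccontr)
      assume "\<not> deg f > 0"
      then obtain c where c: "f = [:c:]" by (auto elim: degree_eq_zeroE)
      thus False using u fnz by (simp add: act_pCons lin_0[OF T])
    qed
    fix g assume g: "preal g" "g dvd f"
    define h where "h = f div g"
    have fh: "f = g * h" using g(2) by (simp add: h_def)
    have ph: "preal h" using preal_mod(2)[OF pf g(1)] by (simp add: h_def)
    have nz: "g \<noteq> 0" "h \<noteq> 0" using fh fnz by auto
    have df: "deg f = deg g + deg h" unfolding fh using nz by (rule degree_mult_eq)
    have gh: "act g (act h u) = 0" using u(3) unfolding fh act_mult .
    show "deg g = 0 \<or> deg g = deg f"
    proof (cases "act h u = 0")
      case True
      hence "h \<in> S" unfolding S_def using ph nz u by blast
      thus ?thesis using least[of h] df by simp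
    next
      case False
      hence "g \<in> S" unfolding S_def using g nz gh sa_space_act[OF U u(1), of h] by blast
      thus ?thesis using least[of g] df by simp
    qed
  qed
  moreover have "Ker U f \<noteq> {0}" using u by (auto simp: Ker_def)
  ultimately show ?thesis using True by blast
qed

text \<open>The power \<open>f\<^bsup>Suc e\<^esup>\<close> is the first one that annihilates the whole \<open>f\<close>-primary part of \<open>U\<close>.\<close>
definition top_exponent :: "'v set \<Rightarrow> 'a poly \<Rightarrow> nat \<Rightarrow> bool" where
  "top_exponent U f e \<longleftrightarrow> Ker U (f ^ e) \<noteq> Ker U (f ^ Suc e) \<and> Ker U (f ^ Suc e) = Ker U (f ^ Suc (Suc e))"

lemma Ker_power_mono: assumes "i \<le> j" shows "Ker U (f ^ i) \<subseteq> Ker U (f ^ j)"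
  unfolding Ker_def using act_dvd le_imp_power_dvd[OF assms] by blast

lemma ex_top_exponent:
  assumes U: "sa_space U" and K: "Ker U f \<noteq> {0}"
  shows "\<exists>e. top_exponent U f e"
proof -
  have "\<exists>e. Ker U (f ^ e) = Ker U (f ^ Suc e)"
  proof (rule ccontr)
    assume n: "\<not> (\<exists>e. Ker U (f ^ e) = Ker U (f ^ Suc e))"
    have "e \<le> card (Ker U (f ^ e))" for e
    proof (induction e)
      case (Suc e)
      have "Ker U (f ^ e) \<subset> Ker U (f ^ Suc e)" using n Ker_power_mono[of e "Suc e" U f] by auto
      from psubset_card_mono[OF finite_Ker[OF U] this] Suc show ?case by simp
    qed simp
    moreover have "card (Ker U (f ^ e)) \<le> card U" for e
      using sa_spaceD(2)[OF U] by (intro card_mono) (auto simp: Ker_def)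
    ultimately have "Suc (card U) \<le> card U" using le_trans by blast
    thus False by simp
  qed
  from exists_least_iff[of "\<lambda>e. Ker U (f ^ e) = Ker U (f ^ Suc e)"] this
  obtain e where e: "Ker U (f ^ e) = Ker U (f ^ Suc e)"
    and least: "\<And>i. i < e \<Longrightarrow> Ker U (f ^ i) \<noteq> Ker U (f ^ Suc i)" by blast
  have "Ker U (f ^ 0) \<noteq> Ker U (f ^ Suc 0)"
    using K subspace_0[OF sa_spaceD(1)[OF U]] by (auto simp: Ker_def)
  hence "e \<noteq> 0" using e by metis
  then obtain d where "e = Suc d" by (cases e) auto
  thus ?thesis using e least[of d] by (auto simp: top_exponent_def)
qed

lemma top_exponent_stable: assumes "top_exponent U f e" and U: "sa_space U" shows "Ker U (f ^ (Suc e + j)) = Ker U (f ^ Suc e)"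
proof (induction j)
  case (Suc j)
  have "Ker U (f ^ (Suc e + Suc j)) \<subseteq> Ker U (f ^ (Suc e + j))"
  proof
    fix u assume u: "u \<in> Ker U (f ^ (Suc e + Suc j))"
    have "Suc e + Suc j = Suc (Suc e) + j" by simp
    hence "act (f ^ Suc (Suc e)) (act (f ^ j) u) = 0" using u unfolding Ker_def
      by (simp only: power_add act_mult mem_Collect_eq)
    moreover have "act (f ^ j) u \<in> U" using u sa_space_act[OF U] by (auto simp: Ker_def)
    ultimately have "act (f ^ j) u \<in> Ker U (f ^ Suc (Suc e))" by (simp only: Ker_def mem_Collect_eq)
    hence "act (f ^ j) u \<in> Ker U (f ^ Suc e)" using assms unfolding top_exponent_def by blast
    thus "u \<in> Ker U (f ^ (Suc e + j))" using u by (simp only: Ker_def mem_Collect_eq power_add act_mult)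
  qed
  thus ?case using Suc Ker_power_mono[of "Suc e" "Suc e + Suc j" U f] by auto
qed simp

text \<open>By Fitting's decomposition the \<open>f\<close>-primary part is an orthogonal summand, so \<open>f\<^sup>e\<close> gives rise to a
  nonzero Hermitian form on it. By polarisation such a form has an anisotropic vector.\<close>
lemma ex_top_vector:
  assumes U: "sa_space U" and f: "preal f" and l: "top_exponent U f e"
  shows "\<exists>x\<in>Ker U (f ^ Suc e). theta x (f ^ e) \<noteq> 0"
proof -
  note g = sa_spaceD[OF U]
  define D where "D = act (f ^ Suc e)"
  have pf: "preal (f ^ i)" for i by (simp only: pbar_power f)
  obtain u where u: "u \<in> Ker U (f ^ Suc e)" "u \<notin> Ker U (f ^ e)"
    using l Ker_power_mono[of e "Suc e" U f] unfolding top_exponent_def by auto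
  define m where "m = act (f ^ e) u"
  have uU: "u \<in> U" and Du: "D u = 0" using u(1) by (simp_all only: Ker_def D_def mem_Collect_eq)
  have mU: "m \<in> U" unfolding m_def by (rule sa_space_act[OF U uU])
  have "m \<noteq> 0" using u uU by (auto simp: Ker_def m_def)
  then obtain v where v: "v \<in> U" "B m v \<noteq> 0" using g(5)[OF mU] by blast
  have DU: "D ` U \<subseteq> U" unfolding D_def using sa_space_act[OF U] by blast
  have linD: "lin D" unfolding D_def by (rule lin_act)
  \<comment> \<open>Fitting: as the kernels are stable from \<open>f\<^bsup>Suc e\<^esup>\<close> on, \<open>D\<close> permutes its image\<close>
  have "inj_on D (D ` U)"
  proof (rule inj_onI)
    fix a b assume ab: "a \<in> D ` U" "b \<in> D ` U" "D a = D b"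
    then obtain c d where cd: "a = D c" "b = D d" "c \<in> U" "d \<in> U" by blast
    have cdU: "c - d \<in> U" using cd g(1) subspace_diff by blast
    have "D (D (c - d)) = 0" using ab(3) cd by (simp add: lin_diff[OF linD])
    hence "act (f ^ (Suc e + Suc e)) (c - d) = 0" unfolding D_def by (simp only: power_add act_mult)
    hence "c - d \<in> Ker U (f ^ (Suc e + Suc e))" using cdU by (simp only: Ker_def mem_Collect_eq)
    hence "c - d \<in> Ker U (f ^ Suc e)" using top_exponent_stable[OF l U] by blast
    hence "D (c - d) = 0" by (simp only: Ker_def mem_Collect_eq D_def)
    thus "a = b" using cd by (simp add: lin_diff[OF linD])
  qed
  moreover have "D ` D ` U \<subseteq> D ` U" using DU by blast
  moreover have "finite (D ` U)" using g(2) by simp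
  ultimately have "D ` D ` U = D ` U" by (intro endo_inj_surj)
  then obtain z where z: "z \<in> U" "D v = D (D z)" using v(1) by blast
  define v1 where "v1 = v - D z"
  have DzU: "D z \<in> U" using z DU by blast
  have v1: "v1 \<in> Ker U (f ^ Suc e)"
    using v z DzU g(1) lin_diff[OF linD, of v "D z"] unfolding Ker_def v1_def mem_Collect_eq
    by (simp add: subspace_diff D_def)
  have "B m (D z) = B (D m) z"
    unfolding D_def using B_act[OF U mU z(1), of "f ^ Suc e"] by (simp only: pf)
  also have "D m = act (f ^ e) (D u)" unfolding m_def D_def by (rule act_commute)
  also have "\<dots> = 0" by (simp add: Du)
  finally have Bm: "B m v1 \<noteq> 0" using v by (simp add: v1_def B_diff_right)
  have v1U: "v1 \<in> U" using v1 by (simp add: Ker_def)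
  \<comment> \<open>this \<open>c\<close> makes both mixed terms of the polarised form equal to \<open>1\<close>\<close>
  define a where "a = B m v1"
  define c where "c = bar (inverse a)"
  have "theta u (f ^ e) \<noteq> 0 \<or> theta v1 (f ^ e) \<noteq> 0 \<or> theta (u + c *s v1) (f ^ e) \<noteq> 0"
  proof (rule ccontr)
    assume "\<not> ?thesis"
    hence z: "B m u = 0" "B (act (f ^ e) v1) v1 = 0" "theta (u + c *s v1) (f ^ e) = 0"
      by (auto simp: theta_def m_def)
    have "B (act (f ^ e) v1) u = B v1 m"
      unfolding m_def using B_act[OF U v1U uU, of "f ^ e"] by (simp only: pf)
    also have "\<dots> = bar a" unfolding a_def by (rule B_swap)
    finally have s: "B (act (f ^ e) v1) u = bar a" .
    have "theta (u + c *s v1) (f ^ e) = B (m + c *s act (f ^ e) v1) (u + c *s v1)"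
      by (simp add: theta_def m_def lin_add[OF lin_act] lin_scale[OF lin_act])
    also have "\<dots> = bar c * a + c * bar a"
      using z(1,2) s a_def by (simp add: B_add_left B_add_right B_scale_left B_scale_right)
    also have "bar c * a = 1" using Bm by (simp add: c_def a_def)
    also have "c * bar a = 1" using Bm by (simp add: c_def a_def flip: bar_mult)
    finally have "(2 :: 'a) = 0" using z(3) by simp
    thus False using two_nz by simp
  qed
  moreover have "u + c *s v1 \<in> Ker U (f ^ Suc e)"
    using u(1) v1 subspace_Ker[OF U] subspace_add subspace_scale by blast
  ultimately show ?thesis using u(1) v1 by blast
qed

lemma top_vector_radical:
  assumes U: "sa_space U" and f: "irred f" and x: "x \<in> Ker U (f ^ Suc e)" and t: "theta x (f ^ e * g) \<noteq> 0"
  shows "radical_is (theta x) (f ^ Suc e)"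
proof (rule radical_isI[OF f functional_theta _ _ t])
  have "x \<in> U" using x by (simp add: Ker_def)
  thus "equivar (theta x)" by (rule equivar_theta[OF U])
  fix p
  have "act (f ^ Suc e) x = 0" using x by (simp only: Ker_def mem_Collect_eq)
  hence "act (f ^ Suc e * p) x = 0" by (rule act_dvd) simp
  thus "theta x (f ^ Suc e * p) = 0" by (simp add: theta_def)
qed

lemma top_exponent_pneg:
  assumes U: "sa_space U" and b: "balanced U" and l: "top_exponent U f e" shows "top_exponent U (pneg f) e"
proof -
  have eq: "Ker U (h ^ i) = Ker U (h ^ Suc i) \<longleftrightarrow> card (Ker U (h ^ i)) = card (Ker U (h ^ Suc i))" for h i
    using card_subset_eq[OF finite_Ker[OF U] Ker_power_mono[of i "Suc i" U h]] by auto
  have c: "card (Ker U (pneg f ^ i)) = card (Ker U (f ^ i))" for i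
    using b unfolding balanced_def by (metis pneg_power)
  show ?thesis using l unfolding top_exponent_def eq c .
qed

section \<open>Flips on one or two cyclic subspaces\<close>

text \<open>For matched vectors this sends \<open>p(T) x\<close> to \<open>p(-T) y\<close>, whatever \<open>p\<close> is chosen.\<close>
definition twist :: "'v \<Rightarrow> 'v \<Rightarrow> 'v \<Rightarrow> 'v" where
  "twist x y u = act (pneg (SOME p. u = act p x)) y"

text \<open>The two conditions under which the twist from \<open>x\<close> to \<open>y\<close> is isometric and well defined.\<close>
definition matched :: "'v set \<Rightarrow> 'v \<Rightarrow> 'v \<Rightarrow> bool" where
  "matched U x y \<longleftrightarrow> x \<in> U \<and> y \<in> U \<and> (\<forall>p. theta y (pneg p) = theta x p) \<and>
     (\<forall>p. act p x = 0 \<longrightarrow> act (pneg p) y = 0)"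

lemma twist_act:
  assumes "matched U x y" shows "twist x y (act p x) = act (pneg p) y"
proof -
  define r where "r = (SOME r. act p x = act r x)"
  have "act p x = act r x" unfolding r_def by (rule someI[of _ p]) simp
  hence "act (r - p) x = 0" by (simp add: act_diff)
  hence "act (pneg (r - p)) y = 0" using assms by (simp add: matched_def)
  thus ?thesis unfolding twist_def r_def[symmetric] by (simp add: pneg_diff act_diff)
qed

lemma twist_props:
  assumes U: "sa_space U" and m: "matched U x y" and u: "u \<in> cyclic x" and v: "v \<in> cyclic x"
  shows "twist x y u \<in> cyclic y" "twist x y (u + v) = twist x y u + twist x y v" "twist x y (c *s u) = c *s twist x y u"
    "twist x y (T u) = - T (twist x y u)" "B (twist x y u) (twist x y v) = B u v"
proof -
  obtain p q where p: "u = act p x" and q: "v = act q x" using u v unfolding cyclic_def by blast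
  have xy: "x \<in> U" "y \<in> U" and th: "\<And>p. theta y (pneg p) = theta x p" using m unfolding matched_def by blast+
  note t = twist_act[OF m]
  have tu: "twist x y u = act (pneg p) y" and tv: "twist x y v = act (pneg q) y" unfolding p q t by simp_all
  show "twist x y u \<in> cyclic y" unfolding tu cyclic_def by simp
  have "twist x y (act (p + q) x) = act (pneg (p + q)) y" by (rule t)
  thus "twist x y (u + v) = twist x y u + twist x y v" unfolding tu tv by (simp add: act_add pneg_add p q)
  have "twist x y (act (smult c p) x) = act (pneg (smult c p)) y" by (rule t)
  thus "twist x y (c *s u) = c *s twist x y u" unfolding tu by (simp add: act_smult pneg_smult p)
  have e: "act (pCons 0 r) w = T (act r w)" for r w by (simp add: act_pCons)
  have "twist x y (act (pCons 0 p) x) = act (pneg (pCons 0 p)) y" by (rule t)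
  thus "twist x y (T u) = - T (twist x y u)" unfolding tu
    by (simp add: e pneg_pCons act_minus lin_minus[OF T] p)
  have "B (twist x y u) (twist x y v) = theta y (pneg p * pbar (pneg q))"
    unfolding tu tv by (rule B_cyclic[OF U xy(2)])
  also have "pneg p * pbar (pneg q) = pneg (p * pbar q)" by (simp add: pbar_pneg pneg_mult)
  also have "theta y \<dots> = theta x (p * pbar q)" by (rule th)
  also have "\<dots> = B u v" unfolding p q by (rule B_cyclic[OF U xy(1), symmetric])
  finally show "B (twist x y u) (twist x y v) = B u v" .
qed

lemma twist_inverse:
  assumes m: "matched U x y" "matched U y x" and u: "u \<in> cyclic x" shows "twist y x (twist x y u) = u"
proof -
  obtain p where p: "u = act p x" using u unfolding cyclic_def by blast
  show ?thesis unfolding p twist_act[OF m(1)] twist_act[OF m(2)] by simp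
qed

lemma flips_single:
  assumes U: "sa_space U" and m: "matched U x x" shows "flips (cyclic x) (twist x x)"
  unfolding flips_def using twist_props[OF U m] twist_inverse[OF m m] by blast

lemma orth_split_assoc:
  assumes 1: "orth_split U W V" and 2: "orth_split V W' Y"
  shows "\<exists>S. orth_split S W W' \<and> orth_split U S Y"
proof -
  note d = 1[unfolded orth_split_def direct_def] 2[unfolded orth_split_def direct_def]
  have g: "sa_space U" "sa_space W" "sa_space W'" "sa_space Y" "sa_space V" and sub: "subspace W" "subspace W'" "subspace Y" "subspace V"
    using d by blast+
  have o1: "B w v = 0" if "w \<in> W" "v \<in> V" for w v using d that by blast
  have o2: "B w y = 0" if "w \<in> W'" "y \<in> Y" for w y using d that by blast
  have WV: "W' \<subseteq> V" "Y \<subseteq> V" "W \<subseteq> U" "V \<subseteq> U" using orth_split_subset 1 2 by blast+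
  have i1: "W \<inter> V \<subseteq> {0}" and i2: "W' \<inter> Y \<subseteq> {0}" using d by blast+
  define S where "S = {a + b | a b. a \<in> W \<and> b \<in> W'}"
  have sS: "subspace S" unfolding S_def by (rule subspace_sums[OF sub(1,2)])
  have dS: "direct S W W'" unfolding direct_def using sub S_def i1 WV by blast
  have SU: "S \<subseteq> U" unfolding S_def using WV subspace_add[OF sa_spaceD(1)[OF g(1)]] by blast
  have WS: "W \<subseteq> S" "W' \<subseteq> S" unfolding S_def using subspace_0[OF sub(1)] subspace_0[OF sub(2)] by force+
  have o1': "B v w = 0" if "w \<in> W" "v \<in> V" for w v using o1[OF that] B_swap[of v w] by simp
  have gS: "sa_space S" unfolding sa_space_def
  proof (intro conjI ballI impI)
    show "subspace S" by (rule sS)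
    show "finite S" using SU sa_spaceD(2)[OF g(1)] finite_subset by blast
    show "B (T u) v = B u (T v)" if "u \<in> S" "v \<in> S" for u v
      using sa_spaceD(4)[OF g(1)] SU that by blast
    fix u assume "u \<in> S"
    then obtain a b where ab: "u = a + b" "a \<in> W" "b \<in> W'" unfolding S_def by blast
    have "T a \<in> W" "T b \<in> W'" using sa_spaceD(3)[OF g(2)] sa_spaceD(3)[OF g(3)] ab by blast+
    thus "T u \<in> S" unfolding ab(1) lin_add[OF T] S_def by blast
    assume z: "\<forall>v\<in>S. B u v = 0"
    have "B a v = 0" if "v \<in> W" for v
    proof -
      have "B (a + b) v = 0" using z WS that ab by blast
      thus ?thesis using o1'[OF that, of b] WV ab by (simp add: B_add_left subset_iff)
    qed
    hence "a = 0" by (rule sa_spaceD(5)[OF g(2) ab(2)])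
    moreover have "B b v = 0" if "v \<in> W'" for v
    proof -
      have "B (a + b) v = 0" using z WS that ab by blast
      thus ?thesis using o1[OF ab(2), of v] WV that by (simp add: B_add_left subset_iff)
    qed
    hence "b = 0" by (rule sa_spaceD(5)[OF g(3) ab(3)])
    ultimately show "u = 0" by (simp add: ab)
  qed
  have "orth_split S W W'" unfolding orth_split_def using gS g dS o1 WV by blast
  moreover have "orth_split U S Y"
  proof -
    have "S \<inter> Y \<subseteq> {0}"
    proof
      fix u assume u: "u \<in> S \<inter> Y"
      then obtain a b where ab: "u = a + b" "a \<in> W" "b \<in> W'" unfolding S_def by blast
      have "u - b \<in> V" using u ab WV subspace_diff[OF sub(4)] by blast
      hence "a \<in> W \<inter> V" using ab by simp
      hence "a = 0" using i1 by blast
      hence "u \<in> W' \<inter> Y" using ab u by simp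
      thus "u \<in> {0}" using i2 by blast
    qed
    moreover have "U = {x + y | x y. x \<in> S \<and> y \<in> Y}"
    proof (intro equalityI subsetI)
      fix u assume "u \<in> U"
      then obtain a v where av: "u = a + v" "a \<in> W" "v \<in> V" using d by blast
      then obtain b y where by': "v = b + y" "b \<in> W'" "y \<in> Y" using d by blast
      have "u = (a + b) + y" by (simp add: av by' add.assoc)
      moreover have "a + b \<in> S" using av by' unfolding S_def by blast
      ultimately show "u \<in> {x + y | x y. x \<in> S \<and> y \<in> Y}" using by' by blast
    next
      fix u assume "u \<in> {x + y | x y. x \<in> S \<and> y \<in> Y}"
      then obtain a y where "u = a + y" "a \<in> S" "y \<in> Y" by blast
      thus "u \<in> U" using SU WV subspace_add[OF sa_spaceD(1)[OF g(1)]] by blast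
    qed
    ultimately have "direct U S Y" unfolding direct_def using sS sub by blast
    moreover have "B a y = 0" if "a \<in> S" "y \<in> Y" for a y
    proof -
      obtain w w' where "a = w + w'" "w \<in> W" "w' \<in> W'" using \<open>a \<in> S\<close> unfolding S_def by blast
      thus ?thesis using o1[of w y] o2[of w' y] that WV by (simp add: B_add_left subset_iff)
    qed
    ultimately show ?thesis unfolding orth_split_def using g gS by blast
  qed
  ultimately show ?thesis by blast
qed

lemma flips_pair:
  assumes U: "sa_space U" and m: "matched U x y" "matched U y x" and sp: "orth_split S (cyclic x) (cyclic y)"
  shows "\<exists>s. flips S s"
proof -
  have d: "direct S (cyclic x) (cyclic y)" and orth: "\<And>a b. a \<in> cyclic x \<Longrightarrow> b \<in> cyclic y \<Longrightarrow> B a b = 0"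
    using sp unfolding orth_split_def by blast+
  note P = twist_props[OF U m(1)] and Q = twist_props[OF U m(2)]
  have im: "B (twist x y a) (twist y x b) = 0" if "a \<in> cyclic x" "b \<in> cyclic y" for a b
    using orth[OF Q(1)[OF that(2,2)] P(1)[OF that(1,1)]] B_swap[of "twist x y a" "twist y x b"] by simp
  have iso: "isometric (cyclic a) (twist a b)" if m: "matched U a b" for a b
    unfolding isometric_def
  proof (intro conjI allI ballI)
    fix u assume u: "u \<in> cyclic a"
    show "twist a b (c *s u) = c *s twist a b u" for c by (rule twist_props(3)[OF U m u u])
    fix v assume v: "v \<in> cyclic a"
    show "twist a b (u + v) = twist a b u + twist a b v" by (rule twist_props(2)[OF U m u v])
    show "B (twist a b u) (twist a b v) = B u v" by (rule twist_props(5)[OF U m u v])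
  qed
  obtain s where si: "isometric S s" and s: "\<And>a b. a \<in> cyclic x \<Longrightarrow> b \<in> cyclic y \<Longrightarrow> s (a + b) = twist x y a + twist y x b"
    using glue_isometric[OF d orth iso[OF m(1)] iso[OF m(2)] im] by blast
  have "s u \<in> S \<and> s (s u) = u \<and> s (T u) = - T (s u)" if "u \<in> S" for u
  proof -
    obtain a b where u: "u = a + b" "a \<in> cyclic x" "b \<in> cyclic y" using d \<open>u \<in> S\<close> unfolding direct_def by blast
    note Pa = P(1)[OF u(2,2)] and Qb = Q(1)[OF u(3,3)]
    have su: "s u = twist y x b + twist x y a" unfolding u(1) s[OF u(2,3)] by (rule add.commute)
    have "s u \<in> S" unfolding su using d Pa Qb unfolding direct_def by blast
    moreover have "s (s u) = u" unfolding su s[OF Qb Pa]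
      unfolding twist_inverse[OF m u(2)] twist_inverse[OF m(2,1) u(3)] u(1) by (rule add.commute)
    moreover have Tu: "T a \<in> cyclic x" "T b \<in> cyclic y" using sa_spaceD(3) sp u unfolding orth_split_def by blast+
    have "s (T u) = twist x y (T a) + twist y x (T b)" unfolding u(1) lin_add[OF T] by (rule s[OF Tu])
    hence "s (T u) = - T (s u)" unfolding su using P(4)[OF u(2,2)] Q(4)[OF u(3,3)] by (simp add: lin_add[OF T])
    ultimately show ?thesis by blast
  qed
  hence "flips S s" using si unfolding flips_def isometric_def by blast
  thus ?thesis by (rule exI[of "flips S" s])
qed

lemma radical_isD: assumes "radical_is \<theta> F" "\<And>r. \<theta> (p * r) = 0" shows "F dvd p"
  using assms unfolding radical_is_def by blast

text \<open>Passing from \<open>x\<close> to \<open>b(T) x\<close> multiplies the Gram functional by the norm of \<open>b\<close>, and norms reach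
  every real unit \<open>w\<close>.\<close>
lemma rescale:
  assumes U: "sa_space U" and f: "irred f" and x: "x \<in> Ker U (f ^ Suc e)" and ex: "radical_is (theta x) (f ^ Suc e)"
    and w: "preal w" "\<not> f dvd w"
  shows "\<exists>x'\<in>Ker U (f ^ Suc e). (\<forall>p. theta x' p = theta x (w * p)) \<and> radical_is (theta x') (f ^ Suc e)"
proof -
  let ?F = "f ^ Suc e"
  have xU: "x \<in> U" and Fx: "act ?F x = 0" using x by (simp_all only: Ker_def mem_Collect_eq)
  obtain b where b: "?F dvd b * pbar b - w" using norm_surj_mod_power[OF f w] by blast
  define x' where "x' = act b x"
  have x'U: "x' \<in> U" unfolding x'_def by (rule sa_space_act[OF U xU])
  have "act ?F x' = act b (act ?F x)" unfolding x'_def by (rule act_commute)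
  hence x': "x' \<in> Ker U ?F" using x'U Fx by (simp add: Ker_def)
  have th: "theta x' p = theta x (w * p)" for p
  proof -
    have "theta x' p = B (act (p * b) x) (act b x)" by (simp add: theta_def x'_def act_mult)
    also have "\<dots> = theta x (p * b * pbar b)" by (rule B_cyclic[OF U xU])
    also have "p * b * pbar b = w * p + (b * pbar b - w) * p" by (simp add: algebra_simps)
    also have "theta x \<dots> = theta x (w * p) + theta x ((b * pbar b - w) * p)"
      by (rule functional_add[OF functional_theta])
    also have "theta x ((b * pbar b - w) * p) = 0"
      using act_dvd[OF Fx dvd_mult2[OF b]] by (simp add: theta_def)
    finally show ?thesis by simp
  qed
  have "\<exists>g. theta x (f ^ e * w * g) \<noteq> 0"
  proof (rule ccontr)
    assume "\<nexists>g. theta x (f ^ e * w * g) \<noteq> 0"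
    hence "?F dvd f ^ e * w" using radical_isD[OF ex] by blast
    hence "f dvd w" using irred_nz[OF f] by (simp add: mult.commute[of f])
    with w show False by blast
  qed
  then obtain g where "theta x (f ^ e * w * g) \<noteq> 0" by blast
  hence "theta x' (f ^ e * g) \<noteq> 0" by (simp add: th algebra_simps)
  from top_vector_radical[OF U f x' this] x' th show ?thesis by blast
qed

lemma matched_swap:
  assumes "matched U x y" "radical_is (theta x) F" "act F x = 0" "radical_is (theta y) (pneg F)" "act (pneg F) y = 0"
  shows "matched U y x"
  unfolding matched_def
proof (intro conjI allI impI)
  show "y \<in> U" "x \<in> U" using assms by (auto simp: matched_def)
  fix p
  have th: "\<And>p. theta y (pneg p) = theta x p" using assms(1) unfolding matched_def by blast
  show "theta x (pneg p) = theta y p" using th[of "pneg p"] by simp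
  assume "act p y = 0"
  hence "theta y (p * r) = 0" for r using act_dvd[of p y "p * r"] by (simp add: theta_def)
  hence "pneg F dvd p" by (rule radical_isD[OF assms(4)])
  hence "F dvd pneg p" using pneg_dvd_iff[of F "pneg p"] by simp
  thus "act (pneg p) x = 0" by (rule act_dvd[OF assms(3)])
qed

lemma matchedI:
  assumes "x \<in> U" "y \<in> U" "\<And>p. theta y (pneg p) = theta x p"
    "radical_is (theta x) F" "act (pneg F) y = 0"
  shows "matched U x y"
  unfolding matched_def
proof (intro conjI allI impI)
  fix p assume "act p x = 0"
  hence "theta x (p * r) = 0" for r using act_dvd[of p x "p * r"] by (simp add: theta_def)
  hence "F dvd p" by (rule radical_isD[OF assms(4)])
  hence "pneg F dvd pneg p" by simp
  thus "act (pneg p) y = 0" by (rule act_dvd[OF assms(5)])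
qed (use assms in auto)

lemma equivar_pneg: "equivar \<theta> \<Longrightarrow> equivar (\<lambda>p. \<theta> (pneg p))"
  unfolding equivar_def by (simp flip: pbar_pneg)

lemma functional_pneg: "functional \<theta> \<Longrightarrow> functional (\<lambda>p. \<theta> (pneg p))"
  unfolding functional_def by (simp add: pneg_add pneg_smult)

section \<open>Splitting off a summand with a flip\<close>

text \<open>Here the substitution \<open>t \<mapsto> - t\<close> preserves the ideal of \<open>f\<close>. It turns the Gram functional \<open>\<theta>\<close> of a
  top vector into \<open>p \<mapsto> \<theta> (\<gamma> p)\<close>, where \<open>\<gamma>(t) \<gamma>(-t) = 1\<close> modulo \<open>f\<^bsup>Suc e\<^esup>\<close>. In the manner of
  Hilbert's Theorem 90, \<open>w = \<eta>(t) + \<gamma>(t) \<eta>(-t)\<close> satisfies \<open>w(t) = \<gamma>(t) w(-t)\<close>; one of \<open>\<eta> = 1\<close> and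
  \<open>\<eta> = t\<close> makes it a unit. For \<open>f = t\<close> and even \<open>e\<close> already \<open>\<eta> = 1\<close> does, as \<open>\<gamma>\<close> has constant term
  \<open>1\<close>. After rescaling by \<open>w\<close> the Gram functional is invariant under \<open>t \<mapsto> - t\<close>, and the twist of
  the vector with itself is a flip.\<close>
lemma ex_cyclic_summand:
  assumes U: "sa_space U" and f: "irred f" and self: "f dvd pneg f"
    and l: "top_exponent U f e" and odd: "f dvd tt \<longrightarrow> f = tt \<and> even e"
  shows "\<exists>S Y. orth_split U S Y \<and> S \<noteq> {0} \<and> (\<exists>s. flips S s)"
proof -
  let ?F = "f ^ Suc e"
  have pf: "preal f" using f by (simp add: irred_def)
  obtain x where x: "x \<in> Ker U ?F" and t: "theta x (f ^ e) \<noteq> 0" using ex_top_vector[OF U pf l] by blast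
  have xU: "x \<in> U" and Fx: "act ?F x = 0" using x by (simp_all only: Ker_def mem_Collect_eq)
  have ex: "radical_is (theta x) ?F" using top_vector_radical[OF U f x, of 1] t by simp
  have eqv: "equivar (theta x)" by (rule equivar_theta[OF U xU])
  note th = functional_theta[of x]
  have FF: "?F dvd pneg ?F" unfolding pneg_power using self by (rule dvd_power_same)
  have van: "theta x p = 0" if "?F dvd p" for p using act_dvd[OF Fx that] by (simp add: theta_def)
  have vanp: "theta x (pneg (?F * p)) = 0" for p
    by (rule van) (use FF in \<open>simp only: pneg_mult dvd_mult2\<close>)
  obtain \<gamma> where g: "preal \<gamma>" "\<And>p. theta x (pneg p) = theta x (\<gamma> * p)"
    using dual_repr_real[OF ex functional_pneg[OF th] vanp eqv equivar_pneg[OF eqv]] by blast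
  have "theta x ((\<gamma> * pneg \<gamma> - 1) * p) = 0" for p
  proof -
    have "theta x p = theta x (\<gamma> * pneg p)" using g(2)[of "pneg p"] by simp
    also have "\<dots> = theta x (pneg (pneg \<gamma> * p))" by (simp add: pneg_mult)
    also have "\<dots> = theta x (\<gamma> * (pneg \<gamma> * p))" by (rule g(2))
    finally show ?thesis by (simp add: left_diff_distrib functional_diff[OF th] mult.assoc)
  qed
  hence gg: "?F dvd \<gamma> * pneg \<gamma> - 1" by (rule radical_isD[OF ex])
  have n2: "\<not> f dvd [:2:]"
  proof
    assume "f dvd [:2:]"
    hence "deg f \<le> deg [:2 :: 'a:]" using two_nz by (intro dvd_imp_degree_le) auto
    thus False using f by (simp add: irred_def)
  qed
  have two: "[:2:] = (1 + 1 :: 'a poly)" by (simp add: one_pCons)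
  have "\<exists>\<eta>. preal \<eta> \<and> \<not> f dvd \<eta> + \<gamma> * pneg \<eta>"
  proof (cases "f dvd 1 + \<gamma>")
    case False
    thus ?thesis by (intro exI[of _ 1]) simp
  next
    case True
    have "\<not> f dvd tt + \<gamma> * pneg tt"
    proof
      assume "f dvd tt + \<gamma> * pneg tt"
      moreover have "tt + \<gamma> * pneg tt = tt * (1 - \<gamma>)"
      proof -
        have "pneg tt = - tt" by (simp add: pneg_pCons)
        hence "tt + \<gamma> * pneg tt = tt + \<gamma> * - tt" by (rule arg_cong)
        also have "\<dots> = tt * (1 - \<gamma>)"
          by (simp only: right_diff_distrib mult_1_right mult_minus_right mult.commute[of \<gamma>] add_uminus_conv_diff)
        finally show ?thesis .
      qed
      ultimately have "f dvd tt * (1 - \<gamma>)" by simp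
      hence "f dvd tt \<or> f dvd 1 - \<gamma>" by (rule irred_dvd_mult[OF f, rotated]) (simp add: pbar_pCons)
      thus False
      proof
        assume "f dvd 1 - \<gamma>"
        from dvd_add[OF True this] have "f dvd 1 + 1" by simp
        with n2 two show False by metis
      next
        assume "f dvd tt"
        hence ft: "f = tt" and ev: "even e" using odd by auto
        obtain k where k: "1 + \<gamma> = tt * k" using True ft by (auto simp: dvd_def)
        have pt: "pneg tt = - tt" by (simp add: pneg_pCons)
        have "pneg (f ^ e) = f ^ e" unfolding ft by (simp only: pneg_power pt power_minus_even[OF ev])
        hence "theta x (f ^ e) = theta x (\<gamma> * f ^ e)" using g(2)[of "f ^ e"] by simp
        hence "theta x (f ^ e) + theta x (f ^ e) = theta x (f ^ e + \<gamma> * f ^ e)"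
          by (simp add: functional_add[OF th])
        also have "f ^ e + \<gamma> * f ^ e = (1 + \<gamma>) * f ^ e" by (simp only: distrib_right mult_1)
        also have "\<dots> = ?F * k" unfolding k ft by (simp only: power_Suc mult_ac)
        also have "theta x \<dots> = 0" by (rule van) simp
        finally have "2 * theta x (f ^ e) = 0" by simp
        thus False using t two_nz by simp
      qed
    qed
    thus ?thesis by (intro exI[of _ tt]) (simp add: pbar_pCons)
  qed
  then obtain \<eta> where eta: "preal \<eta>" "\<not> f dvd \<eta> + \<gamma> * pneg \<eta>" by blast
  define w where "w = \<eta> + \<gamma> * pneg \<eta>"
  have "preal w" unfolding w_def by (simp only: pbar_add pbar_mult pbar_pneg eta g(1))
  moreover have "\<not> f dvd w" using eta(2) by (simp add: w_def)
  ultimately obtain y where y: "y \<in> Ker U ?F" "\<And>p. theta y p = theta x (w * p)" "radical_is (theta y) ?F"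
    using rescale[OF U f x ex] by blast
  have yU: "y \<in> U" and Fy: "act ?F y = 0" using y(1) by (simp_all only: Ker_def mem_Collect_eq)
  have sym: "theta y (pneg p) = theta y p" for p
  proof -
    have "theta y (pneg p) = theta x (pneg (pneg w * p))" by (simp add: y(2) pneg_mult)
    also have "\<dots> = theta x (\<gamma> * (pneg w * p))" by (rule g(2))
    also have "\<gamma> * (pneg w * p) = w * p + (\<gamma> * pneg \<gamma> - 1) * (\<eta> * p)"
      by (simp add: w_def pneg_add pneg_mult algebra_simps)
    also have "theta x \<dots> = theta x (w * p)"
      using van[OF dvd_mult2[OF gg]] by (simp add: functional_add[OF th])
    finally show ?thesis by (simp add: y(2))
  qed
  have "matched U y y" using matchedI[OF yU yU sym y(3)] act_dvd[OF Fy FF] by blast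
  hence "flips (cyclic y) (twist y y)" by (rule flips_single[OF U])
  moreover have "orth_split U (cyclic y) (perp U y)" by (rule cyclic_orth_split[OF U yU y(3) Fy])
  moreover have "cyclic y \<noteq> {0}"
  proof
    assume "cyclic y = {0}"
    hence "y = 0" using cyclic_self[of y] by simp
    hence "theta y p = 0" for p by (simp add: theta_def)
    hence "?F dvd 1" using radical_isD[OF y(3), of 1] by simp
    hence "f dvd 1" by (rule dvd_trans[rotated]) simp
    hence "deg f \<le> deg (1 :: 'a poly)" by (intro dvd_imp_degree_le) auto
    thus False using f by (simp add: irred_def)
  qed
  ultimately show ?thesis by blast
qed

text \<open>A partner for \<open>x\<close> has to be found in the orthogonal complement of its cyclic subspace. If \<open>f\<close> and
  \<open>f(-t)\<close> are coprime, the cyclic subspace has no \<open>f(-t)\<close>-primary part, and balance gives the exponent.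
  If \<open>f = t\<close> and the largest block size \<open>Suc e\<close> is even, the number of blocks of this size is even;
  one of them is spent on \<open>x\<close>, so another one is left.\<close>
lemma partner_top_exponent:
  assumes U: "sa_space U" and b: "balanced U" and E: "even_blocks U" and f: "irred f" and l: "top_exponent U f e"
    and x: "x \<in> Ker U (f ^ Suc e)" and t: "theta x (f ^ e) \<noteq> 0"
    and c: "\<not> f dvd pneg f \<or> f = tt \<and> odd e"
  shows "top_exponent (perp U x) (pneg f) e"
  using c
proof
  let ?F = "f ^ Suc e" and ?Y = "perp U x"
  have pf: "preal f" using f by (simp add: irred_def)
  have xU: "x \<in> U" and Fx: "act ?F x = 0" using x by (simp_all only: Ker_def mem_Collect_eq)
  have ex: "radical_is (theta x) ?F" using top_vector_radical[OF U f x, of 1] t by simp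
  have sp: "orth_split U (cyclic x) ?Y" by (rule cyclic_orth_split[OF U xU ex Fx])
  have gc: "sa_space (cyclic x)" using sp by (simp add: orth_split_def)
  have kill: "act ?F u = 0" if "u \<in> cyclic x" for u
    using that Fx act_commute[of ?F _ x] by (auto simp: cyclic_def)
  {
    assume nd: "\<not> f dvd pneg f"
    have K0: "Ker (cyclic x) (pneg f ^ i) = {0}" for i
    proof -
      have "\<not> f dvd pneg f ^ i"
      proof (induction i)
        case 0
        show ?case
        proof
          assume "f dvd pneg f ^ 0"
          hence "deg f \<le> deg (1 :: 'a poly)" by (intro dvd_imp_degree_le) auto
          thus False using f by (simp add: irred_def)
        qed
      next
        case (Suc i)
        have "preal (pneg f)" by (simp add: pbar_pneg pf)
        from irred_dvd_mult[OF f this, of "pneg f ^ i"] nd Suc show ?case by auto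
      qed
      moreover have "preal (pneg f ^ i)" by (simp only: pbar_power pbar_pneg pf)
      ultimately obtain r s where rs: "r * pneg f ^ i + s * ?F = 1" using irred_bezout_power[OF f] by blast
      have "u = 0" if "u \<in> cyclic x" "act (pneg f ^ i) u = 0" for u
      proof -
        have "u = act (r * pneg f ^ i + s * ?F) u" by (simp only: rs act_1)
        also have "\<dots> = 0" using kill[OF that(1)] that(2) by (simp only: act_add act_mult) simp
        finally show ?thesis .
      qed
      thus ?thesis using subspace_0[OF subspace_cyclic[of x]] by (auto simp: Ker_def)
    qed
    have "Ker ?Y (pneg f ^ i) = Ker U (pneg f ^ i)" for i
      using orth_split_Ker[OF sp, of "pneg f ^ i"] unfolding direct_def K0 by auto
    thus "top_exponent ?Y (pneg f) e" using top_exponent_pneg[OF U b l] unfolding top_exponent_def by metis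
  }
  {
    assume ft: "f = tt \<and> odd e"
    hence f_tt: "f = tt" by simp
    have pt: "pneg tt = - tt" by (simp add: pneg_pCons)
    have Kt: "Ker V (pneg tt ^ i) = Ker V (tt ^ i)" for V i
    proof (cases "even i")
      case True
      show ?thesis unfolding pt power_minus_even[OF True] ..
    next
      case False
      show ?thesis unfolding pt power_minus_odd[OF False] Ker_def act_minus neg_equal_0_iff_equal ..
    qed
    define m where "m = (e + 1) div 2"
    have "odd e" using ft by simp
    hence m: "m \<ge> 1" "2 * m - 1 = e" "2 * m + 1 = Suc (Suc e)" unfolding m_def by presburger+
    \<comment> \<open>the block size \<open>Suc e\<close> is \<open>2 m\<close>\<close>
    have "even (fdim (Ker U (tt ^ (2 * m - 1))) + fdim (Ker U (tt ^ (2 * m + 1))))"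
      using E m(1) unfolding even_blocks_def by blast
    hence ev: "even (fdim (Ker U (tt ^ e)) + fdim (Ker U (tt ^ Suc e)))"
      using l unfolding m(2,3) top_exponent_def f_tt by simp
    have KW: "Ker (cyclic x) ?F = cyclic x" using kill by (auto simp: Ker_def)
    have KH: "Ker (cyclic x) (tt ^ e) = {w \<in> cyclic x. B (act (tt ^ e) x) w = 0}"
    proof -
      have "act (tt ^ e) w = 0 \<longleftrightarrow> B (act (tt ^ e) x) w = 0" if "w \<in> cyclic x" for w
      proof -
        obtain p where p: "w = act p x" using \<open>w \<in> cyclic x\<close> by (auto simp: cyclic_def)
        obtain a r where ar: "p = pCons a r" by (cases p)
        have "p = [:a:] + tt * r" by (simp add: ar)
        hence tp: "tt ^ e * p = smult a (tt ^ e) + ?F * r"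
          unfolding f_tt by (simp add: algebra_simps)
        have 1: "act (tt ^ e) w = a *s act (tt ^ e) x"
        proof -
          have "act (tt ^ e) w = act (tt ^ e * p) x" by (simp only: p act_mult)
          also have "\<dots> = a *s act (tt ^ e) x + act (?F * r) x" unfolding tp by (simp only: act_add act_smult)
          also have "act (?F * r) x = 0" by (rule act_dvd[OF Fx]) simp
          finally show ?thesis by simp
        qed
        have pbt: "pbar (tt ^ e) = tt ^ e" by (simp only: pbar_power pbar_pCons bar_0 bar_1 pbar_0)
        have wU: "w \<in> U" using p sa_space_act[OF U xU] by simp
        have "B (act (tt ^ e) x) w = B x (act (tt ^ e) w)" using B_act[OF U xU wU, of "tt ^ e"] by (simp only: pbt)
        also have "\<dots> = bar a * B x (act (tt ^ e) x)" by (simp add: 1 B_scale_right)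
        also have "B x (act (tt ^ e) x) = bar (theta x (f ^ e))" unfolding theta_def f_tt by (rule B_swap)
        finally have "B (act (tt ^ e) x) w = 0 \<longleftrightarrow> a = 0" using t by simp
        moreover have "act (tt ^ e) x \<noteq> 0" using t unfolding theta_def f_tt by auto
        ultimately show ?thesis by (simp add: 1)
      qed
      thus ?thesis by (auto simp: Ker_def)
    qed
    have "CARD('a) * card (Ker (cyclic x) (tt ^ e)) = card (cyclic x)"
      unfolding KH by (rule hyperplane_card[OF subspace_cyclic sa_spaceD(2)[OF gc] cyclic_self])
        (use t in \<open>simp add: theta_def f_tt\<close>)
    hence "CARD('a) ^ Suc (fdim (Ker (cyclic x) (tt ^ e))) = CARD('a) ^ fdim (cyclic x)"
      using card_fdim[OF subspace_Ker[OF gc] finite_Ker[OF gc]] card_fdim[OF subspace_cyclic sa_spaceD(2)[OF gc]] by simp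
    hence "fdim (cyclic x) = Suc (fdim (Ker (cyclic x) (tt ^ e)))"
      using CARD_gt_1 by (metis power_inject_exp)
    hence "odd (fdim (Ker (cyclic x) (tt ^ e)) + fdim (Ker (cyclic x) (tt ^ Suc e)))"
      using KW unfolding f_tt by simp
    hence "odd (fdim (Ker ?Y (tt ^ e)) + fdim (Ker ?Y (tt ^ Suc e)))"
      using ev unfolding orth_split_fdim_Ker[OF sp] by presburger
    hence "Ker ?Y (tt ^ e) \<noteq> Ker ?Y (tt ^ Suc e)" by auto
    moreover have "Ker ?Y (tt ^ Suc e) = Ker ?Y (tt ^ Suc (Suc e))"
    proof -
      have "Ker ?Y p = ?Y \<inter> Ker U p" for p using orth_split_subset[OF sp] by (auto simp: Ker_def)
      thus ?thesis using l unfolding top_exponent_def f_tt by simp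
    qed
    ultimately show "top_exponent ?Y (pneg f) e" unfolding top_exponent_def f_tt Kt by blast
  }
qed

text \<open>The flip interchanges the cyclic subspaces of two orthogonal vectors, whose Gram functionals
  correspond to each other under \<open>t \<mapsto> - t\<close> once the second vector has been rescaled.\<close>
lemma ex_pair_summand:
  assumes U: "sa_space U" and b: "balanced U" and E: "even_blocks U" and f: "irred f" and l: "top_exponent U f e"
    and c: "\<not> f dvd pneg f \<or> f = tt \<and> odd e"
  shows "\<exists>S Y. orth_split U S Y \<and> S \<noteq> {0} \<and> (\<exists>s. flips S s)"
proof -
  let ?F = "f ^ Suc e"
  have pf: "preal f" using f by (simp add: irred_def)
  obtain x where x: "x \<in> Ker U ?F" and t: "theta x (f ^ e) \<noteq> 0" using ex_top_vector[OF U pf l] by blast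
  have xU: "x \<in> U" and Fx: "act ?F x = 0" using x by (simp_all only: Ker_def mem_Collect_eq)
  have ex: "radical_is (theta x) ?F" using top_vector_radical[OF U f x, of 1] t by simp
  let ?V = "perp U x" and ?h = "pneg f"
  have sp: "orth_split U (cyclic x) ?V" by (rule cyclic_orth_split[OF U xU ex Fx])
  have gV: "sa_space ?V" using sp by (simp add: orth_split_def)
  have h: "irred ?h" by (rule irred_pneg[OF f])
  have ph: "preal ?h" using h by (simp add: irred_def)
  obtain y0 where y0: "y0 \<in> Ker ?V (?h ^ Suc e)" "theta y0 (?h ^ e) \<noteq> 0"
    using ex_top_vector[OF gV ph partner_top_exponent[OF U b E f l x t c]] by blast
  have ex0: "radical_is (theta y0) (?h ^ Suc e)" using top_vector_radical[OF gV h y0(1), of 1] y0(2) by simp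
  have y0V: "y0 \<in> ?V" using y0(1) by (simp add: Ker_def)
  have van: "theta x (pneg (?h ^ Suc e * p)) = 0" for p
  proof -
    have "?F dvd pneg (?h ^ Suc e * p)" by (simp only: pneg_mult pneg_power pneg_pneg dvd_triv_left)
    from act_dvd[OF Fx this] show ?thesis by (simp add: theta_def)
  qed
  obtain w where w: "preal w" "\<And>p. theta x (pneg p) = theta y0 (w * p)"
    using dual_repr_real[OF ex0 functional_pneg[OF functional_theta] van equivar_theta[OF gV y0V]
        equivar_pneg[OF equivar_theta[OF U xU]]] by blast
  have "\<not> ?h dvd w"
  proof
    assume "?h dvd w"
    hence d: "?h ^ Suc e dvd w * ?h ^ e" by (simp add: mult_dvd_mono)
    have "act (?h ^ Suc e) y0 = 0" using y0(1) by (simp only: Ker_def mem_Collect_eq)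
    from act_dvd[OF this d] have "theta y0 (w * ?h ^ e) = 0" by (simp add: theta_def)
    hence "theta x (pneg (?h ^ e)) = 0" by (simp only: w(2))
    thus False using t by (simp only: pneg_power pneg_pneg)
  qed
  then obtain y where y: "y \<in> Ker ?V (?h ^ Suc e)" "\<And>p. theta y p = theta y0 (w * p)"
    "radical_is (theta y) (?h ^ Suc e)" using rescale[OF gV h y0(1) ex0 w(1)] by blast
  have yV: "y \<in> ?V" and Fy: "act (?h ^ Suc e) y = 0" using y(1) by (simp_all only: Ker_def mem_Collect_eq)
  have yU: "y \<in> U" using yV orth_split_subset[OF sp] by blast
  have hF: "?h ^ Suc e = pneg ?F" by (simp only: pneg_power)
  have "theta y (pneg p) = theta x p" for p using w(2)[of "pneg p"] y(2)[of "pneg p"] by simp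
  hence m1: "matched U x y" using matchedI[OF xU yU _ ex] Fy unfolding hF by blast
  have m2: "matched U y x" using matched_swap[OF m1 ex Fx] y(3) Fy unfolding hF by blast
  have "orth_split ?V (cyclic y) (perp ?V y)" by (rule cyclic_orth_split[OF gV yV y(3) Fy])
  from orth_split_assoc[OF sp this] obtain S where S: "orth_split S (cyclic x) (cyclic y)" "orth_split U S (perp ?V y)" by blast
  have "x \<noteq> 0" using t by (auto simp: theta_def)
  moreover have "x \<in> S" using orth_split_subset[OF S(1)] cyclic_self by blast
  ultimately have "S \<noteq> {0}" by blast
  with S(2) flips_pair[OF U m1 m2 S(1)] show ?thesis by blast
qed

text \<open>A summand that carries a flip is itself balanced and has even blocks, so by counting the same is
  true of its orthogonal complement.\<close>
theorem ex_flips: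
  assumes "sa_space U" "balanced U" "even_blocks U"
  shows "\<exists>s. flips U s"
  using assms
proof (induction "card U" arbitrary: U rule: less_induct)
  case less
  note U = less.prems
  show ?case
  proof (cases "U = {0}")
    case True
    have "flips U (\<lambda>u. u)" unfolding True flips_def by (simp add: lin_0[OF T])
    thus ?thesis by (rule exI[of "flips U"])
  next
    case False
    obtain f where f: "irred f" "Ker U f \<noteq> {0}" "Ker U tt \<noteq> {0} \<longrightarrow> f = tt"
      using ex_irred_Ker[OF U(1) False] by blast
    obtain e where l: "top_exponent U f e" using ex_top_exponent[OF U(1) f(2)] by blast
    have ft: "f dvd tt \<longrightarrow> f = tt"
    proof
      assume d: "f dvd tt"
      have "Ker U f \<subseteq> Ker U tt" unfolding Ker_def using act_dvd[OF _ d] by blast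
      moreover have "0 \<in> Ker U f" using subspace_0[OF subspace_Ker[OF U(1)]] .
      ultimately have "Ker U tt \<noteq> {0}" using f(2) by blast
      thus "f = tt" using f(3) by blast
    qed
    have "\<exists>S Y. orth_split U S Y \<and> S \<noteq> {0} \<and> (\<exists>s. flips S s)"
    proof (cases "\<not> f dvd pneg f \<or> f = tt \<and> odd e")
      case True
      thus ?thesis using ex_pair_summand U f(1) l by blast
    next
      case False
      thus ?thesis using ex_cyclic_summand[OF U(1) f(1) _ l] ft by blast
    qed
    then obtain S Y s where S: "orth_split U S Y" "S \<noteq> {0}" "flips S s" by blast
    have gS: "sa_space S" and gY: "sa_space Y" using S(1) by (auto simp: orth_split_def)
    have "balanced Y" using orth_split_balanced[OF S(1) U(2) flips_balanced[OF gS S(3)]] .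
    moreover have "even_blocks Y" using orth_split_even_blocks[OF S(1) U(3) flips_even_blocks[OF gS S(3)]] .
    moreover have "card Y < card U"
    proof -
      obtain v where "v \<in> S" "v \<noteq> 0" using S(2) subspace_0[OF sa_spaceD(1)[OF gS]] by blast
      hence "v \<in> U" "v \<notin> Y" using orth_split_subset[OF S(1)] S(1) by (auto simp: orth_split_def direct_def)
      hence "Y \<subset> U" using orth_split_subset[OF S(1)] by blast
      thus ?thesis using sa_spaceD(2)[OF U(1)] by (rule psubset_card_mono[rotated])
    qed
    ultimately obtain s' where "flips Y s'" using less.hyps[OF _ gY] by blast
    from flips_join[OF S(1) S(3) this] show ?thesis .
  qed
qed

end

section \<open>The Cayley transform\<close>

context herm begin

definition herm_space :: "'v set \<Rightarrow> bool" where
  "herm_space U \<longleftrightarrow> subspace U \<and> finite U \<and> (\<forall>u\<in>U. (\<forall>v\<in>U. B u v = 0) \<longrightarrow> u = 0)"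

definition isometry_on :: "'v set \<Rightarrow> ('v \<Rightarrow> 'v) \<Rightarrow> bool" where
  "isometry_on U g \<longleftrightarrow> lin g \<and> (\<forall>u\<in>U. g u \<in> U) \<and> (\<forall>u\<in>U. \<forall>v\<in>U. B (g u) (g v) = B u v)"

text \<open>The last condition says that \<open>h\<close> conjugates \<open>g\<close> to its inverse, without mentioning the inverse.\<close>
definition inverts :: "'v set \<Rightarrow> ('v \<Rightarrow> 'v) \<Rightarrow> ('v \<Rightarrow> 'v) \<Rightarrow> bool" where
  "inverts U g h \<longleftrightarrow> (\<forall>u\<in>U. h u \<in> U) \<and> (\<forall>u\<in>U. \<forall>v\<in>U. h (u + v) = h u + h v) \<and>
     (\<forall>c. \<forall>u\<in>U. h (c *s u) = c *s h u) \<and> (\<forall>u\<in>U. \<forall>v\<in>U. B (h u) (h v) = B u v) \<and>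
     (\<forall>u\<in>U. g (h (g u)) = h u)"

text \<open>The counterpart of \<open>even_blocks\<close> for an arbitrary operator.\<close>
definition even_jumps :: "'v set \<Rightarrow> ('v \<Rightarrow> 'v) \<Rightarrow> bool" where
  "even_jumps U D \<longleftrightarrow> (\<forall>m\<ge>1. even (fdim {u \<in> U. (D ^^ (2 * m - 1)) u = 0} + fdim {u \<in> U. (D ^^ (2 * m + 1)) u = 0}))"

lemma isometry_on_inj: assumes "herm_space U" "isometry_on U g" shows "inj_on g U"
proof (rule inj_onI)
  fix u v assume uv: "u \<in> U" "v \<in> U" "g u = g v"
  have l: "lin g" and iso: "\<And>u v. u \<in> U \<Longrightarrow> v \<in> U \<Longrightarrow> B (g u) (g v) = B u v"
    using assms(2) unfolding isometry_on_def by blast+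
  have d: "u - v \<in> U" using uv assms(1) subspace_diff unfolding herm_space_def by blast
  have "g (u - v) = 0" using uv by (simp add: lin_diff[OF l])
  hence "B (u - v) w = 0" if "w \<in> U" for w using iso[OF d that] by simp
  hence "u - v = 0" using assms(1) d unfolding herm_space_def by blast
  thus "u = v" by simp
qed

lemma inverts_inj: assumes "herm_space U" "inverts U g h" shows "inj_on h U"
proof (rule inj_onI)
  fix u v assume uv: "u \<in> U" "v \<in> U" "h u = h v"
  have add: "\<And>u v. u \<in> U \<Longrightarrow> v \<in> U \<Longrightarrow> h (u + v) = h u + h v"
    and sc: "\<And>c u. u \<in> U \<Longrightarrow> h (c *s u) = c *s h u"
    and iso: "\<And>u v. u \<in> U \<Longrightarrow> v \<in> U \<Longrightarrow> B (h u) (h v) = B u v"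
    using assms(2) unfolding inverts_def by blast+
  have U: "subspace U" using assms(1) unfolding herm_space_def by blast
  have d: "u - v \<in> U" "- v \<in> U" using uv U subspace_diff subspace_neg by blast+
  have "h (u + - v) = h u + (-1) *s h v" using add[OF uv(1) d(2)] sc[OF uv(2), of "-1"] by simp
  hence "h (u - v) = 0" using uv by simp
  hence "B (u - v) w = 0" if "w \<in> U" for w using iso[OF d(1) that] by simp
  hence "u - v = 0" using assms(1) d unfolding herm_space_def by blast
  thus "u = v" by simp
qed

lemma idempotent_power:
  assumes "finite U" and N: "\<And>u. u \<in> U \<Longrightarrow> N u \<in> U"
  shows "\<exists>n\<ge>1. \<forall>u\<in>U. (N ^^ n) ((N ^^ n) u) = (N ^^ n) u"
proof -
  have pw: "(N ^^ i) u \<in> U" if "u \<in> U" for i u using that N by (induction i) auto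
  define r where "r i = (\<lambda>u. if u \<in> U then (N ^^ i) u else undefined)" for i
  have "range r \<subseteq> {f. \<forall>x. (x \<in> U \<longrightarrow> f x \<in> U) \<and> (x \<notin> U \<longrightarrow> f x = undefined)}"
    using pw by (auto simp: r_def)
  hence "finite (range r)" using finite_set_of_finite_funs[OF assms(1) assms(1)] finite_subset by blast
  hence "\<not> inj r" using finite_imageD infinite_UNIV_nat by blast
  then obtain i j where "i \<noteq> j" "r i = r j" unfolding inj_def by blast
  hence "\<exists>i j. i < j \<and> r i = r j" by (metis nat_neq_iff)
  then obtain i j where ij: "i < j" "r i = r j" by blast
  define d where "d = j - i"
  have step: "(N ^^ (k + d)) u = (N ^^ k) u" if "k \<ge> i" "u \<in> U" for k u
  proof -
    have "(N ^^ j) u = (N ^^ i) u" using fun_cong[OF ij(2), of u] that by (simp add: r_def)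
    hence "(N ^^ (k - i)) ((N ^^ j) u) = (N ^^ (k - i)) ((N ^^ i) u)" by simp
    hence "(N ^^ (k - i + j)) u = (N ^^ (k - i + i)) u" by (simp only: funpow_add o_apply)
    moreover have "k - i + j = k + d" "k - i + i = k" using that ij by (auto simp: d_def)
    ultimately show ?thesis by simp
  qed
  have steps: "(N ^^ (k + m * d)) u = (N ^^ k) u" if "k \<ge> i" "u \<in> U" for k m u
  proof (induction m)
    case (Suc m)
    have "k + Suc m * d = (k + m * d) + d" by simp
    thus ?case using step[of "k + m * d" u] Suc that by (simp only:)
  qed simp
  define n where "n = Suc i * d"
  have d1: "d \<ge> 1" using ij by (simp add: d_def)
  hence "n \<ge> Suc i" using mult_le_mono2[OF d1, of "Suc i"] by (simp only: n_def mult_1_right)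
  moreover have "(N ^^ n) ((N ^^ n) u) = (N ^^ n) u" if "u \<in> U" for u
  proof -
    have "(N ^^ n) ((N ^^ n) u) = (N ^^ (n + Suc i * d)) u" by (simp only: funpow_add o_apply n_def)
    also have "\<dots> = (N ^^ n) u" using steps[of n u "Suc i"] that \<open>n \<ge> Suc i\<close> by simp
    finally show ?thesis .
  qed
  ultimately show ?thesis by (intro exI[of _ n]) auto
qed

lemma funpow_commute: assumes "\<And>v. a (b v) = b (a v)" shows "(a ^^ i) (b v) = b ((a ^^ i) v)"
  by (induction i) (auto simp: assms)

lemma double_cancel: assumes "u + u = v + v" shows "u = (v :: 'v)"
proof -
  have "(u - v) + (u - v) = 0" using assms by (simp add: algebra_simps)
  hence "2 *s (u - v) = 0" by (metis one_add_one scale_left_distrib scale_one)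
  thus ?thesis using two_nz by simp
qed

text \<open>The Cayley transform \<open>T = \<iota> (g + 1) (g - 1)\<^sup>-\<^sup>1\<close> is self-adjoint on \<open>U\<close>, a linear map inverts \<open>g\<close> if
  and only if it anticommutes with \<open>T\<close>, and powers of \<open>T\<close> and of \<open>g + 1\<close> have the same kernels in
  \<open>U\<close>. The inverse of \<open>g - 1\<close> on \<open>U\<close> is taken to be a power of \<open>g - 1\<close>, because \<open>T\<close> has to be linear
  on the whole ambient space.\<close>
theorem involution_iff_even_jumps_off_1:
  assumes U: "herm_space U" and g: "isometry_on U g" and inj: "\<And>u. u \<in> U \<Longrightarrow> g u = u \<Longrightarrow> u = 0"
    and h: "inverts U g h"
  shows "(\<exists>s. inverts U g s \<and> (\<forall>u\<in>U. s (s u) = u)) \<longleftrightarrow> even_jumps U (\<lambda>v. g v + v)"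
proof -
  have sub: "subspace U" and fin: "finite U" and nd: "\<And>u. u \<in> U \<Longrightarrow> (\<And>v. v \<in> U \<Longrightarrow> B u v = 0) \<Longrightarrow> u = 0"
    using U unfolding herm_space_def by blast+
  have lg: "lin g" and gU: "\<And>u. u \<in> U \<Longrightarrow> g u \<in> U"
    and iso: "\<And>u v. u \<in> U \<Longrightarrow> v \<in> U \<Longrightarrow> B (g u) (g v) = B u v" using g unfolding isometry_on_def by blast+
  define N where "N = (\<lambda>v. g v - v)"
  define P where "P = (\<lambda>v. g v + v)"
  have lN: "lin N" unfolding lin_def N_def
    by (simp add: lin_add[OF lg] lin_scale[OF lg] scale_right_diff_distrib)
  have lP: "lin P" unfolding lin_def P_def
    by (simp add: lin_add[OF lg] lin_scale[OF lg] scale_right_distrib)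
  have NU: "N u \<in> U" and PU: "P u \<in> U" if "u \<in> U" for u
    unfolding N_def P_def using that gU sub subspace_diff subspace_add by blast+
  have Nker: "u = 0" if "u \<in> U" "N u = 0" for u using inj[OF that(1)] that(2) by (simp add: N_def)
  have pwU: "(N ^^ i) u \<in> U" if "u \<in> U" for i u using that NU by (induction i) auto
  have pwker: "u = 0" if "u \<in> U" "(N ^^ i) u = 0" for i u
    using that(2)
  proof (induction i)
    case (Suc i)
    have "N ((N ^^ i) u) = 0" using Suc.prems by simp
    hence "(N ^^ i) u = 0" by (rule Nker[OF pwU[OF that(1)]])
    thus ?case by (rule Suc.IH)
  qed simp
  obtain n where n: "n \<ge> 1" "\<And>u. u \<in> U \<Longrightarrow> (N ^^ n) ((N ^^ n) u) = (N ^^ n) u"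
    using idempotent_power[of U N, OF fin NU] by blast
  have Nn: "(N ^^ n) u = u" if "u \<in> U" for u
  proof -
    have "(N ^^ n) ((N ^^ n) u - u) = 0" using n(2)[OF that] by (simp add: lin_diff[OF lin_funpow[OF lN]])
    moreover have "(N ^^ n) u - u \<in> U" using that pwU sub subspace_diff by blast
    ultimately have "(N ^^ n) u - u = 0" using pwker by blast
    thus ?thesis by simp
  qed
  define M where "M = N ^^ (n - 1)"
  have lM: "lin M" unfolding M_def by (rule lin_funpow[OF lN])
  have MU: "M u \<in> U" if "u \<in> U" for u unfolding M_def by (rule pwU[OF that])
  obtain n' where n': "n = Suc n'" using n(1) by (cases n) auto
  have NM: "N (M u) = u" if "u \<in> U" for u using Nn[OF that] by (simp add: M_def n')
  have MN: "M (N u) = u" if "u \<in> U" for u using Nn[OF that] by (simp add: M_def n' funpow_swap1)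
  have NP: "N (P v) = P (N v)" for v
    by (simp add: N_def P_def lin_diff[OF lg] lin_add[OF lg])
  have MP: "M (P v) = P (M v)" for v unfolding M_def by (rule funpow_commute) (rule NP)
  define T where "T = (\<lambda>v. \<iota> *s P (M v))"
  have lT: "lin T" unfolding T_def lin_def
    by (simp add: lin_add[OF lM] lin_add[OF lP] lin_scale[OF lM] lin_scale[OF lP] scale_right_distrib
        scale_left_commute)
  interpret C: herm_op bar \<iota> "(*s)" B T by unfold_locales (rule lT)
  have TU: "T u \<in> U" if "u \<in> U" for u
    unfolding T_def using that MU PU sub subspace_scale by blast
  have TN: "T (N a) = \<iota> *s (g a + a)" if "a \<in> U" for a
    unfolding T_def MN[OF that] by (simp add: P_def)
  have adj: "B (T u) v = B u (T v)" if uv: "u \<in> U" "v \<in> U" for u v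
  proof -
    define a b where "a = M u" and "b = M v"
    have ab: "a \<in> U" "b \<in> U" "u = N a" "v = N b" using uv by (simp_all add: a_def b_def MU NM)
    show ?thesis unfolding ab(3,4) TN[OF ab(1)] TN[OF ab(2)] unfolding N_def
      using iso[OF ab(1,2)]
      by (simp add: B_scale_left B_scale_right bar_iota B_add_left B_add_right B_diff_left B_diff_right algebra_simps)
  qed
  have sa_space: "C.sa_space U" unfolding C.sa_space_def using sub fin TU adj nd by blast
  have anti: "s (T u) = - T (s u)" if s: "inverts U g s" and u: "u \<in> U" for s u
  proof -
    have sU: "\<And>u. u \<in> U \<Longrightarrow> s u \<in> U" and add: "\<And>u v. u \<in> U \<Longrightarrow> v \<in> U \<Longrightarrow> s (u + v) = s u + s v"
      and sc: "\<And>c u. u \<in> U \<Longrightarrow> s (c *s u) = c *s s u" and inv: "\<And>u. u \<in> U \<Longrightarrow> g (s (g u)) = s u"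
      using s unfolding inverts_def by blast+
    define a b where "a = M u" and "b = s (g a)"
    have a: "a \<in> U" "u = N a" using u by (simp_all add: a_def MU NM)
    have b: "b \<in> U" "g b = s a" unfolding b_def using inv[OF a(1)] sU gU a by auto
    have "s u = b - g b"
    proof -
      have "s (g a + (-1) *s a) = s (g a) + (-1) *s s a"
        using add[OF gU[OF a(1)] subspace_scale[OF sub a(1)], of "-1"] sc[OF a(1), of "-1"] by simp
      thus ?thesis by (simp add: a(2) N_def b_def[symmetric] b(2))
    qed
    hence "s u = N (- b)" by (simp add: N_def lin_minus[OF lg])
    hence "T (s u) = \<iota> *s (g (- b) + - b)" using TN[of "- b"] b(1) sub subspace_neg by simp
    moreover have "s (T u) = \<iota> *s (b + s a)"
      unfolding a(2) TN[OF a(1)] b_def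
      using sc[of "g a + a" \<iota>] add[OF gU[OF a(1)] a(1)] subspace_add[OF sub gU[OF a(1)] a(1)] by simp
    ultimately show ?thesis
      by (simp add: lin_minus[OF lg] b(2) scale_right_distrib scale_right_diff_distrib)
  qed
  have Kers: "C.Ker U (C.tt ^ j) = {u \<in> U. (P ^^ j) u = 0}" for j
  proof -
    have "(T ^^ j) u = 0 \<longleftrightarrow> (P ^^ j) u = 0" if "u \<in> U" for u
      using that
    proof (induction j arbitrary: u)
      case (Suc j)
      have lPj: "lin (P ^^ j)" by (rule lin_funpow[OF lP])
      have PjU: "(P ^^ j) (P u) \<in> U" using Suc.prems PU by (induction j) auto
      have "(T ^^ Suc j) u = 0 \<longleftrightarrow> (T ^^ j) (T u) = 0" by (simp add: funpow_swap1)
      also have "\<dots> \<longleftrightarrow> (P ^^ j) (T u) = 0" by (rule Suc.IH[OF TU[OF Suc.prems]])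
      also have "(P ^^ j) (T u) = \<iota> *s M ((P ^^ j) (P u))"
        unfolding T_def MP[symmetric] by (simp add: lin_scale[OF lPj] funpow_commute MP)
      also have "\<dots> = 0 \<longleftrightarrow> (P ^^ j) (P u) = 0"
        using NM[OF PjU] lin_0[OF lM] lin_0[OF lN] iota_nz by auto
      finally show ?case by (simp add: funpow_swap1)
    qed simp
    thus ?thesis unfolding C.Ker_def C.act_tt_power by auto
  qed
  have ej: "C.even_blocks U \<longleftrightarrow> even_jumps U (\<lambda>v. g v + v)"
    unfolding C.even_blocks_def even_jumps_def Kers P_def ..
  show ?thesis
  proof
    assume "\<exists>s. inverts U g s \<and> (\<forall>u\<in>U. s (s u) = u)"
    then obtain s where s: "inverts U g s" "\<forall>u\<in>U. s (s u) = u" by blast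
    have "C.flips U s" unfolding C.flips_def
      using s anti[OF s(1)] unfolding inverts_def by blast
    thus "even_jumps U (\<lambda>v. g v + v)" using C.flips_even_blocks[OF sa_space] ej by blast
  next
    assume "even_jumps U (\<lambda>v. g v + v)"
    hence eb: "C.even_blocks U" using ej by blast
    have "C.balanced U"
      by (rule C.anti_balanced[OF sa_space, of h])
        (use h anti[OF h] inverts_inj[OF U h] in \<open>unfold inverts_def, blast+\<close>)
    from C.ex_flips[OF sa_space this eb] obtain s where s: "C.flips U s" by blast
    have sU: "\<And>u. u \<in> U \<Longrightarrow> s u \<in> U" and add: "\<And>u v. u \<in> U \<Longrightarrow> v \<in> U \<Longrightarrow> s (u + v) = s u + s v"
      and sc: "\<And>c u. u \<in> U \<Longrightarrow> s (c *s u) = c *s s u" and sT: "\<And>u. u \<in> U \<Longrightarrow> s (T u) = - T (s u)"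
      and sB: "\<And>u v. u \<in> U \<Longrightarrow> v \<in> U \<Longrightarrow> B (s u) (s v) = B u v" and ss: "\<And>u. u \<in> U \<Longrightarrow> s (s u) = u"
      using s unfolding C.flips_def by blast+
    have "g (s (g a)) = s a" if a: "a \<in> U" for a
    proof -
      have ga: "g a \<in> U" by (rule gU[OF a])
      have Na: "N a \<in> U" by (rule NU[OF a])
      define c where "c = M (s (N a))"
      have c: "c \<in> U" "s (N a) = N c" unfolding c_def using sU[OF Na] by (simp_all add: MU NM)
      have "s (g a + (-1) *s a) = s (g a) + (-1) *s s a"
        using add[OF ga subspace_scale[OF sub a], of "-1"] sc[OF a, of "-1"] by simp
      hence 1: "s (g a) - s a = g c - c" using c(2) by (simp add: N_def)
      have "s (T (N a)) = \<iota> *s (s (g a) + s a)"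
        unfolding TN[OF a] using sc[of "g a + a" \<iota>] add[OF ga a] subspace_add[OF sub ga a] by simp
      moreover have "s (T (N a)) = - (\<iota> *s (g c + c))" using sT[OF Na] unfolding c(2) TN[OF c(1)] .
      ultimately have "\<iota> *s (s (g a) + s a) = \<iota> *s - (g c + c)" by (simp only: scale_minus_right)
      hence 2: "s (g a) + s a = - (g c + c)" by (rule scale_left_imp_eq[OF iota_nz])
      have "s (g a) + s (g a) = (s (g a) - s a) + (s (g a) + s a)" by simp
      also have "\<dots> = - c + - c" unfolding 1 2 by simp
      finally have 3: "s (g a) = - c" by (rule double_cancel)
      have "s a + s a = (s (g a) + s a) - (s (g a) - s a)" by simp
      also have "\<dots> = g (- c) + g (- c)" unfolding 1 2 by (simp add: lin_minus[OF lg])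
      finally have "s a = g (- c)" by (rule double_cancel)
      thus ?thesis using 3 by simp
    qed
    hence "inverts U g s" unfolding inverts_def using sU add sc sB by blast
    thus "\<exists>s. inverts U g s \<and> (\<forall>u\<in>U. s (s u) = u)" using ss by blast
  qed
qed

lemma involution_orthogonal_sum:
  assumes d: "direct U W Y" and orth: "\<And>w y. w \<in> W \<Longrightarrow> y \<in> Y \<Longrightarrow> B w y = 0"
    and lg: "lin g" and gW: "\<And>w. w \<in> W \<Longrightarrow> g w \<in> W" and gY: "\<And>y. y \<in> Y \<Longrightarrow> g y \<in> Y"
    and s1: "inverts W g s1" "\<forall>w\<in>W. s1 (s1 w) = w" and s2: "inverts Y g s2" "\<forall>y\<in>Y. s2 (s2 y) = y"
  shows "\<exists>s. inverts U g s \<and> (\<forall>u\<in>U. s (s u) = u)"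
proof -
  have h1: "s1 w \<in> W" "s1 (s1 w) = w" "g (s1 (g w)) = s1 w" if "w \<in> W" for w
    using s1 that unfolding inverts_def by blast+
  have h2: "s2 y \<in> Y" "s2 (s2 y) = y" "g (s2 (g y)) = s2 y" if "y \<in> Y" for y
    using s2 that unfolding inverts_def by blast+
  have iso: "isometric W s1" "isometric Y s2" using s1 s2 unfolding inverts_def isometric_def by blast+
  obtain s where si: "isometric U s" and s: "\<And>w y. w \<in> W \<Longrightarrow> y \<in> Y \<Longrightarrow> s (w + y) = s1 w + s2 y"
    using glue_isometric[OF d orth iso orth[OF h1(1) h2(1)]] by blast
  have "s u \<in> U \<and> s (s u) = u \<and> g (s (g u)) = s u" if "u \<in> U" for u
  proof -
    obtain w y where u: "u = w + y" "w \<in> W" "y \<in> Y" using d \<open>u \<in> U\<close> unfolding direct_def by blast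
    have su: "s u = s1 w + s2 y" unfolding u(1) by (rule s[OF u(2,3)])
    have "s u \<in> U" unfolding su using d h1(1)[OF u(2)] h2(1)[OF u(3)] unfolding direct_def by blast
    moreover have "s (s u) = u" unfolding su s[OF h1(1)[OF u(2)] h2(1)[OF u(3)]] by (simp add: h1 h2 u)
    moreover have "g (s (g u)) = s u"
      unfolding su unfolding u(1) lin_add[OF lg] s[OF gW[OF u(2)] gY[OF u(3)]] by (simp add: h1 h2 u lin_add[OF lg])
    ultimately show ?thesis by blast
  qed
  hence "inverts U g s \<and> (\<forall>u\<in>U. s (s u) = u)" using si unfolding inverts_def isometric_def by blast
  thus ?thesis by (rule exI[of "\<lambda>s. inverts U g s \<and> (\<forall>u\<in>U. s (s u) = u)" s])
qed

lemma even_jumps_restrict: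
  assumes W: "W \<subseteq> U" and k: "\<And>u j. u \<in> U \<Longrightarrow> (D ^^ j) u = 0 \<Longrightarrow> u \<in> W"
  shows "even_jumps U D \<longleftrightarrow> even_jumps W D"
proof -
  have "{u \<in> U. (D ^^ j) u = 0} = {u \<in> W. (D ^^ j) u = 0}" for j using W k by blast
  thus ?thesis unfolding even_jumps_def by (simp only:)
qed

text \<open>An idempotent power \<open>E\<close> of \<open>g - 1\<close> splits \<open>U\<close> into its kernel \<open>V\<close>, the generalised eigenspace of
  \<open>1\<close>, and its image \<open>W\<close>. Up to the unitary \<open>g\<close> and a sign, \<open>g - 1\<close> is its own adjoint, so the
  splitting is orthogonal, and up to the same factors it commutes with every map inverting \<open>g\<close>, so such
  maps respect the splitting. The Cayley transform handles \<open>g\<close> on \<open>W\<close> and \<open>- g\<close> on \<open>V\<close>.\<close>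
theorem involution_iff_even_jumps:
  assumes U: "herm_space U" and g: "isometry_on U g" and h: "inverts U g h"
  shows "(\<exists>s. inverts U g s \<and> (\<forall>u\<in>U. s (s u) = u)) \<longleftrightarrow>
    even_jumps U (\<lambda>v. g v - v) \<and> even_jumps U (\<lambda>v. g v + v)"
proof -
  have sub: "subspace U" and fin: "finite U" and nd: "\<And>u. u \<in> U \<Longrightarrow> (\<And>v. v \<in> U \<Longrightarrow> B u v = 0) \<Longrightarrow> u = 0"
    using U unfolding herm_space_def by blast+
  have lg: "lin g" and gU: "\<And>u. u \<in> U \<Longrightarrow> g u \<in> U"
    and iso: "\<And>u v. u \<in> U \<Longrightarrow> v \<in> U \<Longrightarrow> B (g u) (g v) = B u v" using g unfolding isometry_on_def by blast+
  define N where "N = (\<lambda>v. g v - v)"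
  define P where "P = (\<lambda>v. g v + v)"
  have lN: "lin N" unfolding lin_def N_def
    by (simp add: lin_add[OF lg] lin_scale[OF lg] scale_right_diff_distrib)
  have lP: "lin P" unfolding lin_def P_def
    by (simp add: lin_add[OF lg] lin_scale[OF lg] scale_right_distrib)
  have NU: "N u \<in> U" if "u \<in> U" for u
    unfolding N_def using that gU sub subspace_diff by blast
  obtain n where n: "n \<ge> 1" "\<And>u. u \<in> U \<Longrightarrow> (N ^^ n) ((N ^^ n) u) = (N ^^ n) u"
    using idempotent_power[of U N, OF fin NU] by blast
  define E where "E = N ^^ n"
  have lE: "lin E" unfolding E_def by (rule lin_funpow[OF lN])
  have EE: "E (E u) = E u" if "u \<in> U" for u unfolding E_def by (rule n(2)[OF that])
  have pwU: "(N ^^ i) u \<in> U" if "u \<in> U" for i u using that NU by (induction i) auto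
  have EU: "E u \<in> U" if "u \<in> U" for u unfolding E_def by (rule pwU[OF that])
  define V where "V = {u \<in> U. E u = 0}"
  define W where "W = {u \<in> U. E u = u}"
  have sV: "subspace V" and sW: "subspace W"
    unfolding V_def W_def using sub
    by (intro subspaceI; simp add: subspace_0 subspace_add subspace_scale lin_0[OF lE] lin_add[OF lE] lin_scale[OF lE])+
  have VU: "V \<subseteq> U" "W \<subseteq> U" by (auto simp: V_def W_def)
  have int: "V \<inter> W \<subseteq> {0}" by (auto simp: V_def W_def)
  have dec: "u - E u \<in> V" "E u \<in> W" if "u \<in> U" for u
    using that EU EE sub by (auto simp: V_def W_def lin_diff[OF lE] intro: subspace_diff)
  have "U = {x + y | x y. x \<in> V \<and> y \<in> W}"
  proof (intro equalityI subsetI)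
    fix u assume "u \<in> U"
    moreover have "u = (u - E u) + E u" by simp
    ultimately show "u \<in> {x + y | x y. x \<in> V \<and> y \<in> W}" using dec by blast
  next
    fix u assume "u \<in> {x + y | x y. x \<in> V \<and> y \<in> W}"
    thus "u \<in> U" using VU subspace_add[OF sub] by blast
  qed
  hence dir: "direct U V W" unfolding direct_def using sV sW int by blast
  have Ng: "N (g v) = g (N v)" for v by (simp add: N_def lin_diff[OF lg])
  have Eg: "E (g v) = g (E v)" for v unfolding E_def by (rule funpow_commute) (rule Ng)
  have NE: "E (N v) = N (E v)" for v unfolding E_def by (rule funpow_commute) simp
  have gV: "g v \<in> V" if "v \<in> V" for v using that gU by (auto simp: V_def Eg lin_0[OF lg])
  have gW: "g v \<in> W" if "v \<in> W" for v using that gU by (auto simp: W_def Eg)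
  have injg: "inj_on g U" by (rule isometry_on_inj[OF U g])
  have finV: "finite V" "finite W" using VU fin finite_subset by blast+
  have gVV: "g ` V = V"
    by (rule endo_inj_surj[OF finV(1)]) (use gV inj_on_subset[OF injg VU(1)] in auto)
  have gpow: "\<exists>v'\<in>V. v = (g ^^ i) v'" if "v \<in> V" for v i
    using that
  proof (induction i arbitrary: v)
    case (Suc i)
    then obtain v' where "v' \<in> V" "v = g v'" using gVV by blast
    thus ?case using Suc.IH[of v'] by auto
  qed simp
  have gpU: "(g ^^ i) u \<in> U" if "u \<in> U" for i u using that gU by (induction i) auto
  have Nadj: "B (N u) (g w) = - B u (N w)" if "u \<in> U" "w \<in> U" for u w
    using iso[OF that] by (simp add: N_def B_diff_left B_diff_right)
  have Nadjs: "B ((N ^^ i) u) ((g ^^ i) w) = (- 1) ^ i * B u ((N ^^ i) w)" if "u \<in> U" "w \<in> U" for i u w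
    using that
  proof (induction i arbitrary: u w)
    case (Suc i)
    have "B ((N ^^ Suc i) u) ((g ^^ Suc i) w) = B (N ((N ^^ i) u)) (g ((g ^^ i) w))" by simp
    also have "\<dots> = - B ((N ^^ i) u) (N ((g ^^ i) w))"
      by (rule Nadj[OF pwU[OF Suc.prems(1)] gpU[OF Suc.prems(2)]])
    also have "N ((g ^^ i) w) = (g ^^ i) (N w)" by (rule funpow_commute[symmetric]) (rule Ng[symmetric])
    also have "B ((N ^^ i) u) ((g ^^ i) (N w)) = (- 1) ^ i * B u ((N ^^ i) (N w))"
      by (rule Suc.IH[OF Suc.prems(1) NU[OF Suc.prems(2)]])
    finally show ?case by (simp add: funpow_swap1)
  qed simp
  have orth: "B w v = 0" if v: "v \<in> V" and w: "w \<in> W" for v w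
  proof -
    obtain v' where v': "v' \<in> V" "v = (g ^^ n) v'" using gpow[OF v] by blast
    have "B (E w) v = (- 1) ^ n * B w (E v')"
      unfolding E_def v'(2) using w v' VU by (intro Nadjs) auto
    thus ?thesis using w v' by (simp add: V_def W_def)
  qed
  have orth': "B v w = 0" if "v \<in> V" "w \<in> W" for v w using orth[OF that] B_swap[of v w] by simp
  have hV: "herm_space V" unfolding herm_space_def
  proof (intro conjI ballI impI)
    fix u assume u: "u \<in> V" "\<forall>v\<in>V. B u v = 0"
    have "B u v = 0" if "v \<in> U" for v
    proof -
      have "B u (v - E v) = 0" "B u (E v) = 0" using dec[OF that] u orth' by blast+
      thus ?thesis by (simp add: B_diff_right)
    qed
    thus "u = 0" using nd u VU by blast
  qed (use sV finV in auto)
  have hW: "herm_space W" unfolding herm_space_def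
  proof (intro conjI ballI impI)
    fix u assume u: "u \<in> W" "\<forall>v\<in>W. B u v = 0"
    have "B u v = 0" if "v \<in> U" for v
    proof -
      have "B u (v - E v) = 0" "B u (E v) = 0" using dec[OF that] u orth by blast+
      thus ?thesis by (simp add: B_diff_right)
    qed
    thus "u = 0" using nd u VU by blast
  qed (use sW finV in auto)
  have restr: "inverts V g s" "inverts W g s" if s: "inverts U g s" for s
  proof -
    have sU: "\<And>u. u \<in> U \<Longrightarrow> s u \<in> U" and add: "\<And>u v. u \<in> U \<Longrightarrow> v \<in> U \<Longrightarrow> s (u + v) = s u + s v"
      and sc: "\<And>c u. u \<in> U \<Longrightarrow> s (c *s u) = c *s s u" and inv: "\<And>u. u \<in> U \<Longrightarrow> g (s (g u)) = s u"
      using s unfolding inverts_def by blast+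
    have s0: "s 0 = 0" using sc[of 0 0] subspace_0[OF sub] by simp
    have sN: "s (N u) = (-1) *s N (s (g u))" if "u \<in> U" for u
    proof -
      have "s (g u + (-1) *s u) = s (g u) + (-1) *s s u"
        using add[OF gU[OF that] subspace_scale[OF sub that], of "-1"] sc[OF that, of "-1"] by simp
      thus ?thesis using inv[OF that] by (simp add: N_def)
    qed
    have sNs: "s ((N ^^ i) u) = ((-1) ^ i) *s (N ^^ i) (s ((g ^^ i) u))" if "u \<in> U" for i u
      using that
    proof (induction i arbitrary: u)
      case (Suc i)
      have "s ((N ^^ Suc i) u) = s (N ((N ^^ i) u))" by simp
      also have "\<dots> = (-1) *s N (s (g ((N ^^ i) u)))" by (rule sN[OF pwU[OF Suc.prems]])
      also have "g ((N ^^ i) u) = (N ^^ i) (g u)" by (rule funpow_commute[symmetric]) (rule Ng)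
      also have "s ((N ^^ i) (g u)) = ((-1) ^ i) *s (N ^^ i) (s ((g ^^ i) (g u)))"
        by (rule Suc.IH[OF gU[OF Suc.prems]])
      finally show ?case by (simp add: lin_scale[OF lN] funpow_swap1)
    qed simp
    have "s u \<in> V" if u: "u \<in> V" for u
    proof -
      obtain u' where u': "u' \<in> V" "u = (g ^^ n) u'" using gpow[OF u] by blast
      have "s (E u') = ((-1) ^ n) *s E (s u)" unfolding E_def u'(2) using u' VU by (intro sNs) auto
      hence "E (s u) = 0" using u' s0 by (simp add: V_def)
      thus ?thesis using sU u VU by (auto simp: V_def)
    qed
    moreover have "s u \<in> W" if u: "u \<in> W" for u
    proof -
      have uU: "u \<in> U" using u VU by blast
      have "s (E u) = ((-1) ^ n) *s E (s ((g ^^ n) u))" unfolding E_def by (rule sNs[OF uU])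
      hence "s u = ((-1) ^ n) *s E (s ((g ^^ n) u))" using u by (simp add: W_def)
      moreover have "E (s ((g ^^ n) u)) \<in> W" by (rule dec(2)[OF sU[OF gpU[OF uU]]])
      ultimately show ?thesis using subspace_scale[OF sW] by simp
    qed
    ultimately show "inverts V g s" "inverts W g s"
      using s VU unfolding inverts_def by blast+
  qed
  \<comment> \<open>on \<open>V\<close> the only eigenvalue of \<open>g\<close> is \<open>1\<close>, so \<open>- g\<close> does not have the eigenvalue \<open>1\<close>\<close>
  define g' where "g' = (\<lambda>v. - g v)"
  have inv': "inverts V g' s \<longleftrightarrow> inverts V g s" for s
  proof -
    have "g' (s (g' u)) = g (s (g u))" if "u \<in> V" "\<And>c u. u \<in> V \<Longrightarrow> s (c *s u) = c *s s u" for u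
      using that(2)[OF gV[OF that(1)], of "-1"] by (simp add: g'_def lin_minus[OF lg])
    thus ?thesis unfolding inverts_def by auto
  qed
  have isoV: "isometry_on V g'" unfolding isometry_on_def
  proof (intro conjI ballI)
    show "lin g'" using lg by (simp add: lin_def g'_def)
    show "g' u \<in> V" if "u \<in> V" for u unfolding g'_def using gV[OF that] subspace_neg[OF sV] by blast
    show "B (g' u) (g' v) = B u v" if "u \<in> V" "v \<in> V" for u v
      using iso VU that by (simp add: g'_def B_minus_left B_minus_right subset_iff)
  qed
  have isoW: "isometry_on W g" unfolding isometry_on_def using lg gW iso VU by blast
  have pker: "u = 0" if u: "u \<in> V" "P u = 0" for u
  proof -
    have "g u = - u" using u(2) by (simp add: P_def eq_neg_iff_add_eq_0)
    hence "N u = (-2) *s u"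
      by (simp add: N_def scale_left_distrib[of "-1" "-1", simplified])
    hence "(N ^^ i) u = ((-2) ^ i) *s u" for i by (induction i) (auto simp: lin_scale[OF lN])
    hence "E u = ((-2) ^ n) *s u" by (simp add: E_def)
    thus ?thesis using u(1) two_nz by (simp add: V_def)
  qed
  have nker: "u = 0" if u: "u \<in> W" "N u = 0" for u
  proof -
    obtain n' where "n = Suc n'" using n(1) by (cases n) auto
    hence "E u = 0" using u(2) lin_0[OF lin_funpow[OF lN]] by (simp add: E_def funpow_swap1)
    thus ?thesis using u(1) by (simp add: W_def)
  qed
  have kerV: "u \<in> V" if u: "u \<in> U" "(N ^^ j) u = 0" for u j
  proof -
    have "E ((N ^^ j) u) = (N ^^ j) (E u)" by (rule funpow_commute[symmetric]) (rule NE[symmetric])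
    hence z: "(N ^^ j) (E u) = 0" using u(2) lin_0[OF lE] by simp
    have w: "w = 0" if "w \<in> W" "(N ^^ i) w = 0" for w i
      using that
    proof (induction i)
      case (Suc i)
      have "(N ^^ i) w \<in> W"
        using Suc.prems(1) pwU funpow_commute[of N E i w] NE by (auto simp: W_def)
      thus ?case using nker[of "(N ^^ i) w"] Suc by simp
    qed simp
    have "E u = 0" by (rule w[OF dec(2)[OF u(1)] z])
    thus ?thesis using u by (simp add: V_def)
  qed
  have kerW: "u \<in> W" if u: "u \<in> U" "(P ^^ j) u = 0" for u j
  proof -
    have lj: "lin (P ^^ j)" by (rule lin_funpow[OF lP])
    have PE: "P (E v) = E (P v)" for v by (simp add: P_def Eg lin_add[OF lE])
    have "(P ^^ j) (E u) = E ((P ^^ j) u)" by (rule funpow_commute) (rule PE)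
    hence z: "(P ^^ j) (u - E u) = 0" using u(2) lin_0[OF lE] by (simp add: lin_diff[OF lj])
    have w: "w = 0" if "w \<in> V" "(P ^^ i) w = 0" for w i
      using that
    proof (induction i)
      case (Suc i)
      have "(P ^^ i) w \<in> U" using Suc.prems(1) VU gU subspace_add[OF sub]
        by (induction i) (auto simp: P_def subset_iff)
      moreover have "E ((P ^^ i) w) = 0"
        using Suc.prems(1) funpow_commute[of P E i w] PE lin_0[OF lin_funpow[OF lP]] by (auto simp: V_def)
      ultimately have "(P ^^ i) w \<in> V" by (simp add: V_def)
      thus ?case using pker[of "(P ^^ i) w"] Suc by simp
    qed simp
    have "u - E u = 0" by (rule w[OF dec(1)[OF u(1)] z])
    thus ?thesis using u by (simp add: W_def)
  qed
  have jV: "even_jumps U N \<longleftrightarrow> even_jumps V (\<lambda>v. g' v + v)"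
  proof -
    have "even_jumps U N \<longleftrightarrow> even_jumps V N" by (rule even_jumps_restrict[OF VU(1) kerV])
    also have "\<dots> \<longleftrightarrow> even_jumps V (\<lambda>v. g' v + v)"
    proof -
      have e: "(\<lambda>v. g' v + v) = (\<lambda>v. (-1) *s N v)" by (auto simp: g'_def N_def)
      have "((\<lambda>v. (-1) *s N v) ^^ j) u = ((-1) ^ j) *s (N ^^ j) u" for j u
        by (induction j) (simp_all add: lin_scale[OF lN])
      hence "((\<lambda>v. (-1) *s N v) ^^ j) u = 0 \<longleftrightarrow> (N ^^ j) u = 0" for j u by simp
      thus ?thesis unfolding even_jumps_def e by (simp only:)
    qed
    finally show ?thesis .
  qed
  have jW: "even_jumps U P \<longleftrightarrow> even_jumps W (\<lambda>v. g v + v)"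
    unfolding P_def[symmetric] by (rule even_jumps_restrict[OF VU(2) kerW])
  have cV: "(\<exists>s. inverts V g' s \<and> (\<forall>u\<in>V. s (s u) = u)) \<longleftrightarrow> even_jumps V (\<lambda>v. g' v + v)"
  proof (rule involution_iff_even_jumps_off_1[OF hV isoV])
    show "u = 0" if "u \<in> V" "g' u = u" for u
    proof (rule pker[OF that(1)])
      have "P u = g u + g' u" using that(2) by (simp add: P_def)
      thus "P u = 0" by (simp add: g'_def)
    qed
    show "inverts V g' h" unfolding inv' by (rule restr(1)[OF h])
  qed
  have cW: "(\<exists>s. inverts W g s \<and> (\<forall>u\<in>W. s (s u) = u)) \<longleftrightarrow> even_jumps W (\<lambda>v. g v + v)"
  proof (rule involution_iff_even_jumps_off_1[OF hW isoW])
    show "u = 0" if "u \<in> W" "g u = u" for u using nker[OF that(1)] that(2) by (simp add: N_def)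
    show "inverts W g h" by (rule restr(2)[OF h])
  qed
  have eV: "even_jumps U N \<longleftrightarrow> (\<exists>s. inverts V g s \<and> (\<forall>u\<in>V. s (s u) = u))"
    using jV cV unfolding inv' by blast
  have eW: "even_jumps U P \<longleftrightarrow> (\<exists>s. inverts W g s \<and> (\<forall>u\<in>W. s (s u) = u))"
    using jW cW by blast
  show ?thesis unfolding N_def[symmetric] P_def[symmetric] eV eW
  proof
    assume "\<exists>s. inverts U g s \<and> (\<forall>u\<in>U. s (s u) = u)"
    thus "(\<exists>s. inverts V g s \<and> (\<forall>u\<in>V. s (s u) = u)) \<and> (\<exists>s. inverts W g s \<and> (\<forall>u\<in>W. s (s u) = u))"
      using restr VU by blast
  next
    assume "(\<exists>s. inverts V g s \<and> (\<forall>u\<in>V. s (s u) = u)) \<and> (\<exists>s. inverts W g s \<and> (\<forall>u\<in>W. s (s u) = u))"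
    then obtain s1 s2 where s12: "inverts V g s1" "\<forall>u\<in>V. s1 (s1 u) = u" "inverts W g s2" "\<forall>u\<in>W. s2 (s2 u) = u" by blast
    show "\<exists>s. inverts U g s \<and> (\<forall>u\<in>U. s (s u) = u)"
      using involution_orthogonal_sum[OF dir orth' lg gV gW s12] by blast
  qed
qed

end

section \<open>Kernels of matrices and Jordan blocks\<close>

lemma card_mat_kernel:
  fixes A :: "'a :: {field, finite} mat"
  assumes A: "A \<in> carrier_mat nr nc"
  shows "card (mat_kernel A) = CARD('a) ^ kernel_dim A"
proof -
  interpret K: kernel nr nc A by unfold_locales (rule A)
  have fd: "K.Ker.fin_dim"
  proof -
    obtain P Q where PQ: "gauss_jordan_single A = P * A" "P \<in> carrier_mat nr nr" "Q \<in> carrier_mat nr nr"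
      "P * Q = 1\<^sub>m nr" "Q * P = 1\<^sub>m nr"
      and row: "row_echelon_form (gauss_jordan_single A)" and C: "gauss_jordan_single A \<in> carrier_mat nr nc"
      using gauss_jordan_single[OF A refl] by blast
    have k: "mat_kernel (gauss_jordan_single A) = mat_kernel A"
      unfolding PQ(1) by (rule mat_kernel_mult_eq[OF A PQ(2,3,5)])
    have "kernel.basis nc A (set (find_base_vectors (gauss_jordan_single A)))"
      using find_base_vectors(3)[OF row C] unfolding k .
    thus ?thesis using K.Ker.basis_def K.Ker.fin_dim_def by blast
  qed
  obtain b where b: "finite b" "K.Ker.basis b" using K.Ker.finite_basis_exists[OF fd] by blast
  have bc: "b \<subseteq> mat_kernel A" using b(2) by (simp add: K.Ker.basis_def)
  have cr: "\<forall>v. v \<in> mat_kernel A \<longrightarrow> (\<exists>!a. a \<in> PiE b (\<lambda>_. UNIV) \<and> K.Ker.lincomb a b = v)"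
    using K.Ker.basis_criterion[OF b(1) bc] b(2) by simp
  have "bij_betw (\<lambda>a. K.Ker.lincomb a b) (PiE b (\<lambda>_. UNIV)) (mat_kernel A)"
  proof (rule bij_betw_imageI)
    have mem: "K.Ker.lincomb a b \<in> mat_kernel A" for a using bc b(1) by (simp add: K.Ker.lincomb_closed)
    show "inj_on (\<lambda>a. K.Ker.lincomb a b) (PiE b (\<lambda>_. UNIV))"
      by (rule inj_onI) (use cr mem in metis)
    show "(\<lambda>a. K.Ker.lincomb a b) ` PiE b (\<lambda>_. UNIV) = mat_kernel A"
      using cr mem by blast
  qed
  hence "card (mat_kernel A) = card (PiE b (\<lambda>_. UNIV :: 'a set))" by (simp add: bij_betw_same_card)
  also have "\<dots> = CARD('a) ^ card b" by (rule card_funcsetE[OF b(1)])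
  also have "card b = kernel_dim A" using K.Ker.dim_basis[OF b] by simp
  finally show ?thesis .
qed

text \<open>The image of a row echelon form under an injective homomorphism is a row echelon form with the
  same nonzero rows.\<close>
lemma kernel_dim_map_mat:
  fixes A :: "'a :: field mat" and \<phi> :: "'a \<Rightarrow> 'b :: field"
  assumes hom: "inj_comm_ring_hom \<phi>" and A: "A \<in> carrier_mat nr nc"
  shows "kernel_dim (map_mat \<phi> A) = kernel_dim A"
proof -
  interpret inj_comm_ring_hom \<phi> by (rule hom)
  define C where "C = gauss_jordan_single A"
  obtain P Q where PQ: "C = P * A" "P \<in> carrier_mat nr nr" "Q \<in> carrier_mat nr nr" "Q * P = 1\<^sub>m nr"
    and row: "row_echelon_form C" and C: "C \<in> carrier_mat nr nc"
    using gauss_jordan_single[OF A refl] unfolding C_def by blast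
  have 1: "kernel_dim A = nc - card {i. i < nr \<and> row C i \<noteq> 0\<^sub>v nc}"
  proof -
    have "mat_kernel A = mat_kernel C" unfolding PQ(1) by (rule mat_kernel_mult_eq[OF A PQ(2-4), symmetric])
    hence "kernel_dim A = kernel.dim nc C" using A by (simp add: kernel_dim_def)
    thus ?thesis using find_base_vectors(6)[OF row C] by simp
  qed
  let ?A = "map_mat \<phi> A" and ?C = "map_mat \<phi> C" and ?P = "map_mat \<phi> P" and ?Q = "map_mat \<phi> Q"
  have c: "?A \<in> carrier_mat nr nc" "?C \<in> carrier_mat nr nc" "?P \<in> carrier_mat nr nr" "?Q \<in> carrier_mat nr nr"
    using A C PQ by auto
  have m: "?C = ?P * ?A" "?Q * ?P = 1\<^sub>m nr"
    using mat_hom_mult[OF PQ(2) A] mat_hom_mult[OF PQ(3,2)] PQ(1,4) by (simp_all add: mat_hom_one)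
  obtain f where f: "pivot_fun C f nc" using row C unfolding row_echelon_form_def by auto
  have dC: "dim_row C = nr" using C by simp
  note pf = pivot_funD[OF dC f]
  have "pivot_fun ?C f nc"
  proof (rule pivot_funI[of _ nr])
    show "dim_row ?C = nr" using c by simp
    show "f i \<le> nc" if "i < nr" for i using pf(1) that .
    show "?C $$ (i, j) = 0" if "i < nr" "j < f i" for i j
      using pf(2)[OF that] pf(1)[OF that(1)] that C by simp
    show "f i < f (Suc i) \<or> f (Suc i) = nc" if "i < nr" "Suc i < nr" for i using pf(3)[OF that] .
    show "?C $$ (i, f i) = 1" if "i < nr" "f i < nc" for i using pf(4)[OF that] that C by simp
    show "?C $$ (i', f i) = 0" if "i < nr" "f i < nc" "i' < nr" "i' \<noteq> i" for i i'
      using pf(5)[OF that] that C by simp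
  qed
  hence row': "row_echelon_form ?C" unfolding row_echelon_form_def using c by auto
  have "mat_kernel ?A = mat_kernel ?C" unfolding m(1) by (rule mat_kernel_mult_eq[OF c(1,3,4) m(2), symmetric])
  hence "kernel_dim ?A = kernel.dim nc ?C" using A by (simp add: kernel_dim_def)
  also have "\<dots> = nc - card {i. i < nr \<and> row ?C i \<noteq> 0\<^sub>v nc}" by (rule find_base_vectors(6)[OF row' c(2)])
  also have "{i. i < nr \<and> row ?C i \<noteq> 0\<^sub>v nc} = {i. i < nr \<and> row C i \<noteq> 0\<^sub>v nc}"
  proof -
    have "row ?C i = 0\<^sub>v nc \<longleftrightarrow> row C i = 0\<^sub>v nc" if "i < nr" for i
      using that C by (auto simp: vec_eq_iff)
    thus ?thesis by blast
  qed
  finally show ?thesis using 1 by simp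
qed

lemma inj_comm_ring_hom_to_ac: "inj_comm_ring_hom (to_ac :: 'a :: field \<Rightarrow> _)"
  by unfold_locales auto

text \<open>A Jordan block of size \<open>x\<close> for the eigenvalue \<open>e\<close> contributes \<open>min j x\<close> to \<open>d j\<close>, and the second
  difference of \<open>j \<mapsto> min j x\<close> vanishes except at \<open>j = x\<close>. The Jordan form lives over the algebraic
  closure, but the kernel dimensions may be taken over the ground field.\<close>
lemma elementary_divisor_mult_second_difference:
  fixes g :: "'a :: field mat" and e :: 'a
  assumes g: "g \<in> carrier_mat n n" and k: "k \<ge> 1"
  defines "d \<equiv> \<lambda>j. kernel_dim (char_matrix g e ^\<^sub>m j)"
  shows "d (k - 1) + d (k + 1) + elementary_divisor_mult g e k = 2 * d k"
proof -
  interpret inj_comm_ring_hom "to_ac :: 'a \<Rightarrow> _" by (rule inj_comm_ring_hom_to_ac)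
  let ?h = "map_mat to_ac g"
  have h: "?h \<in> carrier_mat n n" using g by simp
  obtain n_as where jnf: "jordan_nf ?h n_as" using jordan_nf_exists_alg_closed[OF h] by blast
  have ch: "char_matrix ?h (to_ac e) = map_mat to_ac (char_matrix g e)"
    using g by (intro eq_matI) (auto simp: char_matrix_def)
  have "dim_gen_eigenspace ?h (to_ac e) j = d j" for j
  proof -
    have "char_matrix ?h (to_ac e) ^\<^sub>m j = map_mat to_ac (char_matrix g e ^\<^sub>m j)"
      unfolding ch by (rule mat_hom_pow[symmetric, of _ n]) (use g in simp)
    thus ?thesis unfolding dim_gen_eigenspace_def d_def
      using kernel_dim_map_mat[OF inj_comm_ring_hom_to_ac pow_carrier_mat[OF char_matrix_closed[OF g]]] by simp
  qed
  hence dj: "d j = (\<Sum>x\<leftarrow>map fst [(n, e')\<leftarrow>n_as . e' = to_ac e]. min j x)" for j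
    using dim_gen_eigenspace[OF jnf, of "to_ac e" j] by simp
  have "(\<Sum>x\<leftarrow>map fst [(n, e')\<leftarrow>l . e' = a]. min (k - 1) x) + (\<Sum>x\<leftarrow>map fst [(n, e')\<leftarrow>l . e' = a]. min (k + 1) x)
      + count_list l (k, a) = 2 * (\<Sum>x\<leftarrow>map fst [(n, e')\<leftarrow>l . e' = a]. min k x)" for l and a :: "'a alg_closure"
    using k by (induction l) (auto simp: min_def)
  thus ?thesis unfolding dj elementary_divisor_mult_eq[OF jnf] .
qed

section \<open>Unitary matrices acting on coordinate functions\<close>

context
  fixes n q :: nat
begin

text \<open>Coordinate vectors are functions that vanish from \<open>n\<close> on. Unlike vectors with a dimension, functions
  form an additive group as a type, which is what \<open>herm\<close> asks for.\<close>
definition fscale :: "'a :: finite_field \<Rightarrow> (nat \<Rightarrow> 'a) \<Rightarrow> nat \<Rightarrow> 'a" where "fscale c v = (\<lambda>i. c * v i)"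
definition fform :: "(nat \<Rightarrow> 'a :: finite_field) \<Rightarrow> (nat \<Rightarrow> 'a) \<Rightarrow> 'a" where "fform u v = (\<Sum>i<n. u i * v i ^ q)"
definition fspace :: "(nat \<Rightarrow> 'a :: finite_field) set" where "fspace = {v. \<forall>i\<ge>n. v i = 0}"
definition fapp :: "'a :: finite_field mat \<Rightarrow> (nat \<Rightarrow> 'a) \<Rightarrow> nat \<Rightarrow> 'a" where
  "fapp A v = (\<lambda>i. if i < n then \<Sum>j<n. A $$ (i, j) * v j else 0)"
definition funit :: "nat \<Rightarrow> nat \<Rightarrow> 'a :: finite_field" where "funit j = (\<lambda>i. if i = j then 1 else 0)"

lemma fapp_in [simp]: "fapp A v \<in> fspace" by (simp add: fapp_def fspace_def)
lemma funit_in [simp]: "j < n \<Longrightarrow> funit j \<in> fspace" by (auto simp: funit_def fspace_def)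

lemma fapp_funit: assumes "j < n" shows "fapp A (funit j) = (\<lambda>i. if i < n then A $$ (i, j) else 0)"
  using assms by (auto simp: fapp_def funit_def if_distrib[of "(*) _"] cong: if_cong)

lemma fapp_mult:
  assumes "A \<in> carrier_mat n n" "C \<in> carrier_mat n n"
  shows "fapp (A * C) v = fapp A (fapp C v)"
proof
  fix i
  have "(\<Sum>j<n. (A * C) $$ (i, j) * v j) = (\<Sum>j<n. \<Sum>k<n. A $$ (i, k) * C $$ (k, j) * v j)" if "i < n"
    using assms that by (intro sum.cong) (auto simp: scalar_prod_def sum_distrib_right lessThan_atLeast0)
  also have "\<dots> = (\<Sum>k<n. \<Sum>j<n. A $$ (i, k) * C $$ (k, j) * v j)" by (rule sum.swap)
  also have "\<dots> = (\<Sum>k<n. A $$ (i, k) * (\<Sum>j<n. C $$ (k, j) * v j))"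
    by (simp add: sum_distrib_left mult.assoc)
  finally show "fapp (A * C) v i = fapp A (fapp C v) i" by (simp add: fapp_def)
qed

lemma fapp_one: "v \<in> fspace \<Longrightarrow> fapp (1\<^sub>m n) v = v"
  by (auto simp: fapp_def fspace_def if_distrib[of "\<lambda>x. x * _"] cong: if_cong)

lemma fapp_inj:
  assumes A: "A \<in> carrier_mat n n" "C \<in> carrier_mat n n" and e: "\<And>v. v \<in> fspace \<Longrightarrow> fapp A v = fapp C v"
  shows "A = C"
proof (rule eq_matI)
  fix i j assume "i < dim_row C" "j < dim_col C"
  hence ij: "i < n" "j < n" using A by auto
  thus "A $$ (i, j) = C $$ (i, j)" using fun_cong[OF e[OF funit_in[OF ij(2)]], of i] by (simp add: fapp_funit)
qed (use A in auto)

lemma finite_fspace: "finite fspace"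
proof -
  have "fspace \<subseteq> {v. \<forall>i. (i \<in> {..<n} \<longrightarrow> v i \<in> (UNIV :: 'a set)) \<and> (i \<notin> {..<n} \<longrightarrow> v i = 0)}"
    by (auto simp: fspace_def)
  moreover have "finite {v. \<forall>i. (i \<in> {..<n} \<longrightarrow> v i \<in> (UNIV :: 'a set)) \<and> (i \<notin> {..<n} \<longrightarrow> v i = 0)}"
    by (rule finite_set_of_finite_funs) auto
  ultimately show ?thesis by (rule finite_subset)
qed

lemma card_fapp_kernel:
  fixes A :: "'a :: finite_field mat"
  assumes A: "A \<in> carrier_mat n n"
  shows "card {v \<in> fspace. fapp A v = 0} = CARD('a) ^ kernel_dim A"
proof -
  have "bij_betw (\<lambda>v. vec n v) {v \<in> fspace. fapp A v = 0} (mat_kernel A)"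
  proof (rule bij_betwI')
    fix u v assume uv: "u \<in> {v \<in> fspace. fapp A v = 0}" "v \<in> {v \<in> fspace. fapp A v = 0}"
    show "(vec n u = vec n v) = (u = v)"
    proof
      assume e: "vec n u = vec n v"
      show "u = v"
      proof
        fix i show "u i = v i"
          using arg_cong[OF e, of "\<lambda>w. vec_index w i"] uv by (cases "i < n") (auto simp: fspace_def)
      qed
    qed simp
  next
    fix v assume v: "v \<in> {v \<in> fspace. fapp A v = 0}"
    have "(A *\<^sub>v vec n v) $ i = fapp A v i" if "i < n" for i
      using A that by (simp add: fapp_def scalar_prod_def lessThan_atLeast0)
    hence "A *\<^sub>v vec n v = 0\<^sub>v n" using A v by (intro eq_vecI) auto
    thus "vec n v \<in> mat_kernel A" using A by (intro mat_kernelI[of _ n n]) auto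
  next
    fix w assume "w \<in> mat_kernel A"
    hence w: "w \<in> carrier_vec n" "A *\<^sub>v w = 0\<^sub>v n" using mat_kernelD[OF A] by auto
    define v where "v = (\<lambda>i. if i < n then w $ i else 0)"
    have "fapp A v i = 0" for i
    proof (cases "i < n")
      case True
      have "fapp A v i = (A *\<^sub>v w) $ i"
        using A w(1) True by (simp add: fapp_def v_def scalar_prod_def lessThan_atLeast0)
      thus ?thesis using w True by simp
    qed (simp add: fapp_def)
    hence "fapp A v = 0" by auto
    moreover have "v \<in> fspace" by (simp add: v_def fspace_def)
    moreover have "w = vec n v" using w by (intro eq_vecI) (auto simp: v_def)
    ultimately show "\<exists>v\<in>{v \<in> fspace. fapp A v = 0}. w = vec n v" by blast
  qed
  from bij_betw_same_card[OF this] show ?thesis using card_mat_kernel[OF A] by simp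
qed

lemma fapp_pow:
  assumes A: "A \<in> carrier_mat n n" and D: "\<And>v. v \<in> fspace \<Longrightarrow> D v = fapp A v" and v: "v \<in> fspace"
  shows "(D ^^ k) v = fapp (A ^\<^sub>m k) v"
  using v
proof (induction k arbitrary: v)
  case 0
  thus ?case using A by (simp add: fapp_one)
next
  case (Suc k)
  have "(D ^^ Suc k) v = (D ^^ k) (fapp A v)" by (simp add: funpow_swap1 D[OF Suc.prems])
  also have "\<dots> = fapp (A ^\<^sub>m k) (fapp A v)" by (rule Suc.IH) simp
  also have "\<dots> = fapp (A ^\<^sub>m k * A) v" by (rule fapp_mult[symmetric, OF pow_carrier_mat[OF A] A])
  finally show ?case by simp
qed

end

lemma ex_power_ne:
  assumes "1 < q" "q < CARD('a :: {field, finite})"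
  shows "\<exists>a :: 'a. a ^ q \<noteq> a"
proof (rule ccontr)
  assume n: "\<nexists>a :: 'a. a ^ q \<noteq> a"
  define p :: "'a poly" where "p = Polynomial.monom 1 q - Polynomial.monom 1 1"
  have c: "poly.coeff p q = 1" using assms(1) by (simp add: p_def)
  hence pnz: "p \<noteq> 0" by auto
  have "{x. Polynomial.poly p x = 0} = UNIV" using n by (auto simp: p_def poly_monom)
  hence "CARD('a) \<le> deg p" using card_poly_roots_bound[OF pnz] by simp
  also have "deg p \<le> q" using assms(1) unfolding p_def
    by (intro degree_diff_le) (auto simp: degree_monom_eq)
  finally show False using assms(2) by simp
qed

text \<open>Any \<open>a\<close> outside the fixed field yields the imaginary unit \<open>a - a\<^sup>q\<close>.\<close>
lemma herm_fform:
  assumes p: "Factorial_Ring.prime p" "odd p" and q: "q = p ^ k" and card: "CARD('a :: finite_field) = q\<^sup>2"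
  shows "\<exists>\<iota>. herm (\<lambda>a :: 'a. a ^ q) \<iota> fscale (fform n q)"
proof -
  let ?bar = "\<lambda>a :: 'a. a ^ q"
  have pr: "Factorial_Ring.prime CHAR('a)" by (rule prime_CHAR_semidom) (rule finite_imp_CHAR_pos, simp)
  have "CHAR('a) dvd q\<^sup>2" using CHAR_dvd_CARD[where 'a = 'a] card by simp
  hence char: "CHAR('a) = p" using q p pr by (metis prime_dvd_power primes_dvd_imp_eq)
  have add: "?bar (a + b) = ?bar a + ?bar b" for a b
    by (rule freshmans_dream'[OF pr, of q k]) (simp add: char q)
  have oddq: "odd q" using p q by simp
  hence q0: "q > 0" by (cases q) auto
  have bb: "?bar (?bar a) = a" for a
    using finite_field_power_card_eq_same[of a] card by (simp add: power2_eq_square power_mult)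
  have "1 < CARD('a)"
  proof -
    have "card {0, 1 :: 'a} \<le> CARD('a)" by (intro card_mono) auto
    thus ?thesis by simp
  qed
  hence "1 < q" using card q0 by (cases "q = 1") auto
  moreover from this have "q < CARD('a)" unfolding card power2_eq_square by simp
  ultimately obtain a :: 'a where a: "?bar a \<noteq> a" using ex_power_ne by blast
  define \<iota> where "\<iota> = a - ?bar a"
  have minus: "?bar (- b) = - ?bar b" for b using oddq by (simp add: power_minus_odd)
  have "?bar \<iota> = ?bar (a + - ?bar a)" by (simp add: \<iota>_def)
  also have "\<dots> = - \<iota>" unfolding add minus bb by (simp add: \<iota>_def)
  finally have i1: "?bar \<iota> = - \<iota>" .
  have i2: "\<iota> \<noteq> 0" using a by (simp add: \<iota>_def)
  have two: "(2 :: 'a) \<noteq> 0"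
  proof
    assume "(2 :: 'a) = 0"
    hence "of_nat 2 = (0 :: 'a)" by simp
    hence "CHAR('a) dvd 2" by (simp only: of_nat_eq_0_iff_char_dvd)
    hence "p = 2" using char p by (metis primes_dvd_imp_eq two_is_prime_nat)
    thus False using p by simp
  qed
  have sum: "(\<Sum>i\<in>I. f i) ^ q = (\<Sum>i\<in>I. f i ^ q)" for f :: "nat \<Rightarrow> 'a" and I
    using q0 by (induction I rule: infinite_finite_induct) (auto simp: add)
  have "herm ?bar \<iota> fscale (fform n q)"
  proof unfold_locales
    show "?bar (a + b) = ?bar a + ?bar b" for a b by (rule add)
    show "?bar (a * b) = ?bar a * ?bar b" for a b by (rule power_mult_distrib)
    show "?bar (?bar a) = a" for a by (rule bb)
    show "?bar \<iota> = - \<iota>" by (rule i1)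
    show "\<iota> \<noteq> 0" by (rule i2)
    show "(2 :: 'a) \<noteq> 0" by (rule two)
    show "fscale c (u + v) = fscale c u + fscale c v" for c and u v :: "nat \<Rightarrow> 'a"
      by (auto simp: fscale_def distrib_left)
    show "fscale (c + d) u = fscale c u + fscale d u" for c d and u :: "nat \<Rightarrow> 'a"
      by (auto simp: fscale_def distrib_right)
    show "fscale c (fscale d u) = fscale (c * d) u" for c d and u :: "nat \<Rightarrow> 'a"
      by (auto simp: fscale_def mult.assoc)
    show "fscale 1 u = u" for u :: "nat \<Rightarrow> 'a" by (auto simp: fscale_def)
    show "fform n q (u + v) w = fform n q u w + fform n q v w" for u v w :: "nat \<Rightarrow> 'a"
      by (simp add: fform_def distrib_right sum.distrib)
    show "fform n q (fscale c u) w = c * fform n q u w" for c and u w :: "nat \<Rightarrow> 'a"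
      by (simp add: fform_def fscale_def sum_distrib_left mult.assoc)
    show "fform n q v u = ?bar (fform n q u v)" for u v :: "nat \<Rightarrow> 'a"
      unfolding fform_def sum power_mult_distrib bb by (simp add: mult.commute)
  qed
  thus ?thesis by blast
qed

lemma fform_funit:
  assumes "i < n" "j < n" "q > 0"
  shows "fform n q (fapp n A (funit i)) (fapp n A (funit j))
    = (\<Sum>k<n. A $$ (k, i) * (A $$ (k, j)) ^ q)"
  unfolding fform_def by (rule sum.cong) (use assms in \<open>auto simp: fapp_funit\<close>)

lemma unitary_entries:
  fixes A :: "'a :: finite_field mat"
  assumes A: "A \<in> carrier_mat n n" and q: "q > 0"
  shows "transpose_mat (bar_mat q A) * A = 1\<^sub>m n \<longleftrightarrow>
    (\<forall>i<n. \<forall>j<n. (\<Sum>k<n. A $$ (k, i) * (A $$ (k, j)) ^ q) = (if i = j then 1 else 0))"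
proof -
  have e: "(transpose_mat (bar_mat q A) * A) $$ (j, i) = (\<Sum>k<n. A $$ (k, i) * (A $$ (k, j)) ^ q)"
    if "i < n" "j < n" for i j
    using A that by (simp add: bar_mat_def scalar_prod_def lessThan_atLeast0 mult.commute)
  have d: "dim_row (transpose_mat (bar_mat q A) * A) = n" "dim_col (transpose_mat (bar_mat q A) * A) = n"
    using A by (auto simp: bar_mat_def)
  show ?thesis unfolding mat_eq_iff d using e by auto
qed

lemma carrier_unitary_iff:
  fixes A :: "'a :: finite_field mat"
  assumes "Factorial_Ring.prime p" "q = p ^ k" "CARD('a) = q\<^sup>2"
  shows "A \<in> carrier (unitary_group n q) \<longleftrightarrow> A \<in> carrier_mat n n \<and> transpose_mat (bar_mat q A) * A = 1\<^sub>m n"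
proof -
  have "det A \<noteq> 0" if A: "A \<in> carrier_mat n n" and u: "transpose_mat (bar_mat q A) * A = 1\<^sub>m n"
  proof -
    have "transpose_mat (bar_mat q A) \<in> carrier_mat n n" using A by (simp add: bar_mat_def)
    hence "det (transpose_mat (bar_mat q A)) * det A = det (1\<^sub>m n :: 'a mat)"
      using det_mult[of _ n A] A u by metis
    thus ?thesis by auto
  qed
  thus ?thesis unfolding unitary_group_def by (auto simp: carrier_GL_iff)
qed

context herm
begin

lemma B_sum_left: "B (\<Sum>j\<in>J. f j) w = (\<Sum>j\<in>J. B (f j) w)"
  by (induction J rule: infinite_finite_induct) (auto simp: B_add_left)

lemma B_sum_right: "B w (\<Sum>j\<in>J. f j) = (\<Sum>j\<in>J. B w (f j))"
  by (induction J rule: infinite_finite_induct) (auto simp: B_add_right)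

lemma additive_sum:
  assumes U: "subspace U" and add: "\<And>u v. u \<in> U \<Longrightarrow> v \<in> U \<Longrightarrow> s (u + v) = s u + s v"
    and sc: "\<And>c u. u \<in> U \<Longrightarrow> s (c *s u) = c *s s u" and f: "\<And>j. j \<in> J \<Longrightarrow> f j \<in> U" and "finite J"
  shows "s (\<Sum>j\<in>J. c j *s f j) = (\<Sum>j\<in>J. c j *s s (f j))"
  using \<open>finite J\<close> f
proof (induction J rule: finite_induct)
  case empty
  show ?case using sc[of 0 0] subspace_0[OF U] by simp
next
  case (insert i J)
  have "(\<Sum>j\<in>J. c j *s f j) \<in> U" by (rule subspace_sum[OF U]) (use insert.prems subspace_scale[OF U] in auto)
  moreover have "c i *s f i \<in> U" using insert.prems subspace_scale[OF U] by auto
  ultimately show ?case using insert by (simp add: add sc)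
qed

lemma isometry_of_frame:
  assumes U: "subspace U" and add: "\<And>u v. u \<in> U \<Longrightarrow> v \<in> U \<Longrightarrow> s (u + v) = s u + s v"
    and sc: "\<And>c u. u \<in> U \<Longrightarrow> s (c *s u) = c *s s u" and e: "\<And>j. j \<in> J \<Longrightarrow> e j \<in> U" and J: "finite J"
    and iso: "\<And>i j. i \<in> J \<Longrightarrow> j \<in> J \<Longrightarrow> B (s (e i)) (s (e j)) = B (e i) (e j)"
    and u: "u = (\<Sum>j\<in>J. a j *s e j)" and v: "v = (\<Sum>j\<in>J. b j *s e j)"
  shows "B (s u) (s v) = B u v"
proof -
  have su: "s u = (\<Sum>j\<in>J. a j *s s (e j))" unfolding u by (rule additive_sum[OF U add sc e J])
  have sv: "s v = (\<Sum>j\<in>J. b j *s s (e j))" unfolding v by (rule additive_sum[OF U add sc e J])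
  show ?thesis unfolding su sv unfolding u v
    unfolding B_sum_left B_sum_right B_scale_left B_scale_right
    by (intro sum.cong refl) (simp add: iso)
qed

end

lemma sum_fun_apply: "(\<Sum>j\<in>J. f j) i = (\<Sum>j\<in>J. f j i :: 'b :: comm_monoid_add)"
  by (induction J rule: infinite_finite_induct) auto

lemma fspace_expand:
  assumes "v \<in> fspace n" shows "v = (\<Sum>j<n. fscale (v j) (funit j))"
proof
  fix i
  have "(\<Sum>j<n. v j * (if i = j then 1 else 0)) = v i"
    using assms by (simp add: fspace_def if_distrib[of "(*) _"] cong: if_cong)
  thus "v i = (\<Sum>j<n. fscale (v j) (funit j)) i" by (simp add: sum_fun_apply fscale_def funit_def)
qed

text \<open>Unitary matrices act on coordinate functions by isometries, and an isometry is the action of the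
  matrix formed from its values on the unit vectors. The parity conditions for \<open>g - 1\<close> and \<open>g + 1\<close> turn
  into those on the elementary divisors.\<close>
theorem theorem5p1:
  fixes g :: "'a :: finite_field mat" and p k q n :: nat
  assumes "Factorial_Ring.prime p" and "odd p" and "k \<ge> 1" and "q = p ^ k"
    and "CARD('a) = q\<^sup>2"
    and "n \<ge> 1"
    and "real_in (unitary_group n q) g"
  shows "strongly_real_in (unitary_group n q) g \<longleftrightarrow>
    (\<forall>m \<ge> 1. even (elementary_divisor_mult g 1 (2 * m)) \<and>
             even (elementary_divisor_mult g (-1) (2 * m)))"
proof -
  let ?G = "unitary_group n q :: 'a mat monoid" and ?U = "fspace n :: (nat \<Rightarrow> 'a) set"
  let ?T = "fapp n :: 'a mat \<Rightarrow> _" and ?e = "funit :: nat \<Rightarrow> nat \<Rightarrow> 'a"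
  note params = assms(1,4,5)
  obtain \<iota> where h: "herm (\<lambda>a :: 'a. a ^ q) \<iota> fscale (fform n q)" using herm_fform[OF assms(1,2,4,5)] by blast
  interpret H: herm "\<lambda>a :: 'a. a ^ q" \<iota> fscale "fform n q" by (rule h)
  interpret G: group ?G by (rule group_unitary_group[OF params])
  have q0: "q > 0" using assms(1,4) by (simp add: prime_gt_0_nat)
  have Gs: "x \<otimes>\<^bsub>?G\<^esub> y = x * y" "\<one>\<^bsub>?G\<^esub> = 1\<^sub>m n" for x y by (simp_all add: unitary_group_def GL_simps)
  note cG = carrier_unitary_iff[OF params, of _ n]
  have subU: "H.subspace ?U" by (rule H.subspaceI) (auto simp: fspace_def fscale_def)
  have frame: "fform n q (?e i) (?e j) = (if i = j then 1 else 0)" if "i < n" "j < n" for i j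
  proof -
    have "fform n q (?e i) (?e j) = (\<Sum>k<n. (if k = i then if i = j then 1 else 0 else 0))"
      unfolding fform_def funit_def using q0 by (intro sum.cong) auto
    thus ?thesis using that by simp
  qed
  have hs: "H.herm_space ?U" unfolding H.herm_space_def
  proof (intro conjI ballI impI)
    show "H.subspace ?U" by (rule subU)
    show "finite ?U" by (rule finite_fspace)
    fix u assume u: "u \<in> ?U" "\<forall>v\<in>?U. fform n q u v = 0"
    show "u = 0"
    proof
      fix i show "u i = 0 i"
      proof (cases "i < n")
        case True
        have "fform n q u (?e i) = (\<Sum>k<n. if k = i then u i else 0)"
          unfolding fform_def funit_def using q0 by (intro sum.cong) auto
        thus ?thesis using u(2) True by auto
      qed (use u(1) in \<open>simp add: fspace_def\<close>)
    qed
  qed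
  have linT: "H.lin (?T A)" for A
    unfolding H.lin_def by (auto simp: fun_eq_iff fapp_def fscale_def distrib_left distrib_right sum.distrib sum_distrib_left mult_ac)
  have Tadd: "?T A (u + v) = ?T A u + ?T A v" for A u v by (rule H.lin_add[OF linT])
  have Tsc: "?T A (fscale c u) = fscale c (?T A u)" for A c u by (rule H.lin_scale[OF linT])
  have isoT: "H.isometry_on ?U (?T A)" if A: "A \<in> carrier ?G" for A
  proof -
    have Ac: "A \<in> carrier_mat n n" and Au: "transpose_mat (bar_mat q A) * A = 1\<^sub>m n" using A cG by blast+
    have b: "fform n q (?T A (?e i)) (?T A (?e j)) = fform n q (?e i) (?e j)"
      if "i \<in> {..<n}" "j \<in> {..<n}" for i j
      using unitary_entries[OF Ac q0] Au that by (simp add: fform_funit q0 frame)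
    have "fform n q (?T A u) (?T A v) = fform n q u v" if "u \<in> ?U" "v \<in> ?U" for u v
      by (rule H.isometry_of_frame[OF subU Tadd Tsc _ _ b fspace_expand[OF that(1)] fspace_expand[OF that(2)]]) simp_all
    thus ?thesis unfolding H.isometry_on_def using linT by simp
  qed
  have invT: "H.inverts ?U (?T g) (?T A) \<longleftrightarrow> g * A * g = A" if A: "A \<in> carrier ?G" and g: "g \<in> carrier ?G" for A
  proof -
    have c: "A \<in> carrier_mat n n" "g \<in> carrier_mat n n" using A g cG by blast+
    have e: "?T g (?T A (?T g u)) = ?T (g * A * g) u" for u
      using c by (simp add: fapp_mult)
    have "(\<forall>u\<in>?U. ?T (g * A * g) u = ?T A u) \<longleftrightarrow> g * A * g = A"
      using fapp_inj[of "g * A * g" n A] c by auto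
    moreover have "H.inverts ?U (?T g) (?T A) \<longleftrightarrow> (\<forall>u\<in>?U. ?T (g * A * g) u = ?T A u)"
      using isoT[OF A] Tadd Tsc unfolding H.inverts_def H.isometry_on_def e by blast
    ultimately show ?thesis by blast
  qed
  have gG: "g \<in> carrier ?G" using assms(7) by (simp add: real_in_def)
  have gc: "g \<in> carrier_mat n n" using gG cG by blast
  obtain A where A: "A \<in> carrier ?G" "A \<otimes>\<^bsub>?G\<^esub> g \<otimes>\<^bsub>?G\<^esub> inv\<^bsub>?G\<^esub> A = inv\<^bsub>?G\<^esub> g"
    using assms(7) unfolding real_in_def by blast
  have "g * A * g = A"
  proof -
    have "A \<otimes>\<^bsub>?G\<^esub> g = inv\<^bsub>?G\<^esub> g \<otimes>\<^bsub>?G\<^esub> A"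
      using A gG by (metis G.inv_closed G.inv_solve_right' G.m_closed)
    hence "g \<otimes>\<^bsub>?G\<^esub> (A \<otimes>\<^bsub>?G\<^esub> g) = A" using A gG by (simp add: G.m_assoc[symmetric])
    hence "g \<otimes>\<^bsub>?G\<^esub> A \<otimes>\<^bsub>?G\<^esub> g = A" using G.m_assoc[OF gG A(1) gG] by simp
    thus ?thesis by (simp only: Gs)
  qed
  hence inv: "H.inverts ?U (?T g) (?T A)" using invT[OF A(1) gG] by blast
  have sr: "strongly_real_in ?G g \<longleftrightarrow> (\<exists>S\<in>carrier ?G. S * S = 1\<^sub>m n \<and> g * S * g = S)"
  proof -
    have "S [^]\<^bsub>?G\<^esub> (2::nat) = \<one>\<^bsub>?G\<^esub> \<and> S \<otimes>\<^bsub>?G\<^esub> g \<otimes>\<^bsub>?G\<^esub> S = inv\<^bsub>?G\<^esub> g \<longleftrightarrow> S * S = 1\<^sub>m n \<and> g * S * g = S"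
      if S: "S \<in> carrier ?G" for S
    proof -
      have pw: "S [^]\<^bsub>?G\<^esub> (2::nat) = S \<otimes>\<^bsub>?G\<^esub> S" using S by (simp add: numeral_2_eq_2)
      have "S \<otimes>\<^bsub>?G\<^esub> g \<otimes>\<^bsub>?G\<^esub> S = inv\<^bsub>?G\<^esub> g \<longleftrightarrow> g \<otimes>\<^bsub>?G\<^esub> S \<otimes>\<^bsub>?G\<^esub> g = S" if SS: "S \<otimes>\<^bsub>?G\<^esub> S = \<one>\<^bsub>?G\<^esub>"
      proof -
        have iS: "inv\<^bsub>?G\<^esub> S = S" using SS S by (simp add: G.inv_equality)
        have "S \<otimes>\<^bsub>?G\<^esub> g \<otimes>\<^bsub>?G\<^esub> S = inv\<^bsub>?G\<^esub> g \<longleftrightarrow> S \<otimes>\<^bsub>?G\<^esub> g = inv\<^bsub>?G\<^esub> g \<otimes>\<^bsub>?G\<^esub> S"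
          using S gG iS G.inv_solve_right'[of "inv\<^bsub>?G\<^esub> g" "S \<otimes>\<^bsub>?G\<^esub> g" S] by auto
        also have "\<dots> \<longleftrightarrow> g \<otimes>\<^bsub>?G\<^esub> (S \<otimes>\<^bsub>?G\<^esub> g) = S"
          using S gG G.inv_solve_left[of "S \<otimes>\<^bsub>?G\<^esub> g" g S] by auto
        finally show ?thesis using S gG by (simp add: G.m_assoc)
      qed
      thus ?thesis unfolding pw by (auto simp: Gs)
    qed
    thus ?thesis unfolding strongly_real_in_def using gG by blast
  qed
  have ex: "(\<exists>S\<in>carrier ?G. S * S = 1\<^sub>m n \<and> g * S * g = S)
      \<longleftrightarrow> (\<exists>s. H.inverts ?U (?T g) s \<and> (\<forall>u\<in>?U. s (s u) = u))"
  proof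
    assume "\<exists>S\<in>carrier ?G. S * S = 1\<^sub>m n \<and> g * S * g = S"
    then obtain S where S: "S \<in> carrier ?G" "S * S = 1\<^sub>m n" "g * S * g = S" by blast
    have Sc: "S \<in> carrier_mat n n" using S(1) cG by blast
    have "?T S (?T S u) = u" if "u \<in> ?U" for u
      using fapp_mult[OF Sc Sc, of u] S(2) fapp_one[OF that] by simp
    moreover have "H.inverts ?U (?T g) (?T S)" using invT[OF S(1) gG] S(3) by blast
    ultimately show "\<exists>s. H.inverts ?U (?T g) s \<and> (\<forall>u\<in>?U. s (s u) = u)" by blast
  next
    assume "\<exists>s. H.inverts ?U (?T g) s \<and> (\<forall>u\<in>?U. s (s u) = u)"
    then obtain s where s: "H.inverts ?U (?T g) s" "\<forall>u\<in>?U. s (s u) = u" by blast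
    have sU: "\<And>u. u \<in> ?U \<Longrightarrow> s u \<in> ?U" and add: "\<And>u v. u \<in> ?U \<Longrightarrow> v \<in> ?U \<Longrightarrow> s (u + v) = s u + s v"
      and sc: "\<And>c u. u \<in> ?U \<Longrightarrow> s (fscale c u) = fscale c (s u)"
      and iso: "\<And>u v. u \<in> ?U \<Longrightarrow> v \<in> ?U \<Longrightarrow> fform n q (s u) (s v) = fform n q u v"
      and inv: "\<And>u. u \<in> ?U \<Longrightarrow> ?T g (s (?T g u)) = s u"
      using s(1) unfolding H.inverts_def by blast+
    define S where "S = mat n n (\<lambda>(i, j). s (?e j) i)"
    have Sc: "S \<in> carrier_mat n n" by (simp add: S_def)
    have Se: "?T S (?e j) = s (?e j)" if "j < n" for j
      using sU[OF funit_in[OF that]] that by (auto simp: fapp_funit S_def fspace_def)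
    have Ss: "?T S u = s u" if u: "u \<in> ?U" for u
    proof -
      have "s u = s (\<Sum>j<n. fscale (u j) (?e j))" using fspace_expand[OF u] by simp
      also have "\<dots> = (\<Sum>j<n. fscale (u j) (s (?e j)))"
        by (rule H.additive_sum[OF subU add sc]) auto
      also have "\<dots> = (\<Sum>j<n. fscale (u j) (?T S (?e j)))" by (rule sum.cong) (auto simp: Se)
      also have "\<dots> = ?T S (\<Sum>j<n. fscale (u j) (?e j))"
        by (simp add: H.lin_sum[OF linT] H.lin_scale[OF linT])
      also have "\<dots> = ?T S u" using fspace_expand[OF u] by simp
      finally show ?thesis by simp
    qed
    have "(\<Sum>k<n. S $$ (k, i) * (S $$ (k, j)) ^ q) = (if i = j then 1 else 0)" if "i < n" "j < n" for i j
    proof -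
      have "(\<Sum>k<n. S $$ (k, i) * (S $$ (k, j)) ^ q) = fform n q (s (?e i)) (s (?e j))"
        using fform_funit[OF that q0, of S] that by (simp add: Se)
      also have "\<dots> = fform n q (?e i) (?e j)" by (rule iso) (use that in auto)
      finally show ?thesis using frame[OF that] by simp
    qed
    hence SG: "S \<in> carrier ?G" using unitary_entries[OF Sc q0] Sc cG by blast
    have "S * S = 1\<^sub>m n"
    proof (rule fapp_inj)
      show "?T (S * S) v = ?T (1\<^sub>m n) v" if "v \<in> ?U" for v
        unfolding fapp_mult[OF Sc Sc] fapp_one[OF that] Ss[OF that] Ss[OF sU[OF that]] using s(2) that by blast
    qed (use Sc in auto)
    moreover have "H.inverts ?U (?T g) (?T S)"
      using isoT[OF SG] inv Tadd Tsc Ss unfolding H.inverts_def H.isometry_on_def by simp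
    hence "g * S * g = S" using invT[OF SG gG] by blast
    ultimately show "\<exists>S\<in>carrier ?G. S * S = 1\<^sub>m n \<and> g * S * g = S" using SG by blast
  qed
  have jumps: "H.even_jumps ?U D \<longleftrightarrow> (\<forall>m\<ge>1. even (elementary_divisor_mult g e (2 * m)))"
    if D: "\<And>v. v \<in> ?U \<Longrightarrow> D v = ?T (char_matrix g e) v" for D e
  proof -
    let ?C = "char_matrix g e"
    have Cc: "?C \<in> carrier_mat n n" using gc by simp
    have fd: "H.fdim {u \<in> ?U. (D ^^ j) u = 0} = kernel_dim (?C ^\<^sub>m j)" for j
    proof (rule H.fdim_eqI)
      have "{u \<in> ?U. (D ^^ j) u = 0} = {u \<in> ?U. ?T (?C ^\<^sub>m j) u = 0}"
        using fapp_pow[OF Cc D] by auto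
      thus "card {u \<in> ?U. (D ^^ j) u = 0} = CARD('a) ^ kernel_dim (?C ^\<^sub>m j)"
        using card_fapp_kernel[OF pow_carrier_mat[OF Cc], of j] by simp
    qed
    have "even (kernel_dim (?C ^\<^sub>m (2 * m - 1)) + kernel_dim (?C ^\<^sub>m (2 * m + 1)))
        \<longleftrightarrow> even (elementary_divisor_mult g e (2 * m))" if "m \<ge> 1" for m
    proof -
      have "1 \<le> 2 * m" using that by simp
      from elementary_divisor_mult_second_difference[OF gc this, of e]
      have "even (kernel_dim (?C ^\<^sub>m (2 * m - 1)) + kernel_dim (?C ^\<^sub>m (2 * m + 1)) + elementary_divisor_mult g e (2 * m))"
        by (metis dvd_triv_left)
      thus ?thesis by presburger
    qed
    thus ?thesis unfolding H.even_jumps_def fd by blast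
  qed
  have char: "?T (char_matrix g e) v = ?T g v - fscale e v" if "v \<in> ?U" for e v
  proof
    fix i
    have "(\<Sum>j<n. char_matrix g e $$ (i, j) * v j) = (\<Sum>j<n. g $$ (i, j) * v j) - e * v i" if i: "i < n"
    proof -
      have "(\<Sum>j<n. char_matrix g e $$ (i, j) * v j) = (\<Sum>j<n. g $$ (i, j) * v j - (if j = i then e * v i else 0))"
        using gc i by (intro sum.cong) (auto simp: char_matrix_def algebra_simps)
      thus ?thesis using i by (simp add: sum_subtractf)
    qed
    thus "?T (char_matrix g e) v i = (?T g v - fscale e v) i"
      using that by (auto simp: fapp_def fscale_def fspace_def)
  qed
  have j1: "H.even_jumps ?U (\<lambda>v. ?T g v - v) \<longleftrightarrow> (\<forall>m\<ge>1. even (elementary_divisor_mult g 1 (2 * m)))"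
    by (rule jumps) (simp add: char H.scale_one)
  have j2: "H.even_jumps ?U (\<lambda>v. ?T g v + v) \<longleftrightarrow> (\<forall>m\<ge>1. even (elementary_divisor_mult g (- 1) (2 * m)))"
    by (rule jumps) (simp add: char)
  show ?thesis
    unfolding sr ex H.involution_iff_even_jumps[OF hs isoT[OF gG] inv] j1 j2 by blast
qed

end
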